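(* Let $S=(-\frac{\pi}{2},\frac{\pi}{2})^2\subset\mathbb{R}^2$. There exists $h^*<0$ such that for every $h<h^*$ and every $k\ge 6$, if the eigenvalue $\lambda_{k,h}(S)$ of the Robin Laplacian on $S$ with parameter $h$ is negative, then $\lambda_{k,h}(S)$ is not Courant-sharp.
   Context: For $h\in\mathbb{R}$, the eigenvalues of the Robin Laplacian on $S$ with parameter $h$ are the numbers $\lambda_{1,h}(S)\le\lambda_{2,h}(S)\le\dots$ (listed in nondecreasing order, repeated according to multiplicity, indexed from $1$) for which there is a nonzero $u\in H^1(S)$ with $-\Delta u=\lambda_{k,h}(S)u$ in $S$ and $\frac{\partial u}{\partial\nu}+hu=0$ on $\partial S$, where $\nu$ is the outward-pointing unit normal. (The associated quadratic form is $u\mapsto\int_S|\nabla u|^2+h\int_{\partial S}|u|^2\,d\sigma$ on $H^1(S)$.) A nodal domain of an eigenfunction $u$ is a connected component of $S\setminus u^{-1}(0)$. The eigenvalue $\lambda_{k,h}(S)$ is called Courant-sharp if it has a corresponding eigenfunction with exactly $k$ nodal domains. *)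

theory Defs
  imports "HOL-Analysis.Analysis"
begin

section \<open>The square, its area measure and its boundary integral\<close>

definition square :: "(real \<times> real) set" where
  "square = {-pi/2<..<pi/2} \<times> {-pi/2<..<pi/2}"

abbreviation area :: "(real \<times> real) measure" where
  "area \<equiv> restrict_space lborel square"

abbreviation edge :: "real measure" where
  "edge \<equiv> restrict_space lborel {-pi/2<..<pi/2}"

text \<open>Arc-length parametrisations of the four open sides over the interval of \<open>edge\<close>.
  The corners have measure zero.\<close>

definition sides :: "(real \<Rightarrow> real \<times> real) list" where
  "sides = [\<lambda>t. (t, -pi/2), \<lambda>t. (t, pi/2), \<lambda>t. (-pi/2, t), \<lambda>t. (pi/2, t)]"

definition boundary_integral :: "(real \<times> real \<Rightarrow> real) \<Rightarrow> real" where
  "boundary_integral f = (\<Sum>\<gamma>\<leftarrow>sides. \<integral>t. f (\<gamma> t) \<partial>edge)"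

section \<open>The Sobolev space and the trace\<close>

definition L2 :: "'a measure \<Rightarrow> ('a \<Rightarrow> 'b::euclidean_space) \<Rightarrow> bool" where
  "L2 M f \<longleftrightarrow> f \<in> borel_measurable M \<and> integrable M (\<lambda>x. (norm (f x))\<^sup>2)"

definition L2_tendsto ::
  "'a measure \<Rightarrow> (nat \<Rightarrow> 'a \<Rightarrow> 'b::euclidean_space) \<Rightarrow> ('a \<Rightarrow> 'b) \<Rightarrow> bool" where
  "L2_tendsto M w f \<longleftrightarrow> (\<lambda>n. \<integral>x. (norm (w n x - f x))\<^sup>2 \<partial>M) \<longlonglongrightarrow> 0"

definition partial :: "'a::euclidean_space \<Rightarrow> ('a \<Rightarrow> real) \<Rightarrow> 'a \<Rightarrow> real" where
  "partial e f x = frechet_derivative f (at x) e"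

definition grad :: "('a::euclidean_space \<Rightarrow> real) \<Rightarrow> 'a \<Rightarrow> 'a" where
  "grad f x = (\<Sum>e\<in>Basis. partial e f x *\<^sub>R e)"

primrec cont_diff :: "nat \<Rightarrow> ('a::euclidean_space \<Rightarrow> real) \<Rightarrow> bool" where
  "cont_diff 0 f \<longleftrightarrow> continuous_on UNIV f"
| "cont_diff (Suc n) f \<longleftrightarrow>
     (\<forall>x. f differentiable (at x)) \<and> (\<forall>e\<in>Basis. cont_diff n (partial e f))"

definition smooth :: "('a::euclidean_space \<Rightarrow> real) \<Rightarrow> bool" where
  "smooth f \<longleftrightarrow> (\<forall>n. cont_diff n f)"

definition test_function :: "(real \<times> real \<Rightarrow> real) \<Rightarrow> bool" where
  "test_function \<phi> \<longleftrightarrow> smooth \<phi> \<and> compact (closure {x. \<phi> x \<noteq> 0}) \<and> closure {x. \<phi> x \<noteq> 0} \<subseteq> square"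

text \<open>\<open>H1 u g\<close>: the function \<open>u\<close> lies in the Sobolev space of order one on the square and
  \<open>g\<close> is its weak gradient. Functions stand for their classes modulo equality almost everywhere;
  values outside the square are irrelevant.\<close>

definition H1 :: "(real \<times> real \<Rightarrow> real) \<Rightarrow> (real \<times> real \<Rightarrow> real \<times> real) \<Rightarrow> bool" where
  "H1 u g \<longleftrightarrow> L2 area u \<and> L2 area g \<and>
     (\<forall>\<phi>. test_function \<phi> \<longrightarrow> (\<forall>e\<in>Basis.
        (\<integral>x. u x * partial e \<phi> x \<partial>area) = - (\<integral>x. (g x \<bullet> e) * \<phi> x \<partial>area)))"

text \<open>The trace operator is the continuous extension, from the Sobolev space to the
  square-integrable functions on the boundary, of the restriction to the boundary of functions
  smooth up to the boundary. Hence \<open>\<tau>\<close> is the trace of \<open>u\<close> iff it is the limit of the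
  boundary values of a sequence of smooth functions approximating \<open>u\<close> in Sobolev norm. Only the
  values of \<open>\<tau>\<close> on the sides matter.\<close>

definition has_trace ::
  "(real \<times> real \<Rightarrow> real) \<Rightarrow> (real \<times> real \<Rightarrow> real \<times> real) \<Rightarrow> (real \<times> real \<Rightarrow> real) \<Rightarrow> bool" where
  "has_trace u g \<tau> \<longleftrightarrow> H1 u g \<and> (\<forall>\<gamma>\<in>set sides. L2 edge (\<tau> \<circ> \<gamma>)) \<and>
     (\<exists>w. (\<forall>n. smooth (w n)) \<and> L2_tendsto area w u \<and> L2_tendsto area (\<lambda>n. grad (w n)) g \<and>
        (\<forall>\<gamma>\<in>set sides. L2_tendsto edge (\<lambda>n. w n \<circ> \<gamma>) (\<tau> \<circ> \<gamma>)))"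

section \<open>Robin eigenvalues\<close>

text \<open>The Robin problem in its usual weak form: the bilinear form associated with
  \<open>\<integral>|\<nabla>u|\<^sup>2 + h \<integral>|u|\<^sup>2 d\<sigma>\<close>, tested against the whole Sobolev space. The zero
  function is included, so that these sets are vector spaces.\<close>

definition robin_eigenspace :: "real \<Rightarrow> real \<Rightarrow> (real \<times> real \<Rightarrow> real) set" where
  "robin_eigenspace h \<mu> = {u. \<exists>g \<tau>. has_trace u g \<tau> \<and>
     (\<forall>v g' \<tau>'. has_trace v g' \<tau>' \<longrightarrow>
        (\<integral>x. g x \<bullet> g' x \<partial>area) + h * boundary_integral (\<lambda>x. \<tau> x * \<tau>' x)
          = \<mu> * (\<integral>x. u x * v x \<partial>area))}"

text \<open>Dimension of a vector space of functions modulo equality almost everywhere.\<close>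

definition has_dim_ae :: "'a measure \<Rightarrow> ('a \<Rightarrow> real) set \<Rightarrow> nat \<Rightarrow> bool" where
  "has_dim_ae M V d \<longleftrightarrow> (\<exists>b. (\<forall>i<d. b i \<in> V) \<and>
     (\<forall>c. (AE x in M. (\<Sum>i<d. c i * b i x) = 0) \<longrightarrow> (\<forall>i<d. c i = 0)) \<and>
     (\<forall>u\<in>V. \<exists>c. AE x in M. u x = (\<Sum>i<d. c i * b i x)))"

text \<open>Sequences are indexed from 1; a number that is not an eigenvalue has a
  zero-dimensional eigenspace and therefore does not occur.\<close>

definition eigenvalue_listing :: "real \<Rightarrow> (nat \<Rightarrow> real) \<Rightarrow> bool" where
  "eigenvalue_listing h ev \<longleftrightarrow> mono_on {1..} ev \<and>
     (\<forall>\<mu>. finite {k \<in> {1..}. ev k = \<mu>} \<and>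
          has_dim_ae area (robin_eigenspace h \<mu>) (card {k \<in> {1..}. ev k = \<mu>}))"

text \<open>A listing exists, and its values at indices \<open>k \<ge> 1\<close> are unique, because the spectrum of the
  Robin Laplacian is discrete and bounded below.\<close>

definition robin_eigenvalue :: "real \<Rightarrow> nat \<Rightarrow> real" where
  "robin_eigenvalue h k = (SOME ev. eigenvalue_listing h ev) k"

section \<open>Nodal domains and Courant-sharpness\<close>

definition nodal_domains :: "(real \<times> real \<Rightarrow> real) \<Rightarrow> (real \<times> real) set set" where
  "nodal_domains u = components (square - u -` {0})"

text \<open>Nodal domains depend on the chosen representative of an eigenfunction: it has to be the
  continuous one, which exists by interior regularity.\<close>

definition courant_sharp :: "real \<Rightarrow> nat \<Rightarrow> bool" where
  "courant_sharp h k \<longleftrightarrow> (\<exists>u \<in> robin_eigenspace h (robin_eigenvalue h k).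
     \<not> (AE x in area. u x = 0) \<and> continuous_on square u \<and>
     finite (nodal_domains u) \<and> card (nodal_domains u) = k)"

end

theory Submission imports Defs
begin

text \<open>Separation of variables: with \<open>p n\<close> the Robin modes of the interval, with eigenvalues \<open>\<mu> n\<close>, the
  products \<open>p i x * p j y\<close> form a complete orthogonal system of eigenfunctions. Only \<open>\<mu> 0\<close> and
  \<open>\<mu> 1\<close> are negative, and for \<open>h\<close> very negative their distance is smaller than every gap
  between the positive ones. Hence a negative eigenvalue of index \<open>k \<ge> 6\<close> is \<open>\<mu> i + \<mu> n\<close> with
  \<open>i < 2 \<le> n\<close>, it is double, and \<open>k \<ge> 4 n - 3 + 2 i\<close>. Its eigenfunctions are
  \<open>u = a p_i(x) p_n(y) + b p_n(x) p_i(y)\<close>. By the maximum principle each nodal domain reaches the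
  boundary of the square; each side carries at most \<open>n + 1\<close> sign intervals, because \<open>p_n / p_i\<close> is
  piecewise monotone, which gives at most \<open>4 n\<close> intervals in all. Near the corners (or near the
  centre, when \<open>i = 1\<close> and \<open>n\<close> is even) enough of them lie in a common nodal domain to leave fewer than
  \<open>k\<close> nodal domains.\<close>

section \<open>The Robin modes of an interval\<close>

text \<open>The two counts differ by exactly one: the pair of \<open>i\<close> and \<open>n\<close>
  has index at least \<open>4 * n - 3 + 2 * i\<close>, so the nodal count must come down to
  \<open>4 * n - 4 + 2 * i\<close>. For \<open>i = 0\<close> the 4 n sign intervals have to lose
  four, one per corner; for \<open>i = 1\<close> a loss of two suffices. For \<open>i = 0\<close>
  and \<open>n = 2\<close> only the bound 5 is reached, and \<open>k \<ge> 6\<close> closes the gap.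
  On a side, u is a combination of the two modes whose zeros move with a and b. The sign intervals
  are therefore represented by zeros of the Wronskian, which are the same for all coefficients; the
  common Robin condition puts the end points among them. Only near 0, where the odd mode vanishes,
  are further points added. Completeness serves the index: no eigenvalue may be missed when
  multiplicities are counted. It comes from the one-dimensional form alone, by comparing the modes
  with functions that vanish at equally spaced points. The threshold -12 makes both negative
  frequencies at least 6, which \<open>eigv_gap\<close> exploits.\<close>

text \<open>\<open>H\<close> stands for \<open>-h\<close>. For \<open>n \<ge> 2\<close> the defining equation is the phase form of
  \<open>a tan (a \<pi>/2) = - H\<close> (even modes) and \<open>a cot (a \<pi>/2) = H\<close> (odd modes).\<close>

definition freq :: "real \<Rightarrow> nat \<Rightarrow> real" where
  "freq H n = (SOME a. a > 0 \<and>
     (if n = 0 then a * tanh (a * pi/2) = H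
      else if n = 1 then H/2 \<le> a \<and> a < H \<and> a = H * tanh (a * pi/2)
      else real n - 1 < a \<and> a < real n \<and> a + 2/pi * arctan (H/a) = real n))"

definition mode :: "real \<Rightarrow> nat \<Rightarrow> real \<Rightarrow> real" where
  "mode H n x = (if n = 0 then cosh (freq H n * x) else if n = 1 then sinh (freq H n * x)
     else if even n then cos (freq H n * x) else sin (freq H n * x))"

definition dmode :: "real \<Rightarrow> nat \<Rightarrow> real \<Rightarrow> real" where
  "dmode H n x = freq H n * (if n = 0 then sinh (freq H n * x) else if n = 1 then cosh (freq H n * x)
     else if even n then - sin (freq H n * x) else cos (freq H n * x))"

definition eigv :: "real \<Rightarrow> nat \<Rightarrow> real" where
  "eigv H n = (if n < 2 then - (freq H n)\<^sup>2 else (freq H n)\<^sup>2)"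

lemma mode_deriv: "(mode H n has_real_derivative dmode H n x) (at x within S)"
proof -
  have "(mode H n has_real_derivative dmode H n x) (at x)"
    unfolding mode_def [abs_def] dmode_def
    by (cases "n = 0"; cases "n = 1"; cases "even n"; auto intro!: derivative_eq_intros)
  then show ?thesis by (rule has_field_derivative_at_within)
qed

lemma dmode_deriv: "(dmode H n has_real_derivative - eigv H n * mode H n x) (at x within S)"
proof -
  have "(dmode H n has_real_derivative - eigv H n * mode H n x) (at x)"
    unfolding mode_def dmode_def [abs_def] eigv_def
    by (cases "n = 0"; cases "n = 1"; cases "even n"; cases "n < 2"; auto intro!: derivative_eq_intros simp: power2_eq_square)
  then show ?thesis by (rule has_field_derivative_at_within)
qed

lemma freq_ex:
  assumes H: "H \<ge> 12"
  shows "\<exists>a>0. (if n = 0 then a * tanh (a * pi/2) = H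
      else if n = 1 then H/2 \<le> a \<and> a < H \<and> a = H * tanh (a * pi/2)
      else real n - 1 < a \<and> a < real n \<and> a + 2/pi * arctan (H/a) = real n)"
proof -
  have tanh_half: "tanh x \<ge> 1/2" if "x \<ge> 1" for x :: real
  proof -
    define y where "y = exp (- (2 * x))"
    have "exp (2*x) \<ge> 1 + 2*x" by (rule exp_ge_add_one_self)
    then have "3 \<le> exp (2*x)" using that by linarith
    then have "inverse (exp (2*x)) \<le> inverse 3" by (intro le_imp_inverse_le) auto
    then have y: "y \<le> 1/3" "y > 0" by (simp_all add: y_def exp_minus)
    have "tanh x = (1 - y) / (1 + y)"
      using tanh_real_altdef[of x] by (simp add: y_def)
    then show ?thesis using y by (simp add: pos_le_divide_eq)
  qed
  consider "n = 0" | "n = 1" | "n \<ge> 2" by linarith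
  then show ?thesis
  proof cases
    case 1
    have "\<exists>a\<ge>0. a \<le> 2*H \<and> a * tanh (a * pi/2) = H"
    proof (rule IVT')
      have "tanh (2*H*pi/2) \<ge> 1/2"
      proof (rule tanh_half)
        have "12 * 3 \<le> H * pi" using H pi_gt3 by (intro mult_mono) auto
        then show "1 \<le> 2*H*pi/2" by simp
      qed
      then have "2*H * (1/2) \<le> 2*H * tanh (2*H*pi/2)" using H by (intro mult_left_mono) auto
      then show "H \<le> 2*H * tanh (2*H*pi/2)" by simp
      show "continuous_on {0..2*H} (\<lambda>a. a * tanh (a * pi / 2))"
        by (intro continuous_intros) (auto simp: cosh_real_nonzero)
    qed (use H in auto)
    then obtain a where a: "a \<ge> 0" "a * tanh (a * pi/2) = H" by auto
    then have "a > 0" using H by (cases "a = 0") auto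
    then show ?thesis using a 1 by auto
  next
    case 2
    \<comment> \<open>The equation also has the trivial solution \<open>a = 0\<close>; starting at
      \<open>H/2\<close> excludes it and keeps the frequency large.\<close>
    have "\<exists>a\<ge>H/2. a \<le> H \<and> a - H * tanh (a * pi/2) = 0"
    proof (rule IVT')
      have "tanh (H/2*pi/2) \<ge> 1/2"
      proof (rule tanh_half)
        have "12 * 3 \<le> H * pi" using H pi_gt3 by (intro mult_mono) auto
        then show "1 \<le> H/2*pi/2" by simp
      qed
      then have "H * (1/2) \<le> H * tanh (H/2*pi/2)" using H by (intro mult_left_mono) auto
      then show "H/2 - H * tanh (H/2*pi/2) \<le> 0" by simp
      have "H * tanh (H * pi/2) \<le> H * 1" using H less_imp_le[OF tanh_real_lt_1] by (intro mult_left_mono) auto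
      then show "0 \<le> H - H * tanh (H * pi/2)" by simp
      show "continuous_on {H/2..H} (\<lambda>a. a - H * tanh (a * pi / 2))"
        by (intro continuous_intros) (auto simp: cosh_real_nonzero)
    qed (use H in auto)
    then obtain a where a: "a \<ge> H/2" "a \<le> H" "a = H * tanh (a * pi/2)" by auto
    have "H * tanh (a * pi/2) < H * 1" using H tanh_real_lt_1 by (intro mult_strict_left_mono) auto
    then have "a < H" using a by simp
    then show ?thesis using a 2 H by (intro exI[of _ a]) auto
  next
    case 3
    let ?f = "\<lambda>a. a + 2/pi * arctan (H/a)"
    \<comment> \<open>At \<open>a = n - 1\<close> the phase term is below 1, at \<open>a = n\<close>
      it is positive, so a root lies strictly between.\<close>
    have up: "?f (real n - 1) < real n"
    proof -
      have "2/pi * arctan (H/(real n - 1)) < 2/pi * (pi/2)"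
        using arctan_ubound by (intro mult_strict_left_mono) auto
      then show ?thesis by simp
    qed
    have lo: "?f (real n) > real n" using 3 H by auto
    have "\<exists>a\<ge>real n - 1. a \<le> real n \<and> ?f a = real n"
      by (rule IVT') (use 3 up lo in \<open>auto intro!: continuous_intros less_imp_le\<close>)
    then obtain a where a: "a \<ge> real n - 1" "a \<le> real n" "?f a = real n" by auto
    have "a \<noteq> real n - 1" "a \<noteq> real n" using up lo a(3) by (metis order_less_irrefl)+
    then have "real n - 1 < a" "a < real n" using a by auto
    then show ?thesis using a(3) 3 by (intro exI[of _ a]) auto
  qed
qed

section \<open>Robin conditions, signs and gaps of the eigenvalues on the interval\<close>

locale robin =
  fixes H :: real
  assumes H: "H \<ge> 12"
begin

abbreviation "\<alpha> \<equiv> freq H"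
abbreviation "p \<equiv> mode H"
abbreviation "p' \<equiv> dmode H"
abbreviation "\<mu> \<equiv> eigv H"

lemma freq_props:
  "\<alpha> n > 0 \<and> (if n = 0 then \<alpha> n * tanh (\<alpha> n * pi/2) = H
      else if n = 1 then H/2 \<le> \<alpha> n \<and> \<alpha> n < H \<and> \<alpha> n = H * tanh (\<alpha> n * pi/2)
      else real n - 1 < \<alpha> n \<and> \<alpha> n < real n \<and> \<alpha> n + 2/pi * arctan (H/\<alpha> n) = real n)"
  unfolding freq_def by (rule someI_ex) (rule freq_ex[OF H])

lemma freq_pos: "\<alpha> n > 0" using freq_props by blast

lemma freq_0: "\<alpha> 0 * tanh (\<alpha> 0 * pi/2) = H" using freq_props[of 0] by simp

lemma freq_1: "H/2 \<le> \<alpha> 1" "\<alpha> 1 < H" "\<alpha> 1 = H * tanh (\<alpha> 1 * pi/2)" using freq_props[of 1] by auto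

lemma freq_ge2:
  assumes "n \<ge> 2"
  shows "real n - 1 < \<alpha> n" "\<alpha> n < real n" "\<alpha> n + 2/pi * arctan (H/\<alpha> n) = real n"
  using freq_props[of n] assms by (auto split: if_splits)

lemma freq_0_gt: "\<alpha> 0 > H"
proof -
  have "\<alpha> 0 * tanh (\<alpha> 0 * pi/2) < \<alpha> 0 * 1"
    using freq_pos tanh_real_lt_1 by (intro mult_strict_left_mono) auto
  then show ?thesis using freq_0 by simp
qed

text \<open>For \<open>n \<ge> 2\<close> put \<open>t = arctan (H / \<alpha> n)\<close>. The phase
  equation says that the angle at the end point is n * pi/2 - t, and
  \<open>tan t = H / \<alpha> n\<close> is the Robin condition once the parity of \<open>n\<close>
  has been split off.\<close>

lemma robin_right: "p' n (pi/2) = H * p n (pi/2)"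
proof -
  consider "n = 0" | "n = 1" | "n \<ge> 2" by linarith
  then show ?thesis
  proof cases
    case 1
    then show ?thesis using freq_0 by (auto simp: mode_def dmode_def tanh_def field_simps)
  next
    case 2
    then show ?thesis using freq_1(3) by (auto simp: mode_def dmode_def tanh_def field_simps)
  next
    case 3
    define t where "t = arctan (H/\<alpha> n)"
    have ang: "\<alpha> n * pi/2 = real n * (pi/2) - t"
      using freq_ge2(3)[OF 3] by (simp add: t_def field_simps)
    have "tan t = H/\<alpha> n" by (simp add: t_def tan_arctan)
    moreover have "cos t \<noteq> 0" by (simp add: t_def)
    ultimately have t: "\<alpha> n * sin t = H * cos t" 
      using freq_pos[of n] by (auto simp: tan_def field_simps)
    show ?thesis
    proof (cases "even n")
      case True
      then obtain m where m: "n = 2*m" by auto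
      have "\<alpha> n * (pi/2) = real m * pi - t" using ang by (simp add: m)
      then have "sin (\<alpha> n * (pi/2)) = - cos (real m * pi) * sin t" "cos (\<alpha> n * (pi/2)) = cos (real m * pi) * cos t"
        by (simp_all only: sin_diff cos_diff) (simp_all add: sin_npi)
      then show ?thesis using 3 True t by (simp add: mode_def dmode_def)
    next
      case False
      then obtain m where m: "n = 2*m+1" by (metis oddE)
      have "\<alpha> n * (pi/2) = (real m * pi - t) + pi/2" using ang by (simp add: m field_simps)
      then have "sin (\<alpha> n * (pi/2)) = cos (real m * pi - t)" "cos (\<alpha> n * (pi/2)) = - sin (real m * pi - t)"
        by (simp_all only: sin_add cos_add) simp_all
      then have "sin (\<alpha> n * (pi/2)) = cos (real m * pi) * cos t" "cos (\<alpha> n * (pi/2)) = cos (real m * pi) * sin t"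
        by (simp_all add: sin_diff cos_diff)
      then show ?thesis using 3 False t by (simp add: mode_def dmode_def)
    qed
  qed
qed

lemma mode_minus: "p n (- x) = (-1)^n * p n x"
  by (auto simp: mode_def)

lemma dmode_minus: "p' n (- x) = - ((-1)^n * p' n x)"
  by (auto simp: dmode_def)

lemma robin_left: "p' n (- pi/2) = - H * p n (- pi/2)"
  using robin_right[of n] mode_minus[of n "pi/2"] dmode_minus[of n "pi/2"] by simp

lemma cont_mode: "continuous_on S (p n)"
  by (rule DERIV_continuous_on) (rule mode_deriv)

lemma cont_dmode: "continuous_on S (p' n)"
  by (rule DERIV_continuous_on) (rule dmode_deriv)

lemma cosh_ge: "cosh x \<ge> x\<^sup>2/4" if "x \<ge> 0" for x :: real
proof -
  have "exp x \<ge> 1 + x + x\<^sup>2/2" by (rule exp_lower_Taylor_quadratic) (use that in auto)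
  moreover have "exp (-x) \<ge> 1 + (-x)" by (rule exp_ge_add_one_self)
  ultimately show ?thesis unfolding cosh_field_def by simp
qed

text \<open>Both frequencies are very close to \<open>H\<close>: by 1 - tanh^2 = 1 / cosh^2 the
  defining equations bound the distances of their squares from H^2 by 1/9 and 4/9. The estimate
  \<open>sm\<close> needs \<open>a \<ge> 6\<close>, and \<open>\<alpha> 1 \<ge> H/2\<close> makes
  this the source of the constant 12.\<close>

lemma eigv_gap: "\<mu> 1 - \<mu> 0 < 1"
proof -
  have c: "1 - (tanh x)\<^sup>2 = 1 / (cosh x)\<^sup>2" for x :: real
  proof -
    have "(cosh x)\<^sup>2 \<noteq> 0" using cosh_real_nonzero[of x] by simp
    then have "1 - (tanh x)\<^sup>2 = ((cosh x)\<^sup>2 - (sinh x)\<^sup>2) / (cosh x)\<^sup>2"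
      by (simp add: tanh_def power_divide diff_divide_distrib)
    then show ?thesis by (simp add: cosh_square_eq)
  qed
  have sm: "a\<^sup>2 / (cosh (a * pi/2))\<^sup>2 \<le> 1/9" if "a \<ge> 6" for a :: real
  proof -
    have "a * 3 \<le> a * pi" using that pi_gt3 by (intro mult_left_mono) auto
    then have "a * 3/2 \<le> a * pi/2" by simp
    then have "(a*3/2)\<^sup>2/4 \<le> (a*pi/2)\<^sup>2/4" using that by (intro divide_right_mono power_mono) auto
    also have "\<dots> \<le> cosh (a * pi/2)" using that by (intro cosh_ge) auto
    finally have "(a*3/2)\<^sup>2/4 \<le> cosh (a * pi/2)" .
    moreover have "(a*3/2)\<^sup>2/4 \<ge> 3 * a"
    proof -
      have "a * 6 \<le> a * a" using that by (intro mult_left_mono) auto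
      then have "16 * a \<le> 3 * (a * a)" using that by linarith
      then show ?thesis by (simp add: power2_eq_square field_simps)
    qed
    ultimately have "3 * a \<le> cosh (a * pi/2)" by linarith
    then have "(3 * a)\<^sup>2 \<le> (cosh (a * pi/2))\<^sup>2" using that by (intro power_mono) auto
    then show ?thesis by (simp add: field_simps)
  qed
  have "(\<alpha> 0)\<^sup>2 - H\<^sup>2 = (\<alpha> 0)\<^sup>2 * (1 - (tanh (\<alpha> 0 * pi/2))\<^sup>2)"
    by (subst freq_0[symmetric]) (simp add: algebra_simps power_mult_distrib)
  also have "\<dots> \<le> 1/9" using sm[of "\<alpha> 0"] freq_0_gt H by (simp add: c)
  finally have 1: "(\<alpha> 0)\<^sup>2 - H\<^sup>2 \<le> 1/9" .
  have "(\<alpha> 1)\<^sup>2 = H\<^sup>2 * (tanh (\<alpha> 1 * pi/2))\<^sup>2" using freq_1(3) by (metis power_mult_distrib)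
  then have "H\<^sup>2 - (\<alpha> 1)\<^sup>2 = H\<^sup>2 * (1 - (tanh (\<alpha> 1 * pi/2))\<^sup>2)" by (simp add: algebra_simps)
  also have "\<dots> = H\<^sup>2 / (cosh (\<alpha> 1 * pi/2))\<^sup>2" by (simp add: c)
  also have "\<dots> \<le> (2 * \<alpha> 1)\<^sup>2 / (cosh (\<alpha> 1 * pi/2))\<^sup>2"
    using freq_1(1) H by (intro divide_right_mono power_mono) auto
  also have "\<dots> = 4 * ((\<alpha> 1)\<^sup>2 / (cosh (\<alpha> 1 * pi/2))\<^sup>2)" by (simp add: power_mult_distrib)
  also have "\<dots> \<le> 4 * (1/9)" using sm[of "\<alpha> 1"] freq_1(1) H by (intro mult_left_mono) auto
  finally show ?thesis using 1 by (simp add: eigv_def)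
qed

lemma eigv_neg: "n < 2 \<Longrightarrow> \<mu> n < 0"
  using freq_pos[of n] by (simp add: eigv_def)

lemma eigv_pos: "n \<ge> 2 \<Longrightarrow> \<mu> n > 0"
  using freq_pos[of n] by (simp add: eigv_def)

lemma eigv_lt: "N \<ge> 1 \<Longrightarrow> i \<le> N \<Longrightarrow> \<mu> i < (real N)\<^sup>2"
proof -
  assume N: "N \<ge> 1" "i \<le> N"
  show ?thesis
  proof (cases "i < 2")
    case True
    then have "\<mu> i < 0" by (rule eigv_neg)
    also have "0 \<le> (real N)\<^sup>2" by simp
    finally show ?thesis .
  next
    case False
    then have "\<alpha> i < real i" "0 < \<alpha> i" using freq_ge2[of i] freq_pos by auto
    then have "\<alpha> i < real N" using N by linarith
    then show ?thesis using False \<open>0 < \<alpha> i\<close> by (simp add: eigv_def power_strict_mono)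
  qed
qed

text \<open>The phase term \<open>2/pi * arctan (H/a)\<close> decreases in \<open>a\<close>, so when
  \<open>n\<close> grows by 1 the frequency has to grow by at least as much.\<close>

lemma freq_Suc: "n \<ge> 2 \<Longrightarrow> \<alpha> (Suc n) \<ge> \<alpha> n + 1"
proof -
  assume n: "n \<ge> 2"
  have "\<alpha> n < real n" "real n < \<alpha> (Suc n)" using freq_ge2[of n] freq_ge2[of "Suc n"] n by auto
  then have "H / \<alpha> (Suc n) \<le> H / \<alpha> n" using H freq_pos by (intro divide_left_mono) auto
  then have "2/pi * arctan (H/\<alpha> (Suc n)) \<le> 2/pi * arctan (H/\<alpha> n)"
    by (intro mult_left_mono) (auto simp: arctan_le_iff)
  then show ?thesis using freq_ge2(3)[of n] freq_ge2(3)[of "Suc n"] n by simp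
qed

lemma eigv_Suc: "n \<ge> 2 \<Longrightarrow> \<mu> (Suc n) \<ge> \<mu> n + 1"
proof -
  assume n: "n \<ge> 2"
  have "(\<alpha> n + 1)\<^sup>2 \<le> (\<alpha> (Suc n))\<^sup>2" using freq_Suc[OF n] freq_pos[of n] by (intro power_mono) auto
  then show ?thesis using n freq_pos[of n] by (simp add: eigv_def power2_sum)
qed

lemma eigv_0_1: "\<mu> 0 < \<mu> 1"
proof -
  have "\<alpha> 1 < \<alpha> 0" using freq_0_gt freq_1 by simp
  then show ?thesis using freq_pos[of 1] by (simp add: eigv_def power_strict_mono)
qed

lemma eigv_strict_mono: "strict_mono \<mu>"
  unfolding strict_mono_Suc_iff
proof
  fix n :: nat
  consider "n = 0" | "n = 1" | "n \<ge> 2" by linarith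
  then show "\<mu> n < \<mu> (Suc n)"
  proof cases
    case 1
    then show ?thesis using eigv_0_1 by simp
  next
    case 2
    then show ?thesis using eigv_neg[of 1] eigv_pos[of 2] by (simp add: numeral_2_eq_2)
  next
    case 3
    then show ?thesis using eigv_Suc[of n] by simp
  qed
qed

lemma eigv_gap_ge2: "2 \<le> m \<Longrightarrow> m < n \<Longrightarrow> \<mu> n \<ge> \<mu> m + 1"
  using eigv_Suc[of m] strict_mono_less_eq[OF eigv_strict_mono, of "Suc m" n] by simp

lemma eigv_ge: "n \<ge> 2 \<Longrightarrow> \<mu> n \<ge> real n - 1"
proof -
  assume n: "n \<ge> 2"
  have "1 \<le> real n - 1" using n by auto
  then have "(real n - 1) * 1 \<le> (real n - 1) * (real n - 1)" by (intro mult_left_mono) auto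
  also have "\<dots> \<le> \<alpha> n * \<alpha> n" using freq_ge2[OF n] \<open>1 \<le> real n - 1\<close> by (intro mult_mono) auto
  finally show ?thesis using n by (simp add: eigv_def power2_eq_square)
qed

end

section \<open>Completeness of the modes of an interval\<close>

text \<open>Gaussian elimination by induction on the number of equations: \<open>s\<close>
  enumerates the columns other than the pivot column \<open>k\<close>, and \<open>B\<close> is the
  reduced system. It serves both the choice of a function with prescribed zeros and the uniqueness
  of dimension.\<close>

lemma nontrivial_kernel:
  fixes A :: "nat \<Rightarrow> nat \<Rightarrow> real"
  assumes "m < n"
  shows "\<exists>c. (\<exists>i<n. c i \<noteq> 0) \<and> (\<forall>j<m. (\<Sum>i<n. A j i * c i) = 0)"
  using assms
proof (induction m arbitrary: n A)
  case 0
  then show ?case by (intro exI[of _ "\<lambda>_. 1"]) auto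
next
  case (Suc m)
  then obtain n' where n: "n = Suc n'" "m < n'" by (cases n) auto
  show ?case
  proof (cases "\<exists>k<n. A m k \<noteq> 0")
    case False
    obtain c where "\<exists>i<n. c i \<noteq> 0" "\<forall>j<m. (\<Sum>i<n. A j i * c i) = 0"
      using Suc.IH[of n A] Suc.prems by auto
    moreover have "(\<Sum>i<n. A m i * c i) = 0" using False by (intro sum.neutral) auto
    ultimately show ?thesis by (intro exI[of _ c]) (auto simp: less_Suc_eq)
  next
    case True
    then obtain k where k: "k < n" "A m k \<noteq> 0" by auto
    define s where "s = (\<lambda>i. if i < k then i else Suc i)"
    define B where "B = (\<lambda>j i. A j (s i) - A j k * A m (s i) / A m k)"
    obtain c where c: "\<exists>i<n'. c i \<noteq> 0" "\<forall>j<m. (\<Sum>i<n'. B j i * c i) = 0"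
      using Suc.IH[of n' B] n by auto
    have inj: "inj_on s {..<n'}" by (auto simp: s_def inj_on_def split: if_splits)
    have img: "s ` {..<n'} = {..<n} - {k}"
    proof
      show "s ` {..<n'} \<subseteq> {..<n} - {k}" using n by (auto simp: s_def)
      show "{..<n} - {k} \<subseteq> s ` {..<n'}"
      proof
        fix i assume i: "i \<in> {..<n} - {k}"
        show "i \<in> s ` {..<n'}"
        proof (cases "i < k")
          case True
          then show ?thesis using k n by (intro image_eqI[of _ _ i]) (auto simp: s_def)
        next
          case False
          then show ?thesis using i n by (intro image_eqI[of _ _ "i - 1"]) (auto simp: s_def)
        qed
      qed
    qed
    define t where "t = the_inv_into {..<n'} s"
    have ts: "t (s i) = i" if "i < n'" for i
      unfolding t_def using inj that by (intro the_inv_into_f_f) auto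
    define d where "d = (\<lambda>i. if i = k then - (\<Sum>j<n'. A m (s j) * c j) / A m k else c (t i))"
    have sk: "s i \<noteq> k" for i by (auto simp: s_def)
    have sum: "(\<Sum>i<n. A j i * d i) = A j k * d k + (\<Sum>i<n'. A j (s i) * c i)" for j
    proof -
      have "(\<Sum>i<n. A j i * d i) = A j k * d k + (\<Sum>i\<in>{..<n} - {k}. A j i * d i)"
        using k by (intro sum.remove) auto
      also have "(\<Sum>i\<in>{..<n} - {k}. A j i * d i) = (\<Sum>i<n'. A j (s i) * d (s i))"
        unfolding img[symmetric] by (subst sum.reindex[OF inj]) simp
      also have "\<dots> = (\<Sum>i<n'. A j (s i) * c i)" by (intro sum.cong) (auto simp: d_def sk ts)
      finally show ?thesis .
    qed
    have "(\<Sum>i<n. A j i * d i) = 0" if "j < Suc m" for j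
    proof (cases "j = m")
      case True
      then show ?thesis using k(2) by (simp add: sum) (simp add: d_def)
    next
      case False
      then have "j < m" using that by simp
      then have "0 = (\<Sum>i<n'. B j i * c i)" using c by simp
      also have "\<dots> = (\<Sum>i<n'. A j (s i) * c i) - A j k / A m k * (\<Sum>i<n'. A m (s i) * c i)"
        by (simp add: B_def sum_subtractf sum_distrib_left algebra_simps)
      finally show ?thesis by (simp add: sum) (simp add: d_def)
    qed
    moreover obtain i where i: "i < n'" "c i \<noteq> 0" using c by auto
    then have "d (s i) \<noteq> 0" "s i < n" using sk ts img by (auto simp: d_def)
    ultimately show ?thesis by blast
  qed
qed

lemma wirtinger:
  fixes g :: "real \<Rightarrow> real"
  assumes ab: "a < b" and k: "0 \<le> k" "k * (b - a) < pi"
    and g: "\<And>x. x \<in> {a..b} \<Longrightarrow> (g has_real_derivative g' x) (at x within {a..b})"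
    and g': "continuous_on {a..b} g'" and z: "g a = 0" "g b = 0"
  shows "k\<^sup>2 * integral {a..b} (\<lambda>x. (g x)\<^sup>2) \<le> integral {a..b} (\<lambda>x. (g' x)\<^sup>2)"
proof -
  \<comment> \<open>\<open>f\<close> solves the Riccati equation \<open>f' = - (k\<^sup>2 + f\<^sup>2)\<close>, so \<open>g'\<^sup>2 - k\<^sup>2 g\<^sup>2 = (g' - f g)\<^sup>2 + (f g\<^sup>2)'\<close>.\<close>
  define c where "c = (a + b) / 2"
  define f where "f = (\<lambda>x. - k * tan (k * (x - c)))"
  have gc: "continuous_on {a..b} g" by (rule DERIV_continuous_on) (rule g)
  have cos: "cos (k * (x - c)) \<noteq> 0" if "x \<in> {a..b}" for x
  proof -
    have "\<bar>x - c\<bar> \<le> (b - a)/2" using that by (auto simp: c_def field_simps abs_le_iff)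
    then have "k * \<bar>x - c\<bar> \<le> k * ((b - a)/2)" using k by (intro mult_left_mono)
    then have "\<bar>k * (x - c)\<bar> < pi/2" using k by (simp add: abs_mult)
    then have "cos (k * (x - c)) > 0" by (intro cos_gt_zero_pi) auto
    then show ?thesis by simp
  qed
  have f': "(f has_real_derivative - (k\<^sup>2 + (f x)\<^sup>2)) (at x within {a..b})" if "x \<in> {a..b}" for x
  proof -
    have "(f has_real_derivative - k * (k * inverse ((cos (k * (x - c)))\<^sup>2))) (at x within {a..b})"
      unfolding f_def using cos[OF that] by (auto intro!: derivative_eq_intros)
    moreover have "inverse ((cos (k * (x - c)))\<^sup>2) = 1 + (tan (k * (x - c)))\<^sup>2"
      using cos[OF that] by (simp add: tan_def power_divide field_simps)
    ultimately show ?thesis by (simp add: f_def power2_eq_square algebra_simps)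
  qed
  have fc: "continuous_on {a..b} f" by (rule DERIV_continuous_on) (rule f')
  have "((\<lambda>x. 2 * f x * g x * g' x - (k\<^sup>2 + (f x)\<^sup>2) * (g x)\<^sup>2) has_integral f b * (g b)\<^sup>2 - f a * (g a)\<^sup>2) {a..b}"
  proof (rule fundamental_theorem_of_calculus)
    fix x assume x: "x \<in> {a..b}"
    have "((\<lambda>x. f x * (g x)\<^sup>2) has_real_derivative 2 * f x * g x * g' x - (k\<^sup>2 + (f x)\<^sup>2) * (g x)\<^sup>2) (at x within {a..b})"
      by (rule derivative_eq_intros f'[OF x] g[OF x] refl)+ (simp add: algebra_simps power2_eq_square)
    then show "((\<lambda>x. f x * (g x)\<^sup>2) has_vector_derivative 2 * f x * g x * g' x - (k\<^sup>2 + (f x)\<^sup>2) * (g x)\<^sup>2) (at x within {a..b})"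
      by (simp add: has_real_derivative_iff_has_vector_derivative)
  qed (use ab in auto)
  then have 0: "integral {a..b} (\<lambda>x. 2 * f x * g x * g' x - (k\<^sup>2 + (f x)\<^sup>2) * (g x)\<^sup>2) = 0"
    using z by (simp add: integral_unique)
  have "0 \<le> integral {a..b} (\<lambda>x. (g' x - f x * g x)\<^sup>2)"
    by (intro integral_nonneg integrable_continuous_real continuous_intros gc g' fc) auto
  also have "(\<lambda>x. (g' x - f x * g x)\<^sup>2) = (\<lambda>x. (g' x)\<^sup>2 - k\<^sup>2 * (g x)\<^sup>2 - (2 * f x * g x * g' x - (k\<^sup>2 + (f x)\<^sup>2) * (g x)\<^sup>2))"
    by (rule ext) (simp add: power2_eq_square algebra_simps)
  also have "integral {a..b} \<dots> = integral {a..b} (\<lambda>x. (g' x)\<^sup>2 - k\<^sup>2 * (g x)\<^sup>2) - 0"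
    unfolding 0[symmetric]
    by (intro integral_diff integrable_continuous_real continuous_intros gc g' fc)
  also have "\<dots> = integral {a..b} (\<lambda>x. (g' x)\<^sup>2) - k\<^sup>2 * integral {a..b} (\<lambda>x. (g x)\<^sup>2)"
    by (subst integral_diff) (auto intro!: integrable_continuous_real continuous_intros gc g')
  finally show ?thesis by simp
qed

text \<open>\<open>wirtinger\<close> is summed over the \<open>N\<close> intervals of length pi / N
  between neighbouring nodes. The strict \<open>k < N\<close> keeps its tangent finite up to the
  ends of each interval; the constant N^2 is recovered by a limit in
  \<open>mode_approx\<close>.\<close>

lemma wirtinger_nodes:
  fixes g :: "real \<Rightarrow> real"
  assumes N: "N \<ge> 1" and k: "0 \<le> k" "k < real N"
    and g: "\<And>x. (g has_real_derivative g' x) (at x)"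
    and g': "continuous_on UNIV g'"
    and z: "\<And>j. j \<le> N \<Longrightarrow> g (- pi/2 + real j * (pi / real N)) = 0"
  shows "k\<^sup>2 * integral {-pi/2..pi/2} (\<lambda>x. (g x)\<^sup>2) \<le> integral {-pi/2..pi/2} (\<lambda>x. (g' x)\<^sup>2)"
proof -
  define x where "x = (\<lambda>j::nat. - pi/2 + real j * (pi / real N))"
  have gc: "continuous_on UNIV g" by (rule DERIV_continuous_on) (rule has_field_derivative_at_within[OF g])
  have gc': "continuous_on S g" "continuous_on S g'" for S using gc g' continuous_on_subset by blast+
  have "k\<^sup>2 * integral {x 0..x j} (\<lambda>x. (g x)\<^sup>2) \<le> integral {x 0..x j} (\<lambda>x. (g' x)\<^sup>2)" if "j \<le> N" for j
    using that
  proof (induction j)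
    case 0
    then show ?case by simp
  next
    case (Suc j)
    have le: "x 0 \<le> x j" "x j < x (Suc j)" using N by (auto simp: x_def field_simps)
    have comb: "integral {x 0..x (Suc j)} f = integral {x 0..x j} f + integral {x j..x (Suc j)} f"
      if "continuous_on UNIV f" for f :: "real \<Rightarrow> real"
      using le continuous_on_subset[OF that]
      by (intro Henstock_Kurzweil_Integration.integral_combine[symmetric] integrable_continuous_real) auto
    have "x (Suc j) - x j = pi / real N" by (simp add: x_def algebra_simps add_divide_distrib)
    moreover have "k * (pi / real N) < real N * (pi / real N)"
      using k N by (intro mult_strict_right_mono) auto
    ultimately have "k * (x (Suc j) - x j) < pi" using N by simp
    then have "k\<^sup>2 * integral {x j..x (Suc j)} (\<lambda>x. (g x)\<^sup>2) \<le> integral {x j..x (Suc j)} (\<lambda>x. (g' x)\<^sup>2)"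
      using le k gc' z[of j] z[of "Suc j"] Suc.prems
      by (intro wirtinger has_field_derivative_at_within[OF g]) (auto simp: x_def)
    then show ?case using Suc by (subst (1 2) comb) (auto intro!: continuous_intros gc' simp: algebra_simps)
  qed
  from this[of N] show ?thesis using N by (simp add: x_def)
qed

section \<open>Integrals and inner products on the interval\<close>

lemma edge_integrable:
  fixes f :: "real \<Rightarrow> 'b::euclidean_space"
  assumes "continuous_on {-pi/2..pi/2} f"
  shows "integrable edge f"
proof -
  have "set_integrable lborel {-pi/2..pi/2} f"
    using assms by (intro borel_integrable_atLeastAtMost') auto
  then have "set_integrable lborel {-pi/2<..<pi/2} f"
    by (rule set_integrable_subset) auto
  then show ?thesis by (simp add: set_integrable_def integrable_restrict_space)
qed

lemma edge_integral:
  fixes f :: "real \<Rightarrow> real"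
  assumes "continuous_on {-pi/2..pi/2} f"
  shows "(\<integral>x. f x \<partial>edge) = integral {-pi/2..pi/2} f"
proof -
  have i: "set_integrable lborel {-pi/2..pi/2} f"
    using assms by (intro borel_integrable_atLeastAtMost') auto
  then have j: "set_integrable lborel {-pi/2<..<pi/2} f"
    by (rule set_integrable_subset) auto
  have "(\<integral>x. f x \<partial>edge) = (LINT x:{-pi/2<..<pi/2}|lborel. f x)"
    by (simp add: integral_restrict_space set_lebesgue_integral_def)
  also have "\<dots> = integral {-pi/2<..<pi/2} f" using set_borel_integral_eq_integral(2)[OF j] .
  also have "\<dots> = integral {-pi/2..pi/2} f" by (rule integral_open_interval_real[symmetric])
  finally show ?thesis .
qed

lemma edge_FTC:
  fixes F :: "real \<Rightarrow> real"
  assumes "\<And>x. (F has_real_derivative f x) (at x)" and "continuous_on {-pi/2..pi/2} f"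
  shows "(\<integral>x. f x \<partial>edge) = F (pi/2) - F (-pi/2)"
proof -
  have "(f has_integral F (pi/2) - F (-pi/2)) {-pi/2..pi/2}"
    using assms(1) pi_ge_zero
    by (intro fundamental_theorem_of_calculus)
      (auto simp: has_real_derivative_iff_has_vector_derivative[symmetric] intro: has_field_derivative_at_within)
  then show ?thesis using edge_integral[OF assms(2)] by (simp add: integral_unique)
qed

definition C1 :: "(real \<Rightarrow> real) \<Rightarrow> (real \<Rightarrow> real) \<Rightarrow> bool" where
  "C1 f f' \<longleftrightarrow> (\<forall>x. (f has_real_derivative f' x) (at x)) \<and> continuous_on UNIV f'"

lemma C1_cont: 
  assumes "C1 f f'" shows "continuous_on S f" "continuous_on S f'"
  using assms unfolding C1_def
  by (blast intro: DERIV_continuous_on has_field_derivative_at_within continuous_on_subset)+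

lemma C1_add: "C1 f f' \<Longrightarrow> C1 g g' \<Longrightarrow> C1 (\<lambda>x. f x + g x) (\<lambda>x. f' x + g' x)"
  by (auto simp: C1_def intro!: derivative_eq_intros continuous_intros)

lemma C1_cmult: "C1 f f' \<Longrightarrow> C1 (\<lambda>x. c * f x) (\<lambda>x. c * f' x)"
  by (auto simp: C1_def intro!: derivative_eq_intros continuous_intros)

lemma C1_sum: "(\<And>i. i \<in> A \<Longrightarrow> C1 (f i) (f' i)) \<Longrightarrow> C1 (\<lambda>x. \<Sum>i\<in>A. f i x) (\<lambda>x. \<Sum>i\<in>A. f' i x)"
  by (induction A rule: infinite_finite_induct) (auto simp: C1_def intro!: derivative_eq_intros continuous_intros)

definition ip :: "(real \<Rightarrow> real) \<Rightarrow> (real \<Rightarrow> real) \<Rightarrow> real" where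
  "ip f g = (\<integral>x. f x * g x \<partial>edge)"

lemma ip_commute: "ip f g = ip g f" by (simp add: ip_def mult.commute)

lemma ip_integrable:
  fixes f g :: "real \<Rightarrow> real"
  assumes "\<And>S. continuous_on S f" "\<And>S. continuous_on S g"
  shows "integrable edge (\<lambda>x. f x * g x)"
  by (intro edge_integrable continuous_intros assms)

lemma ip_add:
  assumes "\<And>S. continuous_on S f1" "\<And>S. continuous_on S f2" "\<And>S. continuous_on S g"
  shows "ip (\<lambda>x. f1 x + f2 x) g = ip f1 g + ip f2 g"
  unfolding ip_def distrib_right
  by (rule Bochner_Integration.integral_add) (intro ip_integrable assms)+

lemma ip_cmult: "ip (\<lambda>x. a * f x) g = a * ip f g"
  by (simp add: ip_def mult.assoc)

lemma ip_sum:
  assumes "\<And>i S. i \<in> A \<Longrightarrow> continuous_on S (f i)" "\<And>S. continuous_on S g"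
  shows "ip (\<lambda>x. \<Sum>i\<in>A. d i * f i x) g = (\<Sum>i\<in>A. d i * ip (f i) g)"
proof -
  have "ip (\<lambda>x. \<Sum>i\<in>A. d i * f i x) g = (\<integral>x. (\<Sum>i\<in>A. d i * (f i x * g x)) \<partial>edge)"
    by (simp add: ip_def sum_distrib_right mult.assoc)
  also have "\<dots> = (\<Sum>i\<in>A. \<integral>x. d i * (f i x * g x) \<partial>edge)"
    by (rule Bochner_Integration.integral_sum) (intro integrable_mult_right ip_integrable assms)
  finally show ?thesis by (simp add: ip_def)
qed

lemma ip_square:
  assumes f: "\<And>S. continuous_on S f" and g: "\<And>S. continuous_on S g"
  shows "ip (\<lambda>x. f x + e * g x) (\<lambda>x. f x + e * g x) = ip f f + 2 * e * ip f g + e\<^sup>2 * ip g g"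
proof -
  let ?h = "\<lambda>x. f x + e * g x"
  have eg: "continuous_on S (\<lambda>x. e * g x)" for S by (intro continuous_intros g)
  have h: "continuous_on S ?h" for S by (intro continuous_intros f g)
  have "ip ?h ?h = ip f ?h + e * ip g ?h"
    by (subst ip_add[OF f eg h]) (simp add: ip_cmult)
  also have "ip f ?h = ip f f + e * ip f g"
    by (subst (1) ip_commute, subst ip_add[OF f eg f]) (simp add: ip_cmult ip_commute[of g f])
  also have "ip g ?h = ip f g + e * ip g g"
    by (subst (1) ip_commute, subst ip_add[OF f eg g]) (simp add: ip_cmult)
  finally show ?thesis by (simp add: algebra_simps power2_eq_square)
qed

section \<open>Orthogonality of the modes and approximation by them\<close>

context robin
begin

lemma C1_mode: "C1 (p n) (p' n)"
  by (simp add: C1_def mode_deriv cont_dmode)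

lemma mode_end_nonzero: "p n (pi/2) \<noteq> 0"
proof
  assume 0: "p n (pi/2) = 0"
  then have 1: "p' n (pi/2) = 0" by (simp add: robin_right)
  have "cos x = 0 \<Longrightarrow> sin x = 0 \<Longrightarrow> False" for x :: real
    using sin_cos_squared_add[of x] by simp
  then show False using 0 1 freq_pos[of n]
    by (auto simp: mode_def dmode_def split: if_splits)
qed

lemma ip_mode_pos: "ip (p n) (p n) > 0"
proof -
  have c: "continuous_on {-pi/2..pi/2} (\<lambda>x. p n x * p n x)" by (intro continuous_intros cont_mode)
  have "integral {-pi/2..pi/2} (\<lambda>x. p n x * p n x) \<noteq> 0"
  proof
    assume "integral {-pi/2..pi/2} (\<lambda>x. p n x * p n x) = 0"
    then have "((\<lambda>x. p n x * p n x) has_integral 0) (cbox (-pi/2) (pi/2))"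
      using c integrable_continuous_real by (metis cbox_interval integrable_integral)
    moreover have "pi/2 \<in> cbox (-pi/2) (pi/2)" "box (-pi/2) (pi/2) \<noteq> {}"
      using pi_gt_zero by (simp_all add: less_imp_le not_le)
    ultimately have "p n (pi/2) * p n (pi/2) = 0"
      using c by (intro has_integral_0_cbox_imp_0[where f="\<lambda>x. p n x * p n x" and a="-pi/2" and b="pi/2"]) auto
    then show False using mode_end_nonzero by simp
  qed
  moreover have "integral {-pi/2..pi/2} (\<lambda>x. p n x * p n x) \<ge> 0"
    by (intro integral_nonneg integrable_continuous_real c) auto
  ultimately show ?thesis using edge_integral[OF c] by (simp add: ip_def)
qed

text \<open>The polarised Robin form of the interval for the parameter \<open>- H\<close>, with the
  derivatives passed as separate arguments.\<close>

definition form :: "(real \<Rightarrow> real) \<Rightarrow> (real \<Rightarrow> real) \<Rightarrow> (real \<Rightarrow> real) \<Rightarrow> (real \<Rightarrow> real) \<Rightarrow> real" where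
  "form f f' g g' = ip f' g' - H * (f (pi/2) * g (pi/2) + f (-pi/2) * g (-pi/2))"

text \<open>Integration by parts: \<open>robin_right\<close> and \<open>robin_left\<close> turn its
  boundary terms into those of \<open>form\<close>. Thus a mode is a weak eigenfunction against
  every C1 function, whatever the boundary behaviour of \<open>v\<close>.\<close>

lemma form_modes:
  assumes v: "C1 v v'"
  shows "form (\<lambda>x. \<Sum>i\<in>A. d i * p i x) (\<lambda>x. \<Sum>i\<in>A. d i * p' i x) v v' = (\<Sum>i\<in>A. d i * \<mu> i * ip (p i) v)"
proof -
  let ?s = "\<lambda>x. \<Sum>i\<in>A. d i * p i x" and ?s' = "\<lambda>x. \<Sum>i\<in>A. d i * p' i x"
  let ?q = "\<lambda>x. \<Sum>i\<in>A. (d i * \<mu> i) * p i x"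
  have v': "(v has_real_derivative v' x) (at x)" for x using v by (simp add: C1_def)
  note c = C1_cont[OF v] cont_mode cont_dmode
  have "(?s' has_real_derivative - ?q x) (at x)" for x
    by (auto intro!: derivative_eq_intros dmode_deriv simp: sum_negf mult_ac)
  then have "((\<lambda>x. ?s' x * v x) has_real_derivative (- ?q x * v x + v' x * ?s' x)) (at x)" for x
    by (rule DERIV_mult) (rule v')
  then have "((\<lambda>x. ?s' x * v x) has_real_derivative (?s' x * v' x - ?q x * v x)) (at x)" for x
    by (simp add: algebra_simps)
  then have "(\<integral>x. ?s' x * v' x - ?q x * v x \<partial>edge) = ?s' (pi/2) * v (pi/2) - ?s' (-pi/2) * v (-pi/2)"
    by (rule edge_FTC) (intro continuous_intros c)
  also have "?s' (pi/2) = H * ?s (pi/2)" by (simp add: robin_right sum_distrib_left algebra_simps)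
  also have "?s' (-pi/2) = - (H * ?s (-pi/2))" using robin_left by (simp add: sum_distrib_left algebra_simps sum_negf)
  also have "(\<integral>x. ?s' x * v' x - ?q x * v x \<partial>edge) = ip ?s' v' - ip ?q v"
    unfolding ip_def by (rule Bochner_Integration.integral_diff) (intro edge_integrable continuous_intros c)+
  also have "ip ?q v = (\<Sum>i\<in>A. d i * \<mu> i * ip (p i) v)"
    by (rule ip_sum) (intro c)+
  finally show ?thesis unfolding form_def by (simp add: algebra_simps)
qed

lemma ip_mode_orth: "i \<noteq> j \<Longrightarrow> ip (p i) (p j) = 0"
proof -
  assume "i \<noteq> j"
  have "form (p i) (p' i) (p j) (p' j) = \<mu> i * ip (p i) (p j)" for i j
    using form_modes[OF C1_mode, of "\<lambda>_. 1" "{i}" j] by simp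
  moreover have "form (p i) (p' i) (p j) (p' j) = form (p j) (p' j) (p i) (p' i)"
    unfolding form_def by (subst ip_commute) (simp add: mult.commute)
  moreover have "\<mu> i \<noteq> \<mu> j" using \<open>i \<noteq> j\<close> eigv_strict_mono by (meson strict_mono_eq)
  moreover have "ip (p i) (p j) = ip (p j) (p i)" by (rule ip_commute)
  ultimately show ?thesis by (metis mult_right_cancel)
qed

text \<open>Pythagoras for the inner product and for the Robin form at once:
  \<open>form_modes\<close> reduces the cross terms of the form to inner products, which vanish by
  orthogonality.\<close>

lemma mode_expansion:
  fixes d :: "nat \<Rightarrow> real" and e :: real
  assumes v: "C1 v v'" and orth: "\<And>i. i \<le> N \<Longrightarrow> ip (p i) v = 0"
  defines "g \<equiv> \<lambda>x. (\<Sum>i\<le>N. d i * p i x) + e * v x"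
    and "g' \<equiv> \<lambda>x. (\<Sum>i\<le>N. d i * p' i x) + e * v' x"
  shows "ip g g = (\<Sum>i\<le>N. (d i)\<^sup>2 * ip (p i) (p i)) + e\<^sup>2 * ip v v" (is ?A)
    and "form g g' g g' = (\<Sum>i\<le>N. (d i)\<^sup>2 * \<mu> i * ip (p i) (p i)) + e\<^sup>2 * form v v' v v'" (is ?B)
proof -
  let ?s = "\<lambda>x. \<Sum>i\<le>N. d i * p i x" and ?s' = "\<lambda>x. \<Sum>i\<le>N. d i * p' i x"
  have s: "C1 ?s ?s'" by (intro C1_sum C1_cmult C1_mode)
  note c = C1_cont[OF v] C1_cont[OF s] cont_mode cont_dmode
  have sv: "ip ?s v = 0" by (subst ip_sum) (auto intro!: c simp: orth)
  have ps: "ip (p i) ?s = d i * ip (p i) (p i)" if "i \<le> N" for i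
  proof -
    have "ip (p i) ?s = ip ?s (p i)" by (rule ip_commute)
    also have "\<dots> = (\<Sum>j\<le>N. d j * ip (p j) (p i))" by (rule ip_sum) (intro c)+
    also have "\<dots> = (\<Sum>j\<le>N. if j = i then d i * ip (p i) (p i) else 0)"
      by (intro sum.cong) (auto simp: ip_mode_orth)
    finally show ?thesis using that by simp
  qed
  have "ip ?s ?s = (\<Sum>j\<le>N. d j * ip (p j) ?s)" by (rule ip_sum) (intro c)+
  also have "\<dots> = (\<Sum>i\<le>N. (d i)\<^sup>2 * ip (p i) (p i))"
    by (intro sum.cong) (auto simp: ps power2_eq_square)
  finally have ss: "ip ?s ?s = (\<Sum>i\<le>N. (d i)\<^sup>2 * ip (p i) (p i))" .
  show ?A unfolding g_def by (subst ip_square) (auto intro!: c simp: sv ss)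
  have "form ?s ?s' ?s ?s' = (\<Sum>i\<le>N. d i * \<mu> i * ip (p i) ?s)" by (rule form_modes[OF s])
  also have "\<dots> = (\<Sum>i\<le>N. (d i)\<^sup>2 * \<mu> i * ip (p i) (p i))"
    by (intro sum.cong) (auto simp: ps power2_eq_square)
  finally have fss: "form ?s ?s' ?s ?s' = (\<Sum>i\<le>N. (d i)\<^sup>2 * \<mu> i * ip (p i) (p i))" .
  have fsv: "form ?s ?s' v v' = 0" by (subst form_modes[OF v]) (simp add: orth)
  have "form g g' g g' = form ?s ?s' ?s ?s' + 2 * e * form ?s ?s' v v' + e\<^sup>2 * form v v' v v'"
    unfolding g_def g'_def form_def
    by (subst ip_square) (auto intro!: c simp: algebra_simps power2_eq_square)
  then show ?B by (simp add: fss fsv)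
qed

definition coeff :: "(real \<Rightarrow> real) \<Rightarrow> nat \<Rightarrow> real" where
  "coeff f i = ip f (p i) / ip (p i) (p i)"

text \<open>Some nonzero combination \<open>g\<close> of the modes up to \<open>N\<close> and of the remainder \<open>r\<close> vanishes at
  \<open>N + 1\<close> equally spaced points, so its form is at least \<open>N\<^sup>2\<close> times its square norm. As
  \<open>\<mu> i < N\<^sup>2\<close> for \<open>i \<le> N\<close>, the same holds for \<open>r\<close>, whose form is bounded independently of \<open>N\<close>.\<close>

lemma mode_approx:
  assumes f: "C1 f f'"
  shows "\<exists>C. \<forall>N\<ge>1. (\<integral>x. (f x - (\<Sum>i\<le>N. coeff f i * p i x))\<^sup>2 \<partial>edge) \<le> C / (real N)\<^sup>2"
proof -
  \<comment> \<open>Only the terms of the two negative eigenvalues are subtracted. Those of the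
    modes from 2 to \<open>N\<close> are nonnegative and are dropped below, which makes
    \<open>C\<close> independent of \<open>N\<close>.\<close>
  define C where "C = form f f' f f' - (\<Sum>i\<le>1. (coeff f i)\<^sup>2 * \<mu> i * ip (p i) (p i))"
  have "(\<integral>x. (f x - (\<Sum>i\<le>N. coeff f i * p i x))\<^sup>2 \<partial>edge) \<le> C / (real N)\<^sup>2" if N: "N \<ge> 1" for N
  proof -
    let ?s = "\<lambda>x. \<Sum>i\<le>N. coeff f i * p i x" and ?s' = "\<lambda>x. \<Sum>i\<le>N. coeff f i * p' i x"
    define r where "r = (\<lambda>x. f x + (-1) * ?s x)"
    define r' where "r' = (\<lambda>x. f' x + (-1) * ?s' x)"
    have s: "C1 ?s ?s'" by (intro C1_sum C1_cmult C1_mode)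
    have r: "C1 r r'" unfolding r_def r'_def by (intro C1_add C1_cmult s f)
    note c = C1_cont[OF f] C1_cont[OF r] C1_cont[OF s] cont_mode cont_dmode
    have orth: "ip (p i) r = 0" if "i \<le> N" for i
    proof -
      have "ip ?s (p i) = (\<Sum>j\<le>N. coeff f j * ip (p j) (p i))" by (rule ip_sum) (intro c)+
      also have "\<dots> = (\<Sum>j\<le>N. if j = i then coeff f i * ip (p i) (p i) else 0)"
        by (intro sum.cong) (auto simp: ip_mode_orth)
      also have "\<dots> = ip f (p i)" using that ip_mode_pos[of i] by (simp add: coeff_def)
      finally have "ip ?s (p i) = ip f (p i)" .
      moreover have "ip (p i) r = ip f (p i) + ip (\<lambda>x. (-1) * ?s x) (p i)"
        unfolding r_def by (subst ip_commute, rule ip_add) (intro c continuous_intros)+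
      moreover have "ip (\<lambda>x. (-1) * ?s x) (p i) = (-1) * ip ?s (p i)" by (rule ip_cmult)
      ultimately show ?thesis by simp
    qed
    define x where "x = (\<lambda>j::nat. - pi/2 + real j * (pi / real N))"
    \<comment> \<open>\<open>N + 2\<close> unknowns, the coefficients of \<open>N + 1\<close> modes
      and of \<open>r\<close>, against \<open>N + 1\<close> nodes.\<close>
    obtain d where d: "\<exists>i<Suc (Suc N). d i \<noteq> 0"
      "\<forall>j<Suc N. (\<Sum>i<Suc (Suc N). (if i \<le> N then p i (x j) else r (x j)) * d i) = 0"
      using nontrivial_kernel[of "Suc N" "Suc (Suc N)" "\<lambda>j i. if i \<le> N then p i (x j) else r (x j)"] by auto
    define e where "e = d (Suc N)"
    define g where "g = (\<lambda>x. (\<Sum>i\<le>N. d i * p i x) + e * r x)"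
    define g' where "g' = (\<lambda>x. (\<Sum>i\<le>N. d i * p' i x) + e * r' x)"
    have g: "C1 g g'" unfolding g_def g'_def by (intro C1_add C1_sum C1_cmult C1_mode r)
    note c = c C1_cont[OF g]
    have z: "g (x j) = 0" if "j \<le> N" for j
    proof -
      have "0 = (\<Sum>i<Suc (Suc N). (if i \<le> N then p i (x j) else r (x j)) * d i)" using d that by simp
      also have "\<dots> = (\<Sum>i<Suc N. (if i \<le> N then p i (x j) else r (x j)) * d i) + r (x j) * e"
        by (simp add: e_def)
      also have "(\<Sum>i<Suc N. (if i \<le> N then p i (x j) else r (x j)) * d i) = (\<Sum>i\<le>N. d i * p i (x j))"
        by (intro sum.cong) auto
      finally show ?thesis by (simp add: g_def mult.commute)
    qed
    have ends: "g (-pi/2) = 0" "g (pi/2) = 0" using z[of 0] z[of N] N by (simp_all add: x_def)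
    have conv: "integral {-pi/2..pi/2} (\<lambda>x. (u x)\<^sup>2) = ip u u" if "\<And>S. continuous_on S u" for u
      unfolding ip_def power2_eq_square by (rule edge_integral[symmetric]) (intro continuous_intros that)
    have "k\<^sup>2 * ip g g \<le> ip g' g'" if "0 \<le> k" "k < real N" for k
      using wirtinger_nodes[OF N that, of g g'] g z
      unfolding conv[OF C1_cont(1)[OF g]] conv[OF C1_cont(2)[OF g]] C1_def x_def by blast
    \<comment> \<open>The inequality is available for \<open>k < N\<close> only; letting
      \<open>k\<close> tend to \<open>N\<close> gives the full constant.\<close>
    moreover have "((\<lambda>k. k\<^sup>2 * ip g g) \<longlongrightarrow> (real N)\<^sup>2 * ip g g) (at_left (real N))"
      by (intro tendsto_intros)
    moreover have "\<forall>\<^sub>F k in at_left (real N). 0 \<le> k \<and> k < real N"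
      using N eventually_at_left_real[of 0 "real N"] by (auto elim: eventually_mono)
    ultimately have "(real N)\<^sup>2 * ip g g \<le> ip g' g'"
      by (intro tendsto_upperbound[of "\<lambda>k. k\<^sup>2 * ip g g" _ "at_left (real N)"]) (auto elim: eventually_mono)
    \<comment> \<open>The first and the last node are the end points, so the boundary part of the
      form of \<open>g\<close> disappears.\<close>
    also have "ip g' g' = form g g' g g'" unfolding form_def ends by simp
    finally have le: "(real N)\<^sup>2 * ((\<Sum>i\<le>N. (d i)\<^sup>2 * ip (p i) (p i)) + e\<^sup>2 * ip r r)
       \<le> (\<Sum>i\<le>N. (d i)\<^sup>2 * \<mu> i * ip (p i) (p i)) + e\<^sup>2 * form r r' r r'"
      using mode_expansion[OF r orth, where d = d and e = e] by (simp add: g_def g'_def)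
    define D where "D = (\<Sum>i\<le>N. (d i)\<^sup>2 * ((real N)\<^sup>2 - \<mu> i) * ip (p i) (p i))"
    have le': "D \<le> e\<^sup>2 * (form r r' r r' - (real N)\<^sup>2 * ip r r)"
      using le unfolding D_def by (simp add: algebra_simps sum_subtractf sum_distrib_left)
    have Dt: "(d i)\<^sup>2 * ((real N)\<^sup>2 - \<mu> i) * ip (p i) (p i) \<ge> 0" if "i \<le> N" for i
      using eigv_lt[OF N that] ip_mode_pos[of i] by simp
    have D: "D \<ge> 0" unfolding D_def using Dt by (intro sum_nonneg) auto
    \<comment> \<open>Without a contribution of \<open>r\<close> the strict inequality
      \<open>\<mu> i < N^2\<close> would force every coefficient to vanish.\<close>
    have "e \<noteq> 0"
    proof
      assume "e = 0"
      then have "D = 0" using le' D by simp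
      then have "(d i)\<^sup>2 * ((real N)\<^sup>2 - \<mu> i) * ip (p i) (p i) = 0" if "i \<le> N" for i
        using Dt that unfolding D_def by (subst (asm) sum_nonneg_eq_0_iff) auto
      then have "d i = 0" if "i \<le> N" for i
        using eigv_lt[OF N that] ip_mode_pos[of i] that by fastforce
      then show False using d(1) \<open>e = 0\<close> by (auto simp: e_def less_Suc_eq le_less)
    qed
    then have "0 \<le> form r r' r r' - (real N)\<^sup>2 * ip r r"
      using D le' by (metis dual_order.trans zero_le_mult_iff not_le zero_less_power2)
    moreover have "form f f' f f' = (\<Sum>i\<le>N. (coeff f i)\<^sup>2 * \<mu> i * ip (p i) (p i)) + form r r' r r'"
      using mode_expansion(2)[OF r orth, where N = N and d = "coeff f" and e = 1] by (simp add: r_def r'_def)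
    moreover have "(\<Sum>i\<le>1. (coeff f i)\<^sup>2 * \<mu> i * ip (p i) (p i)) \<le> (\<Sum>i\<le>N. (coeff f i)\<^sup>2 * \<mu> i * ip (p i) (p i))"
    proof (rule sum_mono2)
      fix i assume "i \<in> {..N} - {..1}"
      then have "\<mu> i > 0" by (intro eigv_pos) auto
      then show "0 \<le> (coeff f i)\<^sup>2 * \<mu> i * ip (p i) (p i)" using ip_mode_pos[of i] by simp
    qed (use N in auto)
    ultimately have "(real N)\<^sup>2 * ip r r \<le> C" by (simp add: C_def)
    then have "ip r r \<le> C / (real N)\<^sup>2" using N by (simp add: field_simps)
    then show ?thesis by (simp add: ip_def r_def power2_eq_square)
  qed
  then show ?thesis by blast
qed

end

section \<open>Square-integrable functions on the square\<close>

abbreviation csquare :: "(real \<times> real) set" where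
  "csquare \<equiv> {-pi/2..pi/2} \<times> {-pi/2..pi/2}"

lemma finite_edge: "finite_measure edge"
  by (rule finite_measureI) (simp add: emeasure_restrict_space space_restrict_space)

text \<open>\<open>area\<close> is a restriction of planar Lebesgue measure, not a product by
  definition; the identification makes Fubini available.\<close>

lemma area_prod: "edge \<Otimes>\<^sub>M edge = area"
proof (rule pair_measure_eqI)
  show "sigma_finite_measure edge" using finite_edge by (simp add: finite_measure_def)
  then show "sigma_finite_measure edge" .
  let ?I = "{-pi/2<..<pi/2}"
  have sp: "space (edge \<Otimes>\<^sub>M edge) = square" by (simp add: space_pair_measure space_restrict_space square_def)
  show "sets (edge \<Otimes>\<^sub>M edge) = sets area"
  proof
    show "sets (edge \<Otimes>\<^sub>M edge) \<subseteq> sets area"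
    proof -
      have "{a \<times> b |a b. a \<in> sets edge \<and> b \<in> sets edge} \<subseteq> sets area"
      proof safe
        fix a b assume "a \<in> sets edge" "b \<in> sets edge"
        then obtain a' b' where "a' \<in> sets borel" "a = ?I \<inter> a'" "b' \<in> sets borel" "b = ?I \<inter> b'"
          by (auto simp: sets_restrict_space)
        moreover then have "a' \<times> b' \<in> sets borel" by (intro borel_Times)
        moreover have "a \<times> b = square \<inter> (a' \<times> b')" using calculation by (auto simp: square_def)
        ultimately show "a \<times> b \<in> sets area" by (auto simp: sets_restrict_space)
      qed
      then have "sigma_sets (space edge \<times> space edge) {a \<times> b |a b. a \<in> sets edge \<and> b \<in> sets edge} \<subseteq> sets area"
        using sets.sigma_sets_subset[of _ area] sp by (simp add: space_pair_measure space_restrict_space)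
      then show ?thesis by (simp add: sets_pair_measure)
    qed
    show "sets area \<subseteq> sets (edge \<Otimes>\<^sub>M edge)"
    proof
      fix X assume "X \<in> sets area"
      then obtain X' where X': "X' \<in> sets borel" "X = square \<inter> X'" by (auto simp: sets_restrict_space)
      have m: "(\<lambda>x. x) \<in> edge \<rightarrow>\<^sub>M borel" by (rule measurable_restrict_space1) simp
      have "(\<lambda>z. (fst z, snd z)) \<in> edge \<Otimes>\<^sub>M edge \<rightarrow>\<^sub>M borel \<Otimes>\<^sub>M borel"
        by (intro measurable_Pair measurable_compose[OF measurable_fst m] measurable_compose[OF measurable_snd m])
      then have "(\<lambda>z. z) \<in> edge \<Otimes>\<^sub>M edge \<rightarrow>\<^sub>M borel" by (simp add: borel_prod)
      from measurable_sets[OF this X'(1)] show "X \<in> sets (edge \<Otimes>\<^sub>M edge)"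
        using X' sp by (simp add: vimage_def Int_commute Collect_mem_eq)
    qed
  qed
  fix A B assume "A \<in> sets edge" "B \<in> sets edge"
  then have AB: "A \<in> sets borel" "B \<in> sets borel" "A \<subseteq> ?I" "B \<subseteq> ?I" by (auto simp: sets_restrict_space)
  then have "emeasure area (A \<times> B) = emeasure lborel (A \<times> B)"
    by (intro emeasure_restrict_space) (auto simp: square_def intro!: borel_open open_Times)
  also have "\<dots> = emeasure lborel A * emeasure lborel B"
    unfolding lborel_prod[symmetric] using AB by (intro lborel.emeasure_pair_measure_Times) auto
  also have "\<dots> = emeasure edge A * emeasure edge B"
    using AB by (simp add: emeasure_restrict_space)
  finally show "emeasure edge A * emeasure edge B = emeasure area (A \<times> B)" by simp
qed

lemma square_sets [measurable]: "square \<in> sets borel"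
  by (auto simp: square_def intro!: borel_open open_Times)

interpretation edge: finite_measure edge by (rule finite_edge)
interpretation edges: pair_sigma_finite edge edge ..

lemma finite_area: "finite_measure area"
proof (rule finite_measureI)
  have "emeasure area (space area) = emeasure edge (space edge) * emeasure edge (space edge)"
    unfolding area_prod[symmetric] space_pair_measure by (rule edge.emeasure_pair_measure_Times) (rule sets.top)+
  then show "emeasure area (space area) \<noteq> \<infinity>"
    using edge.emeasure_finite by (metis ennreal_mult_eq_top_iff infinity_ennreal_def)
qed

interpretation area: finite_measure area by (rule finite_area)

lemma cont_measurable:
  fixes f :: "real \<times> real \<Rightarrow> 'b::euclidean_space"
  assumes "continuous_on UNIV f" shows "f \<in> borel_measurable area"
  by (intro measurable_restrict_space1) (simp add: borel_measurable_continuous_onI assms)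

lemma area_integrable:
  fixes f :: "real \<times> real \<Rightarrow> 'b::euclidean_space"
  assumes f: "continuous_on UNIV f" shows "integrable area f"
proof -
  have "compact (f ` csquare)"
    by (intro compact_continuous_image continuous_on_subset[OF f] compact_Times) auto
  then obtain B where B: "\<And>z. z \<in> csquare \<Longrightarrow> norm (f z) \<le> B"
    using compact_imp_bounded bounded_iff by (metis (no_types, lifting) image_eqI)
  show ?thesis
  proof (rule area.integrable_const_bound[where B = B])
    have "square \<subseteq> csquare" by (auto simp: square_def)
    then show "AE z in area. norm (f z) \<le> B"
      using B by (intro AE_I2) (auto simp: space_restrict_space)
  qed (rule cont_measurable[OF f])
qed

lemma area_fubini:
  fixes f :: "real \<times> real \<Rightarrow> real"
  assumes "integrable area f"
  shows "(\<integral>z. f z \<partial>area) = (\<integral>x. (\<integral>y. f (x, y) \<partial>edge) \<partial>edge)"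
    and "(\<integral>z. f z \<partial>area) = (\<integral>y. (\<integral>x. f (x, y) \<partial>edge) \<partial>edge)"
proof -
  have i: "integrable (edge \<Otimes>\<^sub>M edge) f" using assms by (simp only: area_prod)
  show "(\<integral>z. f z \<partial>area) = (\<integral>x. (\<integral>y. f (x, y) \<partial>edge) \<partial>edge)"
    unfolding area_prod[symmetric] using edges.integral_fst'[OF i] by simp
  show "(\<integral>z. f z \<partial>area) = (\<integral>y. (\<integral>x. f (x, y) \<partial>edge) \<partial>edge)"
    unfolding area_prod[symmetric] using edges.integral_snd[of "\<lambda>x y. f (x, y)"] i by simp
qed

section \<open>Square-integrable functions: Cauchy-Schwarz and limits of inner products\<close>

lemma L2_inner_integrable:
  assumes "L2 M f" "L2 M g"
  shows "integrable M (\<lambda>x. f x \<bullet> g x)"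
proof (rule Bochner_Integration.integrable_bound)
  show "integrable M (\<lambda>x. (norm (f x))\<^sup>2 + (norm (g x))\<^sup>2)" using assms by (auto simp: L2_def)
  show "(\<lambda>x. f x \<bullet> g x) \<in> borel_measurable M" using assms by (auto simp: L2_def)
  have "\<bar>a \<bullet> b\<bar> \<le> (norm a)\<^sup>2 + (norm b)\<^sup>2" for a b :: 'b
  proof -
    have "\<bar>a \<bullet> b\<bar> \<le> norm a * norm b" by (rule Cauchy_Schwarz_ineq2)
    moreover have "2 * (norm a * norm b) \<le> (norm a)\<^sup>2 + (norm b)\<^sup>2" using sum_squares_bound by (simp add: mult.assoc)
    moreover have "0 \<le> norm a * norm b" by simp
    ultimately show ?thesis by linarith
  qed
  then show "AE x in M. norm (f x \<bullet> g x) \<le> norm ((norm (f x))\<^sup>2 + (norm (g x))\<^sup>2)" by auto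
qed

lemma L2_add_scaled:
  assumes "L2 M f" "L2 M g"
  shows "L2 M (\<lambda>x. f x + c *\<^sub>R g x)"
proof -
  have "integrable M (\<lambda>x. (norm (f x))\<^sup>2 + 2 * c * (f x \<bullet> g x) + c\<^sup>2 * (norm (g x))\<^sup>2)"
    using assms L2_inner_integrable[OF assms] by (auto simp: L2_def)
  also have "(\<lambda>x. (norm (f x))\<^sup>2 + 2 * c * (f x \<bullet> g x) + c\<^sup>2 * (norm (g x))\<^sup>2) = (\<lambda>x. (norm (f x + c *\<^sub>R g x))\<^sup>2)"
    unfolding power2_norm_eq_inner by (rule ext) (simp add: inner_add_left inner_add_right inner_commute power2_eq_square algebra_simps)
  finally show ?thesis using assms by (auto simp: L2_def)
qed

lemma L2_Cauchy_Schwarz: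
  assumes f: "L2 M f" and g: "L2 M g"
  shows "(\<integral>x. f x \<bullet> g x \<partial>M)\<^sup>2 \<le> (\<integral>x. (norm (f x))\<^sup>2 \<partial>M) * (\<integral>x. (norm (g x))\<^sup>2 \<partial>M)"
proof -
  define A B C where "A = (\<integral>x. (norm (f x))\<^sup>2 \<partial>M)" and "B = (\<integral>x. f x \<bullet> g x \<partial>M)"
    and "C = (\<integral>x. (norm (g x))\<^sup>2 \<partial>M)"
  have i: "integrable M (\<lambda>x. (norm (f x))\<^sup>2)" "integrable M (\<lambda>x. (norm (g x))\<^sup>2)" "integrable M (\<lambda>x. f x \<bullet> g x)"
    using f g L2_inner_integrable[OF f g] by (auto simp: L2_def)
  have q: "0 \<le> A + 2 * t * B + t\<^sup>2 * C" for t
  proof -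
    have "0 \<le> (\<integral>x. (norm (f x + t *\<^sub>R g x))\<^sup>2 \<partial>M)" by simp
    also have "(\<lambda>x. (norm (f x + t *\<^sub>R g x))\<^sup>2) = (\<lambda>x. (norm (f x))\<^sup>2 + 2 * t * (f x \<bullet> g x) + t\<^sup>2 * (norm (g x))\<^sup>2)"
      unfolding power2_norm_eq_inner by (rule ext) (simp add: inner_add_left inner_add_right inner_commute power2_eq_square algebra_simps)
    also have "(\<integral>x. \<dots> x \<partial>M) = A + 2 * t * B + t\<^sup>2 * C"
      using i by (simp add: A_def B_def C_def)
    finally show ?thesis .
  qed
  have C: "C \<ge> 0" by (simp add: C_def)
  have "B\<^sup>2 \<le> A * C"
  proof (cases "C = 0")
    case True
    have "B = 0"
    proof (rule ccontr)
      assume "B \<noteq> 0"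
      \<comment> \<open>For \<open>C = 0\<close> the nonnegative quadratic \<open>q\<close> is
        affine in \<open>t\<close>; this \<open>t\<close> would give it the value -1.\<close>
      then have "A + 2 * (- (A + 1) / (2 * B)) * B + (- (A + 1) / (2 * B))\<^sup>2 * C = -1" using True by (simp add: field_simps)
      then show False using q[of "- (A + 1) / (2 * B)"] by simp
    qed
    then show ?thesis using True by simp
  next
    case False
    have "0 \<le> C * (A + 2 * (- B / C) * B + (- B / C)\<^sup>2 * C)" by (rule mult_nonneg_nonneg[OF C q])
    also have "\<dots> = A * C - B\<^sup>2" using False by (simp add: field_simps power2_eq_square)
    finally show ?thesis by simp
  qed
  then show ?thesis by (simp add: A_def B_def C_def)
qed

lemma L2_tendsto_inner:
  assumes w: "\<And>n. L2 M (w n)" and f: "L2 M f" and v: "L2 M v" and lim: "L2_tendsto M w f"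
  shows "(\<lambda>n. \<integral>x. w n x \<bullet> v x \<partial>M) \<longlonglongrightarrow> (\<integral>x. f x \<bullet> v x \<partial>M)"
proof -
  let ?d = "\<lambda>n. \<integral>x. (w n x + (-1) *\<^sub>R f x) \<bullet> v x \<partial>M"
  have "(?d n)\<^sup>2 \<le> (\<integral>x. (norm (w n x - f x))\<^sup>2 \<partial>M) * (\<integral>x. (norm (v x))\<^sup>2 \<partial>M)" for n
    using L2_Cauchy_Schwarz[OF L2_add_scaled[OF w f] v, of n "-1"] by simp
  moreover have "(\<lambda>n. (\<integral>x. (norm (w n x - f x))\<^sup>2 \<partial>M) * (\<integral>x. (norm (v x))\<^sup>2 \<partial>M)) \<longlonglongrightarrow> 0 * (\<integral>x. (norm (v x))\<^sup>2 \<partial>M)"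
    using lim unfolding L2_tendsto_def by (intro tendsto_intros)
  ultimately have "(\<lambda>n. (?d n)\<^sup>2) \<longlonglongrightarrow> 0"
    by (intro tendsto_sandwich[of "\<lambda>_. 0" "\<lambda>n. (?d n)\<^sup>2"]) auto
  then have d: "?d \<longlonglongrightarrow> 0" by simp
  have "?d n = (\<integral>x. w n x \<bullet> v x \<partial>M) - (\<integral>x. f x \<bullet> v x \<partial>M)" for n
    using L2_inner_integrable[OF w v, of n] L2_inner_integrable[OF f v] by (simp add: inner_diff_left)
  then show ?thesis using d by (simp add: LIM_zero_iff)
qed

lemma L2_cont:
  fixes f :: "real \<times> real \<Rightarrow> 'b::euclidean_space"
  assumes "continuous_on UNIV f" shows "L2 area f"
  unfolding L2_def by (intro conjI cont_measurable area_integrable continuous_intros assms)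

lemma L2_cont_edge:
  fixes f :: "real \<Rightarrow> 'b::euclidean_space"
  assumes "continuous_on UNIV f" shows "L2 edge f"
  unfolding L2_def
proof
  show "f \<in> borel_measurable edge"
    by (intro measurable_restrict_space1) (simp add: borel_measurable_continuous_onI assms)
  show "integrable edge (\<lambda>x. (norm (f x))\<^sup>2)"
    by (intro edge_integrable continuous_intros continuous_on_subset[OF assms]) simp
qed

definition tens :: "(real \<Rightarrow> real) \<Rightarrow> (real \<Rightarrow> real) \<Rightarrow> real \<times> real \<Rightarrow> real" where
  "tens f g z = f (fst z) * g (snd z)"

lemma cont_tens:
  assumes "continuous_on UNIV f" "continuous_on UNIV g"
  shows "continuous_on S (tens f g)"
proof -
  have "continuous_on UNIV (\<lambda>z::real\<times>real. f (fst z) * g (snd z))"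
    by (intro continuous_intros continuous_on_compose2[OF assms(1)] continuous_on_compose2[OF assms(2)]) auto
  then show ?thesis unfolding tens_def[abs_def] by (rule continuous_on_subset) simp
qed

lemma tens_integral:
  assumes "continuous_on UNIV f" "continuous_on UNIV g"
  shows "(\<integral>z. tens f g z \<partial>area) = (\<integral>x. f x \<partial>edge) * (\<integral>x. g x \<partial>edge)"
  by (subst area_fubini(1)[OF area_integrable[OF cont_tens[OF assms]]]) (simp add: tens_def)

lemma tens_mult: "tens f g z * tens f' g' z = tens (\<lambda>x. f x * f' x) (\<lambda>x. g x * g' x) z"
  by (simp add: tens_def)

section \<open>Completeness of the products of modes\<close>

lemma L2_mult_integrable:
  fixes f g :: "'a \<Rightarrow> real"
  assumes "L2 M f" "L2 M g" shows "integrable M (\<lambda>x. f x * g x)"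
  using L2_inner_integrable[OF assms] by (simp add: inner_real_def)

lemma max_square_deriv:
  "((\<lambda>t. (max 0 t)\<^sup>2) has_real_derivative 2 * max 0 t) (at (t::real))"
proof -
  consider "t < 0" | "t > 0" | "t = 0" by linarith
  then show ?thesis
  proof cases
    case 1
    have "((\<lambda>t. 0) has_real_derivative 0) (at t)" by simp
    then have "((\<lambda>t. (max 0 t)\<^sup>2) has_real_derivative 0) (at t)"
      by (rule has_field_derivative_transform_within_open[where S = "{..<0}"]) (use 1 in auto)
    then show ?thesis using 1 by simp
  next
    case 2
    have "((\<lambda>t. t\<^sup>2) has_real_derivative 2 * t) (at t)" by (auto intro!: derivative_eq_intros)
    then have "((\<lambda>t. (max 0 t)\<^sup>2) has_real_derivative 2 * t) (at t)"
      by (rule has_field_derivative_transform_within_open[where S = "{0<..}"]) (use 2 in auto)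
    then show ?thesis using 2 by simp
  next
    case 3
    have "((\<lambda>t. (max 0 t)\<^sup>2) has_real_derivative 0) (at (0::real))"
      unfolding DERIV_caratheodory_within [where S = UNIV, simplified]
    proof (intro exI conjI allI)
      show "\<And>z::real. (max 0 z)\<^sup>2 - (max 0 0)\<^sup>2 = max 0 z * (z - 0)" by (simp add: power2_eq_square max_def)
      show "continuous (at 0) (\<lambda>z::real. max 0 z)" by (intro continuous_intros)
    qed simp
    then show ?thesis using 3 by simp
  qed
qed

text \<open>A C1 replacement for the indicator of the open interval from \<open>a\<close> to
  \<open>b\<close>: \<open>s\<close> is positive exactly there, and the quotient tends to 1 wherever
  \<open>s > 0\<close> as \<open>k\<close> grows. Squaring \<open>max 0\<close> smooths the function
  at the end points.\<close>

definition bump :: "nat \<Rightarrow> real \<Rightarrow> real \<Rightarrow> real \<Rightarrow> real" where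
  "bump k a b x = (let s = (max 0 (x - a))\<^sup>2 * (max 0 (b - x))\<^sup>2 in real k * s / (1 + real k * s))"

lemma bump_C1: "\<exists>f'. C1 (bump k a b) f'"
proof -
  define s where "s = (\<lambda>x::real. (max 0 (x - a))\<^sup>2 * (max 0 (b - x))\<^sup>2)"
  define s' where "s' = (\<lambda>x::real. 2 * max 0 (x - a) * (max 0 (b - x))\<^sup>2 + (max 0 (x - a))\<^sup>2 * (- 2 * max 0 (b - x)))"
  have s0: "s x \<ge> 0" for x by (simp add: s_def)
  have pos: "1 + real k * s x > 0" for x using s0[of x] by (simp add: add_pos_nonneg)
  then have nz: "1 + real k * s x \<noteq> 0" for x by (metis less_irrefl)
  have s: "(s has_real_derivative s' x) (at x)" for x
  proof -
    have 1: "((\<lambda>x. (max 0 (x - a))\<^sup>2) has_real_derivative 2 * max 0 (x - a)) (at x)"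
    proof -
      have "((\<lambda>x. x - a) has_real_derivative 1) (at x)" by (auto intro!: derivative_eq_intros)
      from DERIV_chain2[OF max_square_deriv this] show ?thesis by simp
    qed
    have "((\<lambda>x. b - x) has_real_derivative -1) (at x)" by (auto intro!: derivative_eq_intros)
    from DERIV_chain2[OF max_square_deriv this]
    have 2: "((\<lambda>x. (max 0 (b - x))\<^sup>2) has_real_derivative - 2 * max 0 (b - x)) (at x)" by simp
    show ?thesis unfolding s_def s'_def using DERIV_mult[OF 1 2] by (simp add: algebra_simps)
  qed
  have sc: "continuous_on UNIV s" "continuous_on UNIV s'" unfolding s_def s'_def by (intro continuous_intros)+
  have b: "bump k a b = (\<lambda>x. real k * s x / (1 + real k * s x))" by (rule ext) (simp add: bump_def s_def Let_def)
  let ?f' = "\<lambda>x. real k * s' x / (1 + real k * s x)\<^sup>2"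
  have "(bump k a b has_real_derivative ?f' x) (at x)" for x
    unfolding b using nz[of x]
    by (auto intro!: derivative_eq_intros s simp: field_simps power2_eq_square)
  moreover have "continuous_on UNIV ?f'"
    by (intro continuous_intros sc) (use nz in auto)
  ultimately show ?thesis unfolding C1_def by (intro exI[of _ ?f']) auto
qed

lemma bump_range: "\<bar>bump k a b x\<bar> \<le> 1"
proof -
  define s where "s = (max 0 (x - a))\<^sup>2 * (max 0 (b - x))\<^sup>2"
  have "real k * s \<ge> 0" by (simp add: s_def)
  then show ?thesis unfolding bump_def Let_def s_def[symmetric] by simp
qed

lemma bump_limit: "(\<lambda>k. bump k a b x) \<longlonglongrightarrow> indicator {a<..<b} x"
proof (cases "x \<in> {a<..<b}")
  case True
  define s where "s = (max 0 (x - a))\<^sup>2 * (max 0 (b - x))\<^sup>2"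
  have s: "s > 0" using True by (simp add: s_def)
  have "(\<lambda>k. 1 - inverse (1 + real k * s)) \<longlonglongrightarrow> 1 - 0"
  proof (intro tendsto_intros tendsto_inverse_0_at_top)
    have "filterlim (\<lambda>k. real k * s) at_top sequentially"
      by (rule filterlim_at_top_mult_tendsto_pos[OF tendsto_const s filterlim_real_sequentially])
    then show "filterlim (\<lambda>k. 1 + real k * s) at_top sequentially"
      by (intro filterlim_tendsto_add_at_top[OF tendsto_const])
  qed
  moreover have "1 - inverse (1 + real k * s) = bump k a b x" for k
  proof -
    have "1 + real k * s \<noteq> 0" using s by (metis add_nonneg_eq_0_iff less_imp_le mult_nonneg_nonneg of_nat_0_le_iff zero_neq_one zero_le_one)
    then show ?thesis unfolding bump_def Let_def s_def[symmetric] by (simp add: field_simps)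
  qed
  ultimately show ?thesis using True by simp
next
  case False
  then have "bump k a b x = 0" for k by (auto simp: bump_def Let_def not_less)
  then show ?thesis using False by simp
qed

text \<open>Boxes form an intersection-stable generator, so the integral over every Borel set
  vanishes; the sets where \<open>u\<close> is positive or negative then decide. Support in a single
  box gives the zero total integral that the complement step consumes.\<close>

lemma AE_zero_boxes:
  fixes u :: "'a::euclidean_space \<Rightarrow> real"
  assumes u: "integrable lborel u" and 0: "\<And>a b. (\<integral>x. indicator (box a b) x * u x \<partial>lborel) = 0"
    and supp: "\<And>x. x \<notin> box c d \<Longrightarrow> u x = 0"
  shows "AE x in lborel. u x = 0"
proof -
  have tot: "(\<integral>x. u x \<partial>lborel) = 0"
  proof -
    have "(\<lambda>x. indicator (box c d) x * u x) = u"
    proof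
      fix x show "indicator (box c d) x * u x = u x" using supp[of x] by (cases "x \<in> box c d") simp_all
    qed
    then show ?thesis using 0[of c d] by simp
  qed
  have int: "integrable lborel (\<lambda>x. indicator A x * u x)" if "A \<in> sets borel" for A
    using integrable_mult_indicator[of A lborel u] that u by simp
  have A: "(\<integral>x. indicator A x * u x \<partial>lborel) = 0" if "A \<in> sets borel" for A
  proof -
    have "Int_stable (range (\<lambda>(a, b). box a b :: 'a set))"
      by (auto simp: Int_stable_def box_Int_box)
    moreover have "range (\<lambda>(a, b). box a b :: 'a set) \<subseteq> Pow UNIV" by simp
    moreover have "A \<in> sigma_sets UNIV (range (\<lambda>(a, b). box a b :: 'a set))"
      using that by (subst (asm) borel_eq_box) simp
    ultimately show ?thesis
    proof (induction rule: sigma_sets_induct_disjoint)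
      case (basic A)
      then show ?case using 0 by auto
    next
      case empty
      then show ?case by simp
    next
      case (compl A)
      then have "A \<in> sets borel" by (subst borel_eq_box) simp
      have "indicator (UNIV - A) x * u x = u x - indicator A x * u x" for x by (simp add: indicator_def)
      then show ?case using compl int[OF \<open>A \<in> sets borel\<close>] u tot by simp
    next
      case (union A)
      then have m: "A i \<in> sets borel" for i by (subst borel_eq_box) auto
      have "(LINT x:(\<Union>i. A i)|lborel. u x) = (\<Sum>i. (LINT x:(A i)|lborel. u x))"
        by (rule lebesgue_integral_countable_add)
          (use m union u in \<open>auto simp: disjoint_family_on_def set_integrable_def intro!: integrable_mult_indicator[where 'b=real, simplified]\<close>)
      then show ?case using union by (simp add: set_lebesgue_integral_def)
    qed
  qed
  have um: "u \<in> borel_measurable borel" using u by (simp add: borel_measurable_integrable)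
  have "AE x in lborel. indicator {x. u x > 0} x * u x = 0"
  proof (subst integral_nonneg_eq_0_iff_AE[symmetric])
    have "{x. u x > 0} \<in> sets borel" using um by simp
    from int[OF this] A[OF this]
    show "integrable lborel (\<lambda>x. indicator {x. u x > 0} x * u x)"
      "(\<integral>x. indicator {x. u x > 0} x * u x \<partial>lborel) = 0" .
  qed (auto simp: indicator_def)
  moreover have "AE x in lborel. indicator {x. u x < 0} x * - u x = 0"
  proof (subst integral_nonneg_eq_0_iff_AE[symmetric])
    have "{x. u x < 0} \<in> sets borel" using um by simp
    from int[OF this] A[OF this]
    show "integrable lborel (\<lambda>x. indicator {x. u x < 0} x * - u x)"
      "(\<integral>x. indicator {x. u x < 0} x * - u x \<partial>lborel) = 0" by simp_all
  qed (auto simp: indicator_def)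
  ultimately show ?thesis by eventually_elim (auto simp: indicator_def split: if_splits)
qed

text \<open>Products of \<open>bump\<close> functions converge boundedly to indicators of boxes, so
  dominated convergence reduces the claim to \<open>AE_zero_boxes\<close>.\<close>

lemma AE_zero_tens:
  assumes u: "L2 area u"
    and 0: "\<And>f f' g g'. C1 f f' \<Longrightarrow> C1 g g' \<Longrightarrow> (\<integral>z. u z * tens f g z \<partial>area) = 0"
  shows "AE z in area. u z = 0"
proof -
  have ui: "integrable area u"
    using L2_mult_integrable[OF u L2_cont[of "\<lambda>_. 1"]] by simp
  have um: "u \<in> borel_measurable area" using u by (simp add: L2_def)
  have box: "(\<integral>z. indicator (box (a, c) (b, d)) z * u z \<partial>area) = 0" for a b c d :: real
  proof -
    let ?t = "\<lambda>k. tens (bump k a b) (bump k c d)"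
    have "(\<lambda>k. \<integral>z. u z * ?t k z \<partial>area) \<longlonglongrightarrow> (\<integral>z. u z * tens (indicator {a<..<b}) (indicator {c<..<d}) z \<partial>area)"
    proof (rule integral_dominated_convergence[where w = "\<lambda>z. \<bar>u z\<bar>"])
      show "integrable area (\<lambda>z. \<bar>u z\<bar>)" using ui by simp
      have "?t k \<in> borel_measurable area" for k
        using bump_C1 C1_cont(1) by (metis cont_measurable cont_tens)
      then show "(\<lambda>z. u z * ?t k z) \<in> borel_measurable area" for k using um by simp
      have ind: "tens (indicator {a<..<b}) (indicator {c<..<d}) = (indicator (box (a, c) (b, d)) :: _ \<Rightarrow> real)"
        by (rule ext) (auto simp: tens_def indicator_def box_prod split: prod.splits)
      show "(\<lambda>z. u z * tens (indicator {a<..<b}) (indicator {c<..<d}) z) \<in> borel_measurable area"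
        unfolding ind by (rule borel_measurable_times[OF um measurable_restrict_space1]) simp
      show "AE z in area. (\<lambda>k. u z * ?t k z) \<longlonglongrightarrow> u z * tens (indicator {a<..<b}) (indicator {c<..<d}) z"
        unfolding tens_def by (intro AE_I2 tendsto_intros bump_limit)
      show "AE z in area. norm (u z * ?t k z) \<le> \<bar>u z\<bar>" for k
      proof (rule AE_I2)
        fix z
        have "\<bar>?t k z\<bar> \<le> 1 * 1" unfolding tens_def abs_mult by (intro mult_mono bump_range) auto
        then show "norm (u z * ?t k z) \<le> \<bar>u z\<bar>" by (simp add: abs_mult mult_left_le)
      qed
    qed
    moreover have "(\<integral>z. u z * ?t k z \<partial>area) = 0" for k
      using bump_C1[of k a b] bump_C1[of k c d] 0 by blast
    ultimately have "(\<integral>z. u z * tens (indicator {a<..<b}) (indicator {c<..<d}) z \<partial>area) = 0"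
      by (simp add: LIMSEQ_const_iff)
    moreover have "u z * tens (indicator {a<..<b}) (indicator {c<..<d}) z = indicator (box (a, c) (b, d)) z * u z" for z
      by (cases z) (auto simp: tens_def indicator_def box_prod split: prod.splits)
    ultimately show ?thesis by simp
  qed
  have sq: "square = box (-pi/2, -pi/2) (pi/2, pi/2)" by (auto simp: square_def box_prod)
  define U where "U = (\<lambda>z. indicator square z * u z)"
  have "AE z in lborel. U z = 0"
  proof (rule AE_zero_boxes)
    show "integrable lborel U" using ui by (simp add: U_def integrable_restrict_space)
    show "z \<notin> box (-pi/2, -pi/2) (pi/2, pi/2) \<Longrightarrow> U z = 0" for z by (simp add: U_def sq)
    fix x y :: "real \<times> real"
    obtain a c b d where xy: "x = (a, c)" "y = (b, d)" by (metis surj_pair)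
    have "(\<integral>z. indicator (box x y) z * U z \<partial>lborel) = (\<integral>z. indicator square z *\<^sub>R (indicator (box x y) z * u z) \<partial>lborel)"
      by (simp add: U_def mult_ac)
    also have "\<dots> = (\<integral>z. indicator (box x y) z * u z \<partial>area)"
      by (rule integral_restrict_space[symmetric]) (simp add: square_sets)
    finally show "(\<integral>z. indicator (box x y) z * U z \<partial>lborel) = 0" by (simp add: xy box)
  qed
  then show ?thesis by (subst AE_restrict_space_iff) (auto simp: square_sets U_def)
qed

context robin
begin

text \<open>\<open>T\<close> stands for multiplication by a fixed function of the other variable, so
  that \<open>mode_approx\<close> can be used once per variable. Partial sums of modes contribute
  nothing to the integral, and Cauchy-Schwarz bounds the remainder by a multiple of 1 / N^2 after
  squaring.\<close>

lemma modes_vanish: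
  assumes u: "L2 area u"
    and c: "\<And>f. continuous_on UNIV f \<Longrightarrow> continuous_on UNIV (T f)"
    and lin: "\<And>f g a z. T (\<lambda>x. f x + a * g x) z = T f z + a * T g z"
    and zero: "\<And>z. T (\<lambda>x. 0) z = 0"
    and K: "\<And>f. continuous_on UNIV f \<Longrightarrow> (\<integral>z. (T f z)\<^sup>2 \<partial>area) = K * (\<integral>x. (f x)\<^sup>2 \<partial>edge)"
    and 0: "\<And>i. (\<integral>z. u z * T (p i) z \<partial>area) = 0"
    and f: "C1 f f'"
  shows "(\<integral>z. u z * T f z \<partial>area) = 0"
proof -
  obtain C where C: "\<And>N. N \<ge> 1 \<Longrightarrow> (\<integral>x. (f x - (\<Sum>i\<le>N. coeff f i * p i x))\<^sup>2 \<partial>edge) \<le> C / (real N)\<^sup>2"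
    using mode_approx[OF f] by blast
  have ui: "integrable area (\<lambda>z. u z * T g z)" if "continuous_on UNIV g" for g
    by (rule L2_mult_integrable[OF u L2_cont[OF c[OF that]]])
  have sum: "(\<integral>z. u z * T (\<lambda>x. \<Sum>i\<in>A. d i * p i x) z \<partial>area) = 0" if "finite A" for A and d :: "nat \<Rightarrow> real"
    using that
  proof (induction A rule: finite_induct)
    case empty
    then show ?case by (simp add: zero)
  next
    case (insert i A)
    let ?s = "\<lambda>x. \<Sum>i\<in>A. d i * p i x"
    have "(\<lambda>x. \<Sum>i\<in>insert i A. d i * p i x) = (\<lambda>x. ?s x + d i * p i x)"
      using insert by auto
    then have "(\<integral>z. u z * T (\<lambda>x. \<Sum>i\<in>insert i A. d i * p i x) z \<partial>area)
        = (\<integral>z. u z * T ?s z + d i * (u z * T (p i) z) \<partial>area)"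
      by (simp only: lin distrib_left mult.left_commute)
    also have "\<dots> = 0"
    proof -
      have "continuous_on UNIV ?s" by (intro continuous_intros cont_mode)
      from ui[OF this] ui[OF cont_mode[of UNIV i]] show ?thesis using insert.IH 0[of i] by simp
    qed
    finally show ?case .
  qed
  define A where "A = (\<integral>z. (u z)\<^sup>2 \<partial>area)"
  let ?I = "\<integral>z. u z * T f z \<partial>area"
  \<comment> \<open>The second alternative covers a negative \<open>A * K\<close>, where the
    estimate itself forces the integral to vanish.\<close>
  have b: "?I\<^sup>2 \<le> A * K * C / (real N)\<^sup>2 \<or> ?I = 0" if N: "N \<ge> 1" for N
  proof -
    let ?s = "\<lambda>x. \<Sum>i\<le>N. coeff f i * p i x"
    let ?r = "\<lambda>x. f x + (-1) * ?s x"
    have s: "continuous_on UNIV ?s" by (intro continuous_intros cont_mode)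
    have r: "continuous_on UNIV ?r" by (intro continuous_intros cont_mode C1_cont[OF f])
    have "T (\<lambda>x. ?r x + 1 * ?s x) z = T ?r z + 1 * T ?s z" for z by (rule lin)
    moreover have "(\<lambda>x. ?r x + 1 * ?s x) = f" by auto
    ultimately have "T f z = T ?r z + T ?s z" for z by (simp only: mult_1)
    then have "?I = (\<integral>z. u z * T ?r z + u z * T ?s z \<partial>area)" by (simp add: distrib_left)
    also have "\<dots> = (\<integral>z. u z * T ?r z \<partial>area)" using sum[of "{..N}" "coeff f"] ui[OF r] ui[OF s] by simp
    finally have "?I\<^sup>2 = (\<integral>z. u z \<bullet> T ?r z \<partial>area)\<^sup>2" by (simp add: inner_real_def)
    also have "\<dots> \<le> A * (\<integral>z. (T ?r z)\<^sup>2 \<partial>area)"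
      using L2_Cauchy_Schwarz[OF u L2_cont[OF c[OF r]]] by (simp add: A_def)
    also have "\<dots> = A * K * (\<integral>x. (?r x)\<^sup>2 \<partial>edge)" using K[OF r] by simp
    finally have *: "?I\<^sup>2 \<le> A * K * (\<integral>x. (?r x)\<^sup>2 \<partial>edge)" .
    show ?thesis
    proof (cases "A * K \<ge> 0")
      case True
      then have "A * K * (\<integral>x. (?r x)\<^sup>2 \<partial>edge) \<le> A * K * (C / (real N)\<^sup>2)"
        using C[OF N] by (intro mult_left_mono) auto
      then show ?thesis using * by simp
    next
      case False
      then have "A * K * (\<integral>x. (?r x)\<^sup>2 \<partial>edge) \<le> 0" by (intro mult_nonpos_nonneg[of "A * K"]) auto
      then have "?I\<^sup>2 \<le> 0" using * by linarith
      then show ?thesis by simp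
    qed
  qed
  show ?thesis
  proof (rule ccontr)
    assume nz: "?I \<noteq> 0"
    have "(\<lambda>N. A * K * C / (real N)\<^sup>2) \<longlonglongrightarrow> 0"
      by (intro tendsto_divide_0[OF tendsto_const] filterlim_at_top_imp_at_infinity filterlim_pow_at_top filterlim_real_sequentially) auto
    moreover have "\<forall>\<^sub>F N in sequentially. ?I\<^sup>2 \<le> A * K * C / (real N)\<^sup>2"
      using b nz by (intro eventually_sequentiallyI[of 1]) blast
    ultimately have "?I\<^sup>2 \<le> 0" by (intro tendsto_lowerbound) auto
    then show False using nz by simp
  qed
qed

text \<open>\<open>modes_vanish\<close> replaces first the left and then the right factor by an
  arbitrary C1 function, after which \<open>AE_zero_tens\<close> applies.\<close>

lemma modes_complete:
  assumes u: "L2 area u" and 0: "\<And>i j. (\<integral>z. u z * tens (p i) (p j) z \<partial>area) = 0"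
  shows "AE z in area. u z = 0"
proof (rule AE_zero_tens[OF u])
  fix f f' g g' assume f: "C1 f f'" and g: "C1 g g'"
  have 1: "(\<integral>z. u z * tens f (p j) z \<partial>area) = 0" for j
  proof (rule modes_vanish[where T = "\<lambda>f. tens f (p j)" and K = "\<integral>x. (p j x)\<^sup>2 \<partial>edge", OF u _ _ _ _ 0 f])
    fix h :: "real \<Rightarrow> real" assume h: "continuous_on UNIV h"
    show "continuous_on UNIV (tens h (p j))" by (intro cont_tens h cont_mode)
    have "(\<integral>z. (tens h (p j) z)\<^sup>2 \<partial>area) = (\<integral>z. tens (\<lambda>x. (h x)\<^sup>2) (\<lambda>x. (p j x)\<^sup>2) z \<partial>area)"
      by (simp add: tens_def power_mult_distrib)
    also have "\<dots> = (\<integral>x. (h x)\<^sup>2 \<partial>edge) * (\<integral>x. (p j x)\<^sup>2 \<partial>edge)"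
      by (intro tens_integral continuous_intros h cont_mode)
    finally show "(\<integral>z. (tens h (p j) z)\<^sup>2 \<partial>area) = (\<integral>x. (p j x)\<^sup>2 \<partial>edge) * (\<integral>x. (h x)\<^sup>2 \<partial>edge)"
      by simp
  qed (simp_all add: tens_def algebra_simps)
  show "(\<integral>z. u z * tens f g z \<partial>area) = 0"
  proof (rule modes_vanish[where T = "\<lambda>g. tens f g" and K = "\<integral>x. (f x)\<^sup>2 \<partial>edge", OF u _ _ _ _ 1 g])
    fix h :: "real \<Rightarrow> real" assume h: "continuous_on UNIV h"
    show "continuous_on UNIV (tens f h)" by (intro cont_tens h C1_cont[OF f])
    have "(\<integral>z. (tens f h z)\<^sup>2 \<partial>area) = (\<integral>z. tens (\<lambda>x. (f x)\<^sup>2) (\<lambda>x. (h x)\<^sup>2) z \<partial>area)"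
      by (simp add: tens_def power_mult_distrib)
    also have "\<dots> = (\<integral>x. (f x)\<^sup>2 \<partial>edge) * (\<integral>x. (h x)\<^sup>2 \<partial>edge)"
      by (intro tens_integral continuous_intros h C1_cont[OF f])
    finally show "(\<integral>z. (tens f h z)\<^sup>2 \<partial>area) = (\<integral>x. (f x)\<^sup>2 \<partial>edge) * (\<integral>x. (h x)\<^sup>2 \<partial>edge)" .
  qed (simp_all add: tens_def algebra_simps)
qed

end

section \<open>The eigenspaces\<close>

lemma fubini_integrable:
  fixes f :: "real \<times> real \<Rightarrow> real"
  assumes "integrable area f"
  shows "integrable edge (\<lambda>x. \<integral>y. f (x, y) \<partial>edge)" "integrable edge (\<lambda>y. \<integral>x. f (x, y) \<partial>edge)"
proof -
  have i: "integrable (edge \<Otimes>\<^sub>M edge) f" using assms by (simp only: area_prod)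
  show "integrable edge (\<lambda>x. \<integral>y. f (x, y) \<partial>edge)" by (rule edges.integrable_fst'[OF i])
  show "integrable edge (\<lambda>y. \<integral>x. f (x, y) \<partial>edge)"
    by (rule edges.integrable_snd[of "\<lambda>x y. f (x, y)"]) (simp only: case_prod_eta i)
qed

lemma Basis_plane: "Basis = {(1, 0), (0, 1) :: real \<times> real}"
  by (auto simp: Basis_prod_def)

lemma grad_plane: "grad f z = (partial (1, 0) f z, partial (0, 1) f (z :: real \<times> real))"
  by (simp add: grad_def Basis_plane)

lemma partial_has_derivative:
  assumes "(f has_derivative D) (at x)" shows "partial e f x = D e"
  using frechet_derivative_at[OF assms] by (simp add: partial_def)

lemma cont_diff_1:
  assumes "cont_diff 1 w"
  shows "continuous_on UNIV w" "e \<in> Basis \<Longrightarrow> continuous_on UNIV (partial e w)" "w differentiable (at x)"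
  using assms by (auto simp: continuous_on_eq_continuous_at intro: differentiable_imp_continuous_within)

lemma smooth_C1: "smooth w \<Longrightarrow> cont_diff 1 w" by (simp add: smooth_def)

lemma partial_line:
  fixes w :: "'a::euclidean_space \<Rightarrow> real"
  assumes w: "w differentiable (at (\<gamma> t))" and \<gamma>: "(\<gamma> has_derivative (\<lambda>h. h *\<^sub>R e)) (at t)"
  shows "((\<lambda>t. w (\<gamma> t)) has_real_derivative partial e w (\<gamma> t)) (at t)"
proof -
  have D: "(w has_derivative frechet_derivative w (at (\<gamma> t))) (at (\<gamma> t))"
    using w frechet_derivative_works by blast
  from has_derivative_compose[OF \<gamma> D]
  have "((\<lambda>t. w (\<gamma> t)) has_derivative (\<lambda>h. frechet_derivative w (at (\<gamma> t)) (h *\<^sub>R e))) (at t)" .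
  moreover have "frechet_derivative w (at (\<gamma> t)) (h *\<^sub>R e) = partial e w (\<gamma> t) * h" for h
    using linear_scale[OF has_derivative_linear[OF D], of h e] by (simp add: partial_def mult.commute)
  ultimately show ?thesis by (simp add: has_field_derivative_def)
qed

lemma deriv_fst:
  fixes w :: "real \<times> real \<Rightarrow> real"
  assumes "w differentiable (at (x, y))"
  shows "((\<lambda>x. w (x, y)) has_real_derivative partial (1, 0) w (x, y)) (at x)"
  by (rule partial_line[where \<gamma> = "\<lambda>x. (x, y)"]) (use assms in \<open>auto intro!: derivative_eq_intros\<close>)

lemma deriv_snd:
  fixes w :: "real \<times> real \<Rightarrow> real"
  assumes "w differentiable (at (x, y))"
  shows "((\<lambda>y. w (x, y)) has_real_derivative partial (0, 1) w (x, y)) (at y)"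
  by (rule partial_line[where \<gamma> = "\<lambda>y. (x, y)"]) (use assms in \<open>auto intro!: derivative_eq_intros\<close>)

lemma cont_grad:
  fixes w :: "real \<times> real \<Rightarrow> real"
  assumes "cont_diff 1 w" shows "continuous_on UNIV (grad w)"
  unfolding grad_plane[abs_def] using cont_diff_1[OF assms]
  by (intro continuous_intros) (auto simp: Basis_plane)

lemma tens_has_derivative:
  assumes "(f has_real_derivative f') (at (fst z))" "(g has_real_derivative g') (at (snd z))"
  shows "(tens f g has_derivative (\<lambda>h. f' * fst h * g (snd z) + f (fst z) * (g' * snd h))) (at z)"
proof -
  have f: "((\<lambda>z. f (fst z)) has_derivative (\<lambda>h. f' * fst h)) (at z)"
    by (rule has_derivative_compose[OF has_derivative_fst[OF has_derivative_ident]])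
      (use assms(1) in \<open>simp add: has_field_derivative_def\<close>)
  have g: "((\<lambda>z. g (snd z)) has_derivative (\<lambda>h. g' * snd h)) (at z)"
    by (rule has_derivative_compose[OF has_derivative_snd[OF has_derivative_ident]])
      (use assms(2) in \<open>simp add: has_field_derivative_def\<close>)
  show ?thesis unfolding tens_def[abs_def] using has_derivative_mult[OF f g] by (simp add: add.commute)
qed

lemma partial_tens:
  assumes "\<And>x. (f has_real_derivative f' x) (at x)" "\<And>x. (g has_real_derivative g' x) (at x)"
  shows "partial (1, 0) (tens f g) = tens f' g" "partial (0, 1) (tens f g) = tens f g'"
  using partial_has_derivative[OF tens_has_derivative[OF assms]]
  by (auto simp: tens_def)

text \<open>\<open>A\<close> and \<open>B\<close> are sequences of successive derivatives. The
  partial derivatives of a product from the two sequences are again such products, so the induction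
  runs over all \<open>k\<close> and \<open>l\<close> together.\<close>

lemma smooth_tens:
  assumes A: "\<And>k x. (A k has_real_derivative A (Suc k) x) (at x)"
    and B: "\<And>k x. (B k has_real_derivative B (Suc k) x) (at x)"
  shows "smooth (tens (A k) (B l))"
proof -
  have c: "continuous_on UNIV (A k)" "continuous_on UNIV (B k)" for k
    by (rule DERIV_continuous_on, rule A) (rule DERIV_continuous_on, rule B)
  have "cont_diff n (tens (A k) (B l))" for n
  proof (induction n arbitrary: k l)
    case 0
    then show ?case by (simp add: cont_tens c)
  next
    case (Suc n)
    have "tens (A k) (B l) differentiable at z" for z
      using tens_has_derivative[OF A B] differentiable_def by blast
    then show ?case using Suc by (simp add: Basis_plane partial_tens[OF A B])
  qed
  then show ?thesis by (simp add: smooth_def)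
qed

section \<open>Green's formula and the products of modes as eigenfunctions\<close>

context robin
begin

lemma smooth_modes: "smooth (tens (p i) (p j))"
proof -
  \<comment> \<open>\<open>A n k\<close> is the \<open>k\<close>-th derivative of the mode: every
    two derivatives contribute a factor \<open>- \<mu> n\<close>.\<close>
  define A where "A = (\<lambda>n k x. (- \<mu> n) ^ (k div 2) * (if even k then p n x else p' n x))"
  have d: "(A n k has_real_derivative A n (Suc k) x) (at x)" for n k x
  proof (cases "even k")
    case True
    then show ?thesis unfolding A_def by (auto intro!: derivative_eq_intros mode_deriv)
  next
    case False
    then obtain m where "k = 2 * m + 1" by (metis oddE)
    then show ?thesis unfolding A_def by (auto intro!: derivative_eq_intros dmode_deriv)
  qed
  have "p n = A n 0" for n by (rule ext) (simp add: A_def)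
  then show ?thesis using smooth_tens[of "A i" "A j" 0 0] d by simp
qed

lemma grad_modes: "grad (tens (p i) (p j)) z = (tens (p' i) (p j) z, tens (p i) (p' j) z)"
  by (simp add: grad_plane partial_tens[OF mode_deriv mode_deriv])

lemma ip_dmode:
  assumes "C1 v v'"
  shows "ip (p' i) v' = \<mu> i * ip (p i) v + H * (p i (pi/2) * v (pi/2) + p i (-pi/2) * v (-pi/2))"
  using form_modes[OF assms, of "\<lambda>_. 1" "{i}"] by (simp add: form_def)

text \<open>The one-dimensional identity \<open>ip_dmode\<close> on each horizontal slice,
  integrated over \<open>y\<close>. The weight \<open>q\<close> will be the mode in the other
  variable.\<close>

lemma green_slices:
  fixes v v' :: "real \<times> real \<Rightarrow> real"
  assumes v: "continuous_on UNIV v" "continuous_on UNIV v'" and q: "continuous_on UNIV q"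
    and d: "\<And>x y. ((\<lambda>x. v (x, y)) has_real_derivative v' (x, y)) (at x)"
  shows "(\<integral>y. (\<integral>x. v' (x, y) * (p' i x * q y) \<partial>edge) \<partial>edge)
    = \<mu> i * (\<integral>y. (\<integral>x. v (x, y) * (p i x * q y) \<partial>edge) \<partial>edge)
      + H * ((\<integral>y. v (pi/2, y) * (p i (pi/2) * q y) \<partial>edge) + (\<integral>y. v (-pi/2, y) * (p i (-pi/2) * q y) \<partial>edge))"
proof -
  have vs: "continuous_on S (\<lambda>x. v (x, y))" "continuous_on S (\<lambda>x. v' (x, y))" "continuous_on S (\<lambda>x. v (y, x))" for S y
    by (rule continuous_on_compose2[OF v(1)] continuous_on_compose2[OF v(2)], auto intro!: continuous_intros)+
  have C1: "C1 (\<lambda>x. v (x, y)) (\<lambda>x. v' (x, y))" for y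
    using d vs by (simp add: C1_def)
  have "integrable area (\<lambda>z. v z * tens (p i) q z)"
    by (intro area_integrable continuous_intros v cont_tens cont_mode q)
  from fubini_integrable(2)[OF this]
  have i1: "integrable edge (\<lambda>y. \<integral>x. v (x, y) * (p i x * q y) \<partial>edge)" by (simp only: tens_def fst_conv snd_conv)
  have i2: "integrable edge (\<lambda>y. v (c, y) * (p i c * q y))" for c
    by (intro edge_integrable continuous_intros vs continuous_on_subset[OF q]) simp
  have slice: "(\<integral>x. v' (x, y) * (p' i x * q y) \<partial>edge)
    = \<mu> i * (\<integral>x. v (x, y) * (p i x * q y) \<partial>edge)
      + H * (v (pi/2, y) * (p i (pi/2) * q y) + v (-pi/2, y) * (p i (-pi/2) * q y))" for y
  proof -
    have a: "(\<integral>x. v' (x, y) * (p' i x * q y) \<partial>edge) = q y * ip (p' i) (\<lambda>x. v' (x, y))"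
      unfolding ip_def by (subst integral_mult_right_zero[symmetric]) (simp add: mult_ac)
    have b: "(\<integral>x. v (x, y) * (p i x * q y) \<partial>edge) = q y * ip (p i) (\<lambda>x. v (x, y))"
      unfolding ip_def by (subst integral_mult_right_zero[symmetric]) (simp add: mult_ac)
    show ?thesis unfolding a b ip_dmode[OF C1] by (simp add: algebra_simps)
  qed
  show ?thesis
    unfolding slice using i1 i2[of "pi/2"] i2[of "-pi/2"]
    by (subst Bochner_Integration.integral_add) (auto simp only: integrable_mult_right integral_mult_right_zero Bochner_Integration.integral_add Bochner_Integration.integrable_add)
qed

lemma green_fst:
  fixes w :: "real \<times> real \<Rightarrow> real"
  assumes w: "cont_diff 1 w" and q: "continuous_on UNIV q"
  shows "(\<integral>z. partial (1, 0) w z * tens (p' i) q z \<partial>area)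
    = \<mu> i * (\<integral>z. w z * tens (p i) q z \<partial>area)
      + H * ((\<integral>t. w (pi/2, t) * tens (p i) q (pi/2, t) \<partial>edge) + (\<integral>t. w (-pi/2, t) * tens (p i) q (-pi/2, t) \<partial>edge))"
proof -
  have wc: "continuous_on UNIV w" "continuous_on UNIV (partial (1, 0) w)"
    using cont_diff_1[OF w] by (auto simp: Basis_plane)
  have "integrable area (\<lambda>z. partial (1, 0) w z * tens (p' i) q z)" "integrable area (\<lambda>z. w z * tens (p i) q z)"
    by (intro area_integrable continuous_intros wc cont_tens cont_mode cont_dmode q)+
  from this[THEN area_fubini(2)] show ?thesis
    using green_slices[OF wc q deriv_fst[OF cont_diff_1(3)[OF w]]] by (simp only: tens_def fst_conv snd_conv)
qed

lemma green_snd: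
  fixes w :: "real \<times> real \<Rightarrow> real"
  assumes w: "cont_diff 1 w" and q: "continuous_on UNIV q"
  shows "(\<integral>z. partial (0, 1) w z * tens q (p' i) z \<partial>area)
    = \<mu> i * (\<integral>z. w z * tens q (p i) z \<partial>area)
      + H * ((\<integral>t. w (t, pi/2) * tens q (p i) (t, pi/2) \<partial>edge) + (\<integral>t. w (t, -pi/2) * tens q (p i) (t, -pi/2) \<partial>edge))"
proof -
  have wc: "continuous_on UNIV w" "continuous_on UNIV (partial (0, 1) w)"
    using cont_diff_1[OF w] by (auto simp: Basis_plane)
  have "integrable area (\<lambda>z. partial (0, 1) w z * tens q (p' i) z)" "integrable area (\<lambda>z. w z * tens q (p i) z)"
    by (intro area_integrable continuous_intros wc cont_tens cont_mode cont_dmode q)+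
  note F = this[THEN area_fubini(1)]
  \<comment> \<open>The second variable is treated by exchanging the coordinates of
    \<open>w\<close>.\<close>
  let ?s = "\<lambda>z :: real \<times> real. (snd z, fst z)"
  have "continuous_on UNIV (\<lambda>z. w (?s z))" "continuous_on UNIV (\<lambda>z. partial (0, 1) w (?s z))"
    by (rule continuous_on_compose2[OF wc(1)] continuous_on_compose2[OF wc(2)], auto intro!: continuous_intros)+
  from green_slices[OF this q, of i] show ?thesis
    unfolding F using deriv_snd[OF cont_diff_1(3)[OF w]] by (simp only: tens_def fst_conv snd_conv mult.commute[of "q _"])
qed

lemma green_smooth:
  assumes w: "cont_diff 1 w"
  shows "(\<integral>z. grad w z \<bullet> grad (tens (p i) (p j)) z \<partial>area) - H * boundary_integral (\<lambda>z. w z * tens (p i) (p j) z)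
    = (\<mu> i + \<mu> j) * (\<integral>z. w z * tens (p i) (p j) z \<partial>area)"
proof -
  have wc: "continuous_on UNIV (partial (1, 0) w)" "continuous_on UNIV (partial (0, 1) w)"
    using cont_diff_1[OF w] by (auto simp: Basis_plane)
  have "(\<integral>z. grad w z \<bullet> grad (tens (p i) (p j)) z \<partial>area)
    = (\<integral>z. partial (1, 0) w z * tens (p' i) (p j) z + partial (0, 1) w z * tens (p i) (p' j) z \<partial>area)"
    by (simp add: grad_modes grad_plane[of w])
  also have "\<dots> = (\<integral>z. partial (1, 0) w z * tens (p' i) (p j) z \<partial>area) + (\<integral>z. partial (0, 1) w z * tens (p i) (p' j) z \<partial>area)"
    by (rule Bochner_Integration.integral_add) (intro area_integrable continuous_intros wc cont_tens cont_mode cont_dmode)+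
  finally show ?thesis
    unfolding green_fst[OF w cont_mode] green_snd[OF w cont_mode] boundary_integral_def sides_def
    by (simp add: algebra_simps)
qed

text \<open>Each term is continuous under the three convergences in \<open>has_trace\<close>, so the
  identity passes from the smooth approximants to their limit. All integrations by parts fall on the
  modes, so no second or normal derivative of \<open>u\<close> appears.\<close>

lemma green_trace:
  assumes u: "has_trace u g \<tau>"
  shows "(\<integral>z. g z \<bullet> grad (tens (p i) (p j)) z \<partial>area) - H * boundary_integral (\<lambda>z. \<tau> z * tens (p i) (p j) z)
    = (\<mu> i + \<mu> j) * (\<integral>z. u z * tens (p i) (p j) z \<partial>area)"
proof -
  let ?P = "tens (p i) (p j)"
  obtain w where w: "\<And>n. smooth (w n)" and lim: "L2_tendsto area w u" "L2_tendsto area (\<lambda>n. grad (w n)) g"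
    and elim: "\<And>\<gamma>. \<gamma> \<in> set sides \<Longrightarrow> L2_tendsto edge (\<lambda>n. w n \<circ> \<gamma>) (\<tau> \<circ> \<gamma>)"
    using u unfolding has_trace_def by blast
  have uL: "L2 area u" "L2 area g" and tL: "\<And>\<gamma>. \<gamma> \<in> set sides \<Longrightarrow> L2 edge (\<tau> \<circ> \<gamma>)"
    using u by (auto simp: has_trace_def H1_def)
  have w1: "cont_diff 1 (w n)" for n using smooth_C1[OF w] .
  note P1 = smooth_C1[OF smooth_modes[of i j]]
  have \<gamma>: "continuous_on UNIV \<gamma>" if "\<gamma> \<in> set sides" for \<gamma>
    using that unfolding sides_def by (auto intro!: continuous_intros)
  have 1: "(\<lambda>n. \<integral>z. grad (w n) z \<bullet> grad ?P z \<partial>area) \<longlonglongrightarrow> (\<integral>z. g z \<bullet> grad ?P z \<partial>area)"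
    by (rule L2_tendsto_inner[OF L2_cont[OF cont_grad[OF w1]] uL(2) L2_cont[OF cont_grad[OF P1]] lim(2)])
  have 2: "(\<lambda>n. \<integral>z. w n z * ?P z \<partial>area) \<longlonglongrightarrow> (\<integral>z. u z * ?P z \<partial>area)"
    using L2_tendsto_inner[OF L2_cont[OF cont_diff_1(1)[OF w1]] uL(1) L2_cont[OF cont_diff_1(1)[OF P1]] lim(1)]
    by (simp add: inner_real_def)
  have 3: "(\<lambda>n. \<integral>t. w n (\<gamma> t) * ?P (\<gamma> t) \<partial>edge) \<longlonglongrightarrow> (\<integral>t. \<tau> (\<gamma> t) * ?P (\<gamma> t) \<partial>edge)" if "\<gamma> \<in> set sides" for \<gamma>
  proof -
    have c: "continuous_on UNIV (f \<circ> \<gamma>)" if "continuous_on UNIV f" for f :: "real \<times> real \<Rightarrow> real"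
      using \<gamma>[OF \<open>\<gamma> \<in> set sides\<close>] that by (intro continuous_on_compose continuous_on_subset[OF that]) auto
    show ?thesis
      using L2_tendsto_inner[OF L2_cont_edge[OF c[OF cont_diff_1(1)[OF w1]]] tL[OF that] L2_cont_edge[OF c[OF cont_diff_1(1)[OF P1]]] elim[OF that]]
      by (simp add: inner_real_def)
  qed
  have 4: "(\<lambda>n. boundary_integral (\<lambda>z. w n z * ?P z)) \<longlonglongrightarrow> boundary_integral (\<lambda>z. \<tau> z * ?P z)"
    unfolding boundary_integral_def sides_def list.map sum_list.Cons sum_list.Nil
    by (intro tendsto_add tendsto_const 3) (simp_all add: sides_def)
  have "(\<lambda>n. (\<integral>z. grad (w n) z \<bullet> grad ?P z \<partial>area) - H * boundary_integral (\<lambda>z. w n z * ?P z))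
    \<longlonglongrightarrow> (\<integral>z. g z \<bullet> grad ?P z \<partial>area) - H * boundary_integral (\<lambda>z. \<tau> z * ?P z)"
    by (intro tendsto_intros 1 4)
  moreover have "(\<lambda>n. (\<mu> i + \<mu> j) * (\<integral>z. w n z * ?P z \<partial>area)) \<longlonglongrightarrow> (\<mu> i + \<mu> j) * (\<integral>z. u z * ?P z \<partial>area)"
    by (intro tendsto_intros 2)
  ultimately show ?thesis unfolding green_smooth[OF w1] using LIMSEQ_unique by blast
qed

text \<open>A constant sequence serves as approximation. The classical gradient is the weak one
  because a test function vanishes on the boundary, so the product rule integrates to zero on every
  slice.\<close>

lemma has_trace_modes:
  "has_trace (tens (p i) (p j)) (grad (tens (p i) (p j))) (tens (p i) (p j))"
proof -
  let ?P = "tens (p i) (p j)"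
  note P1 = smooth_C1[OF smooth_modes[of i j]]
  have \<gamma>: "continuous_on UNIV \<gamma>" if "\<gamma> \<in> set sides" for \<gamma>
    using that unfolding sides_def by (auto intro!: continuous_intros)
  have Pc: "continuous_on UNIV ?P" "\<And>e. e \<in> Basis \<Longrightarrow> continuous_on UNIV (partial e ?P)"
    using cont_diff_1[OF P1] by auto
  have parts: "(\<integral>x. ?P x * partial e \<phi> x \<partial>area) = - (\<integral>x. (grad ?P x \<bullet> e) * \<phi> x \<partial>area)"
    if \<phi>: "test_function \<phi>" and e: "e \<in> Basis" for \<phi> e
  proof -
    have \<phi>1: "cont_diff 1 \<phi>" using \<phi> smooth_C1 by (auto simp: test_function_def)
    have z: "\<phi> z = 0" if "z \<notin> square" for z
    proof (rule ccontr)
      assume "\<phi> z \<noteq> 0"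
      then have "z \<in> closure {x. \<phi> x \<noteq> 0}" using closure_subset by (metis (mono_tags) mem_Collect_eq subsetD)
      then show False using \<phi> that by (auto simp: test_function_def)
    qed
    have ec: "continuous_on UNIV (partial e \<phi>)" "continuous_on UNIV \<phi>"
      using cont_diff_1[OF \<phi>1] e by auto
    have ge: "grad ?P x \<bullet> e = partial e ?P x" for x using e by (auto simp: Basis_plane grad_plane)
    let ?F = "\<lambda>z. ?P z * partial e \<phi> z + partial e ?P z * \<phi> z"
    have Fc: "continuous_on UNIV ?F" by (intro continuous_intros ec Pc e)
    have Fs: "continuous_on S (\<lambda>x. ?F (x, y))" "continuous_on S (\<lambda>x. ?F (y, x))" for S y
    proof -
      have "continuous_on S (\<lambda>x. (x, y))" "continuous_on S (\<lambda>x. (y, x))" by (intro continuous_intros)+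
      from continuous_on_compose2[OF Fc this(1)] continuous_on_compose2[OF Fc this(2)]
      show "continuous_on S (\<lambda>x. ?F (x, y))" "continuous_on S (\<lambda>x. ?F (y, x))" by simp_all
    qed
    have "(\<integral>z. ?F z \<partial>area) = 0"
    proof -
      consider "e = (1, 0)" | "e = (0, 1)" using e by (auto simp: Basis_plane)
      then show ?thesis
      proof cases
        case 1
        have "((\<lambda>x. ?P (x, y) * \<phi> (x, y)) has_real_derivative ?F (x, y)) (at x)" for x y
          using DERIV_mult[OF deriv_fst[OF cont_diff_1(3)[OF P1], where x = x and y = y] deriv_fst[OF cont_diff_1(3)[OF \<phi>1], where x = x and y = y]]
          by (simp add: 1 algebra_simps)
        from edge_FTC[OF this Fs(1)]
        have "(\<integral>x. ?F (x, y) \<partial>edge) = 0" for y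
          using z[of "(pi/2, y)"] z[of "(-pi/2, y)"] by (simp add: square_def)
        then show ?thesis unfolding area_fubini(2)[OF area_integrable[OF Fc]] by simp
      next
        case 2
        have "((\<lambda>x. ?P (y, x) * \<phi> (y, x)) has_real_derivative ?F (y, x)) (at x)" for x y
          using DERIV_mult[OF deriv_snd[OF cont_diff_1(3)[OF P1], where x = y and y = x] deriv_snd[OF cont_diff_1(3)[OF \<phi>1], where x = y and y = x]]
          by (simp add: 2 algebra_simps)
        from edge_FTC[OF this Fs(2)]
        have "(\<integral>x. ?F (y, x) \<partial>edge) = 0" for y
          using z[of "(y, pi/2)"] z[of "(y, -pi/2)"] by (simp add: square_def)
        then show ?thesis unfolding area_fubini(1)[OF area_integrable[OF Fc]] by simp
      qed
    qed
    moreover have "(\<integral>z. ?F z \<partial>area) = (\<integral>x. ?P x * partial e \<phi> x \<partial>area) + (\<integral>x. (grad ?P x \<bullet> e) * \<phi> x \<partial>area)"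
      unfolding ge by (rule Bochner_Integration.integral_add) (intro area_integrable continuous_intros ec Pc e)+
    ultimately show ?thesis by simp
  qed
  have H1: "H1 ?P (grad ?P)"
    unfolding H1_def using L2_cont[OF Pc(1)] L2_cont[OF cont_grad[OF P1]] parts by blast
  have "L2 edge (?P \<circ> \<gamma>)" if "\<gamma> \<in> set sides" for \<gamma>
    by (intro L2_cont_edge continuous_on_compose \<gamma>[OF that] continuous_on_subset[OF Pc(1)]) auto
  then show ?thesis unfolding has_trace_def
    by (intro conjI H1 exI[of _ "\<lambda>_. ?P"]) (auto simp: L2_tendsto_def smooth_modes)
qed

lemma mode_in_eigenspace: "tens (p i) (p j) \<in> robin_eigenspace (- H) (\<mu> i + \<mu> j)"
  unfolding robin_eigenspace_def mem_Collect_eq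
proof (intro exI conjI allI impI)
  show "has_trace (tens (p i) (p j)) (grad (tens (p i) (p j))) (tens (p i) (p j))" by (rule has_trace_modes)
  fix v g' \<tau>' assume "has_trace v g' \<tau>'"
  from green_trace[OF this, of i j]
  show "(\<integral>x. grad (tens (p i) (p j)) x \<bullet> g' x \<partial>area) + - H * boundary_integral (\<lambda>x. tens (p i) (p j) x * \<tau>' x) =
       (\<mu> i + \<mu> j) * (\<integral>x. tens (p i) (p j) x * v x \<partial>area)"
    by (simp add: inner_commute mult.commute)
qed

text \<open>The Robin form of \<open>u\<close> and a product of modes is evaluated twice, by the
  eigenvalue equation of \<open>u\<close> and by \<open>green_trace\<close>; the two factors
  differ.\<close>

lemma eigenspace_orth:
  assumes u: "u \<in> robin_eigenspace (- H) l" and ne: "\<mu> i + \<mu> j \<noteq> l"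
  shows "(\<integral>z. u z * tens (p i) (p j) z \<partial>area) = 0"
proof -
  obtain g \<tau> where t: "has_trace u g \<tau>" and e: "\<And>v g' \<tau>'. has_trace v g' \<tau>' \<Longrightarrow>
      (\<integral>x. g x \<bullet> g' x \<partial>area) + - H * boundary_integral (\<lambda>x. \<tau> x * \<tau>' x) = l * (\<integral>x. u x * v x \<partial>area)"
    using u unfolding robin_eigenspace_def by blast
  have "(\<mu> i + \<mu> j) * (\<integral>z. u z * tens (p i) (p j) z \<partial>area) = l * (\<integral>z. u z * tens (p i) (p j) z \<partial>area)"
    using e[OF has_trace_modes[of i j]] green_trace[OF t, of i j] by simp
  then show ?thesis using ne by simp
qed

end

section \<open>Counting the eigenvalues\<close>

text \<open>If the independent family were longer than the spanning one,
  \<open>nontrivial_kernel\<close> would give a relation among its members.\<close>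

lemma has_dim_ae_le:
  assumes d: "has_dim_ae M V d" and d': "has_dim_ae M V d'"
  shows "d' \<le> d"
proof (rule ccontr)
  assume "\<not> d' \<le> d"
  then have lt: "d < d'" by simp
  obtain b where bV: "\<And>i. i < d \<Longrightarrow> b i \<in> V"
    and bs: "\<And>u. u \<in> V \<Longrightarrow> \<exists>c. AE x in M. u x = (\<Sum>i<d. c i * b i x)"
    using d unfolding has_dim_ae_def by blast
  obtain b' where bV': "\<And>i. i < d' \<Longrightarrow> b' i \<in> V"
    and bi': "\<And>c. AE x in M. (\<Sum>i<d'. c i * b' i x) = 0 \<Longrightarrow> \<forall>i<d'. c i = 0"
    using d' unfolding has_dim_ae_def by blast
  have "\<forall>j. \<exists>c. j < d' \<longrightarrow> (AE x in M. b' j x = (\<Sum>i<d. c i * b i x))"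
    using bs[OF bV'] by blast
  from choice[OF this] obtain a where a: "\<And>j. j < d' \<Longrightarrow> AE x in M. b' j x = (\<Sum>i<d. a j i * b i x)"
    by blast
  obtain c where c: "\<exists>j<d'. c j \<noteq> 0" "\<forall>i<d. (\<Sum>j<d'. a j i * c j) = 0"
    using nontrivial_kernel[OF lt, of "\<lambda>i j. a j i"] by auto
  have "AE x in M. \<forall>j\<in>{..<d'}. b' j x = (\<Sum>i<d. a j i * b i x)"
    by (intro AE_finite_allI) (use a in auto)
  then have "AE x in M. (\<Sum>j<d'. c j * b' j x) = 0"
  proof eventually_elim
    case (elim x)
    have "(\<Sum>j<d'. c j * b' j x) = (\<Sum>j<d'. \<Sum>i<d. a j i * c j * b i x)"
      using elim by (intro sum.cong) (auto simp: sum_distrib_left mult_ac)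
    also have "\<dots> = (\<Sum>i<d. (\<Sum>j<d'. a j i * c j) * b i x)"
      by (subst sum.swap) (simp add: sum_distrib_right)
    also have "\<dots> = 0" using c by (intro sum.neutral) auto
    finally show ?case .
  qed
  then show False using bi' c(1) by blast
qed

lemma has_dim_ae_unique: "has_dim_ae M V d \<Longrightarrow> has_dim_ae M V d' \<Longrightarrow> d = d'"
  using has_dim_ae_le by (metis le_antisym)

text \<open>\<open>robin_eigenvalue\<close> is a choice, so it has meaning only once a listing is
  exhibited. The listing inverts the counting function: its value at \<open>k\<close> is the least
  \<open>x\<close> with \<open>k \<le> N x\<close>, and a value \<open>l\<close> fills the block of
  indices \<open>{M l<..N l}\<close>.\<close>

lemma sorted_listing:
  fixes V :: "'q \<Rightarrow> real"
  assumes inf: "infinite (UNIV :: 'q set)" and fin: "\<And>r. finite {q. V q \<le> r}"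
  shows "\<exists>ev. mono_on {1..} ev \<and>
    (\<forall>l. finite {k \<in> {1::nat..}. ev k = l} \<and> card {k \<in> {1..}. ev k = l} = card {q. V q = l})"
proof -
  define N where "N = (\<lambda>r. card {q. V q \<le> r})"
  define M where "M = (\<lambda>r. card {q. V q < r})"
  have finl: "finite {q. V q < r}" for r by (rule finite_subset[OF _ fin[of r]]) auto
  have N_mono: "r \<le> s \<Longrightarrow> N r \<le> N s" for r s unfolding N_def by (intro card_mono fin) auto
  have ex: "\<exists>x\<in>range V. k \<le> N x \<and> (\<forall>y\<in>range V. k \<le> N y \<longrightarrow> x \<le> y)" if "k \<ge> 1" for k
  proof -
    obtain F :: "'q set" where F: "finite F" "card F = k" using inf infinite_arbitrarily_large by blast
    have Fne: "F \<noteq> {}" using F that by auto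
    define r where "r = Max (V ` F)"
    have "r \<in> V ` F" unfolding r_def using F Fne by (intro Max_in) auto
    then have r: "r \<in> range V" by blast
    have "F \<subseteq> {q. V q \<le> r}" using F by (auto simp: r_def)
    then have kr: "k \<le> N r" unfolding N_def F(2)[symmetric] by (rule card_mono[OF fin])
    define A where "A = {y \<in> range V. k \<le> N y \<and> y \<le> r}"
    have "A \<subseteq> V ` {q. V q \<le> r}" by (auto simp: A_def)
    then have A: "finite A" using fin finite_subset by blast
    have rA: "r \<in> A" using r kr by (simp add: A_def)
    then have m: "Min A \<in> A" using A by (intro Min_in) auto
    have "Min A \<le> y" if "y \<in> range V" "k \<le> N y" for y
    proof (cases "y \<le> r")
      case True
      then show ?thesis using A that by (intro Min_le) (auto simp: A_def)
    next
      case False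
      then show ?thesis using Min_le[OF A rA] by simp
    qed
    then show ?thesis using m by (auto simp: A_def)
  qed
  define ev where "ev = (\<lambda>k. SOME x. x \<in> range V \<and> k \<le> N x \<and> (\<forall>y\<in>range V. k \<le> N y \<longrightarrow> x \<le> y))"
  have ev: "ev k \<in> range V \<and> k \<le> N (ev k) \<and> (\<forall>y\<in>range V. k \<le> N y \<longrightarrow> ev k \<le> y)" if "k \<ge> 1" for k
    unfolding ev_def by (rule someI_ex) (use ex[OF that] in blast)
  have mono: "mono_on {1..} ev"
  proof (rule mono_onI)
    fix r s :: nat assume "r \<in> {1..}" "s \<in> {1..}" "r \<le> s"
    then show "ev r \<le> ev s" using ev[of r] ev[of s] by auto
  qed
  have set: "{k \<in> {1..}. ev k = l} = {M l<..N l}" if l: "l \<in> range V" for l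
  proof
    show "{k \<in> {1..}. ev k = l} \<subseteq> {M l<..N l}"
    proof
      fix k assume "k \<in> {k \<in> {1..}. ev k = l}"
      then have k: "k \<in> {1..}" and kl: "ev k = l" by auto
      have "M (ev k) < k"
      proof (cases "{q. V q < ev k} = {}")
        case True
        then show ?thesis using k by (simp add: M_def)
      next
        case False
        \<comment> \<open>The largest value below \<open>ev k\<close>; minimality of
          \<open>ev k\<close> gives \<open>N y < k\<close>.\<close>
        define y where "y = Max (V ` {q. V q < ev k})"
        have "y \<in> V ` {q. V q < ev k}" unfolding y_def using False finl by (intro Max_in) auto
        then have y: "y \<in> range V" "y < ev k" by auto
        have "V q \<le> y" if "V q < ev k" for q unfolding y_def using that finl by (intro Max_ge) auto
        then have "M (ev k) \<le> N y" unfolding M_def N_def by (intro card_mono fin) auto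
        moreover have "N y < k" using ev[of k] k y by (meson atLeast_iff leD leI)
        ultimately show ?thesis by simp
      qed
      then show "k \<in> {M l<..N l}" using ev[of k] k kl by auto
    qed
    show "{M l<..N l} \<subseteq> {k \<in> {1..}. ev k = l}"
    proof
      fix k assume k: "k \<in> {M l<..N l}"
      then have k1: "k \<ge> 1" by auto
      have "l \<le> ev k"
      proof (rule ccontr)
        assume "\<not> l \<le> ev k"
        then have "N (ev k) \<le> M l" unfolding M_def N_def by (intro card_mono finl) auto
        then show False using ev[OF k1] k by auto
      qed
      moreover have "ev k \<le> l" using ev[OF k1] k l by auto
      ultimately show "k \<in> {k \<in> {1..}. ev k = l}" using k1 by simp
    qed
  qed
  have "finite {k \<in> {1..}. ev k = l} \<and> card {k \<in> {1..}. ev k = l} = card {q. V q = l}" for l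
  proof (cases "l \<in> range V")
    case True
    have "{q. V q \<le> l} = {q. V q < l} \<union> {q. V q = l}" by auto
    moreover have "finite {q. V q = l}" by (rule finite_subset[OF _ fin[of l]]) auto
    ultimately have "N l = M l + card {q. V q = l}"
      unfolding N_def M_def using finl by (subst card_Un_disjoint[symmetric]) auto
    then show ?thesis unfolding set[OF True] by simp
  next
    case False
    then have "{k \<in> {1..}. ev k = l} = {}" "{q. V q = l} = {}" using ev by auto
    then show ?thesis by (metis card.empty finite.emptyI)
  qed
  then show ?thesis using mono by blast
qed

text \<open>The set of disagreement is open and negligible, hence empty. Nodal domains need
  pointwise values, whereas the expansion of an eigenfunction holds only almost everywhere.\<close>

lemma continuous_AE_eq:
  fixes u v :: "'a::euclidean_space \<Rightarrow> real"
  assumes S: "open S" and u: "continuous_on S u" and v: "continuous_on S v"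
    and ae: "AE z in lborel. z \<in> S \<longrightarrow> u z = v z" and z: "z \<in> S"
  shows "u z = v z"
proof -
  let ?D = "{z \<in> S. u z - v z \<in> - {0}}"
  have "open ?D"
    by (rule continuous_open_preimage[OF continuous_on_diff[OF u v] S, of "- {0}", unfolded vimage_def Int_def mem_Collect_eq]) auto
  moreover have "negligible ?D"
  proof -
    have "?D \<in> sets lborel" using \<open>open ?D\<close> by auto
    moreover have "AE z in lborel. z \<notin> ?D" using ae by eventually_elim auto
    ultimately have "?D \<in> null_sets lborel" using AE_iff_null_sets by blast
    then show ?thesis using negligible_iff_null_sets null_sets_completionI by blast
  qed
  ultimately have "?D = {}" using open_not_negligible by blast
  then show ?thesis using z by auto
qed

section \<open>Eigenvalues indexed by pairs of modes, and their position in the listing\<close>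

context robin
begin

definition V :: "nat \<times> nat \<Rightarrow> real" where "V q = \<mu> (fst q) + \<mu> (snd q)"

definition P :: "nat \<times> nat \<Rightarrow> real \<times> real \<Rightarrow> real" where "P q = tens (p (fst q)) (p (snd q))"

lemma finite_V: "finite {q. V q \<le> r}"
proof (rule finite_subset)
  have lin: "\<mu> n \<ge> \<mu> 0 + real n - 2" for n
  proof (cases "n \<ge> 2")
    case True
    then show ?thesis using eigv_ge[OF True] eigv_neg[of 0] by simp
  next
    case False
    have "\<mu> 0 \<le> \<mu> n" using strict_mono_less_eq[OF eigv_strict_mono] by simp
    then show ?thesis using False by simp
  qed
  define m where "m = nat \<lceil>r + 4 - 2 * \<mu> 0\<rceil>"
  have "fst q \<le> m \<and> snd q \<le> m" if "V q \<le> r" for q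
  proof -
    have "real (fst q) + real (snd q) \<le> r + 4 - 2 * \<mu> 0"
      using that lin[of "fst q"] lin[of "snd q"] by (simp add: V_def)
    moreover have "r + 4 - 2 * \<mu> 0 \<le> real m" unfolding m_def by linarith
    ultimately show ?thesis by linarith
  qed
  then show "{q. V q \<le> r} \<subseteq> {..m} \<times> {..m}" by auto
  show "finite ({..m} \<times> {..m})" by simp
qed

lemma finite_V_eq: "finite {q. V q = r}"
  by (rule finite_subset[OF _ finite_V[of r]]) auto

lemma cont_P: "continuous_on UNIV (P q)"
  unfolding P_def by (intro cont_tens cont_mode)

lemma P_inner: "(\<integral>z. P q z * P r z \<partial>area) = ip (p (fst q)) (p (fst r)) * ip (p (snd q)) (p (snd r))"
  unfolding P_def tens_mult ip_def by (intro tens_integral continuous_intros cont_mode)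

lemma P_orth: "q \<noteq> r \<Longrightarrow> (\<integral>z. P q z * P r z \<partial>area) = 0"
  unfolding P_inner using ip_mode_orth by (metis mult_eq_0_iff prod_eqI)

lemma P_norm: "(\<integral>z. P q z * P q z \<partial>area) > 0"
  unfolding P_inner using ip_mode_pos by simp

lemma P_sum_inner:
  assumes "finite S"
  shows "(\<integral>z. (\<Sum>q\<in>S. c q * P q z) * P r z \<partial>area) = (if r \<in> S then c r * (\<integral>z. P r z * P r z \<partial>area) else 0)"
proof -
  have "(\<integral>z. (\<Sum>q\<in>S. c q * P q z) * P r z \<partial>area) = (\<integral>z. (\<Sum>q\<in>S. c q * (P q z * P r z)) \<partial>area)"
    by (simp add: sum_distrib_right mult.assoc)
  also have "\<dots> = (\<Sum>q\<in>S. c q * (\<integral>z. P q z * P r z \<partial>area))"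
    by (subst Bochner_Integration.integral_sum) (auto intro!: integrable_mult_right area_integrable continuous_intros cont_P)
  also have "\<dots> = (\<Sum>q\<in>S. if q = r then c r * (\<integral>z. P r z * P r z \<partial>area) else 0)"
    by (intro sum.cong) (auto simp: P_orth)
  finally show ?thesis using assms by simp
qed

lemma eigenspace_L2: "u \<in> robin_eigenspace (- H) l \<Longrightarrow> L2 area u"
  unfolding robin_eigenspace_def has_trace_def H1_def by blast

text \<open>Once the finitely many components with \<open>V q = l\<close> are subtracted, the rest
  is orthogonal to every product: to these by the choice of \<open>c\<close>, to the others by
  \<open>eigenspace_orth\<close>. Completeness then makes it zero.\<close>

lemma eigenspace_expansion:
  assumes u: "u \<in> robin_eigenspace (- H) l"
  shows "\<exists>c. AE z in area. u z = (\<Sum>q | V q = l. c q * P q z)"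
proof -
  define c where "c = (\<lambda>q. (\<integral>z. u z * P q z \<partial>area) / (\<integral>z. P q z * P q z \<partial>area))"
  let ?s = "\<lambda>z. \<Sum>q | V q = l. c q * P q z"
  have sc: "continuous_on UNIV ?s" by (intro continuous_intros cont_P)
  note uL = eigenspace_L2[OF u]
  have "AE z in area. u z + (-1) *\<^sub>R ?s z = 0"
  proof (rule modes_complete)
    show "L2 area (\<lambda>z. u z + (-1) *\<^sub>R ?s z)" by (intro L2_add_scaled uL L2_cont sc)
    fix i j
    have "(\<integral>z. (u z + (-1) *\<^sub>R ?s z) * P (i, j) z \<partial>area) = (\<integral>z. u z * P (i, j) z - ?s z * P (i, j) z \<partial>area)"
      by (simp add: algebra_simps)
    also have "\<dots> = (\<integral>z. u z * P (i, j) z \<partial>area) - (\<integral>z. ?s z * P (i, j) z \<partial>area)"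
      by (intro Bochner_Integration.integral_diff L2_mult_integrable uL L2_cont cont_P sc)
    also have "\<dots> = 0"
      unfolding P_sum_inner[OF finite_V_eq]
      using P_norm[of "(i, j)"] eigenspace_orth[OF u, of i j] by (auto simp: c_def V_def) (simp add: P_def)
    finally show "(\<integral>z. (u z + (-1) *\<^sub>R ?s z) * tens (p i) (p j) z \<partial>area) = 0" by (simp add: P_def)
  qed
  then have "AE z in area. u z = ?s z" by eventually_elim simp
  then show ?thesis by blast
qed

lemma eigenspace_has_dim: "has_dim_ae area (robin_eigenspace (- H) l) (card {q. V q = l})"
proof -
  let ?n = "card {q. V q = l}"
  obtain f where "bij_betw f {0..<?n} {q. V q = l}"
    using ex_bij_betw_nat_finite[OF finite_V_eq] by blast
  then have f: "bij_betw f {..<?n} {q. V q = l}" by (simp add: atLeast0LessThan)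
  have re: "(\<Sum>i<?n. g (f i)) = (\<Sum>q | V q = l. g q)" for g :: "nat \<times> nat \<Rightarrow> real"
    by (rule sum.reindex_bij_betw[OF f])
  show ?thesis unfolding has_dim_ae_def
  proof (intro exI[of _ "\<lambda>i. P (f i)"] conjI allI impI ballI)
    fix i assume "i < ?n"
    then have "V (f i) = l" using f by (auto simp: bij_betw_def)
    then show "P (f i) \<in> robin_eigenspace (- H) l"
      using mode_in_eigenspace[of "fst (f i)" "snd (f i)"] by (simp add: P_def V_def)
  next
    fix c i assume ae: "AE x in area. (\<Sum>i<?n. c i * P (f i) x) = 0" and i: "i < ?n"
    define g where "g = the_inv_into {..<?n} f"
    have g: "g (f i) = i" if "i < ?n" for i
      using the_inv_into_f_f[of f "{..<?n}" i] f that by (auto simp: g_def bij_betw_def)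
    have "(\<Sum>i<?n. c i * P (f i) x) = (\<Sum>i<?n. c (g (f i)) * P (f i) x)" for x
      by (intro sum.cong) (auto simp: g)
    then have eq: "(\<Sum>i<?n. c i * P (f i) x) = (\<Sum>q | V q = l. c (g q) * P q x)" for x
      using re[of "\<lambda>q. c (g q) * P q x"] by simp
    have Vi: "V (f i) = l" using f i by (auto simp: bij_betw_def)
    have "(\<integral>z. (\<Sum>q | V q = l. c (g q) * P q z) * P (f i) z \<partial>area) = 0"
      by (rule integral_eq_zero_AE) (use ae in \<open>eventually_elim, simp add: eq\<close>)
    then show "c i = 0"
      unfolding P_sum_inner[OF finite_V_eq] using Vi P_norm[of "f i"] g[OF i] by simp
  next
    fix u assume "u \<in> robin_eigenspace (- H) l"
    then obtain c where "AE z in area. u z = (\<Sum>q | V q = l. c q * P q z)" using eigenspace_expansion by blast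
    then show "\<exists>c. AE z in area. u z = (\<Sum>i<?n. c i * P (f i) z)"
      by (intro exI[of _ "\<lambda>i. c (f i)"]) (simp add: re[of "\<lambda>q. c q * P q _"])
  qed
qed

abbreviation ev :: "nat \<Rightarrow> real" where "ev \<equiv> robin_eigenvalue (- H)"

text \<open>Whichever listing the choice picks, uniqueness of the dimension makes its multiplicities
  the numbers of index pairs.\<close>

lemma ev_listing:
  "mono_on {1..} ev" "finite {k \<in> {1..}. ev k = l}" "card {k \<in> {1..}. ev k = l} = card {q. V q = l}"
proof -
  have "infinite (UNIV :: (nat \<times> nat) set)" using finite_prod infinite_UNIV_nat by blast
  from sorted_listing[OF this finite_V] obtain e where
    "mono_on {1..} e" "\<And>l. finite {k \<in> {1::nat..}. e k = l}" "\<And>l. card {k \<in> {1..}. e k = l} = card {q. V q = l}"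
    by blast
  then have "eigenvalue_listing (- H) e"
    using eigenspace_has_dim unfolding eigenvalue_listing_def by simp
  then have "eigenvalue_listing (- H) (SOME ev. eigenvalue_listing (- H) ev)" by (rule someI[where P = "eigenvalue_listing (- H)"])
  moreover have "ev = (SOME ev. eigenvalue_listing (- H) ev)" by (rule ext) (simp add: robin_eigenvalue_def)
  ultimately have L: "eigenvalue_listing (- H) ev" by simp
  then show "mono_on {1..} ev" "finite {k \<in> {1..}. ev k = l}" unfolding eigenvalue_listing_def by auto
  show "card {k \<in> {1..}. ev k = l} = card {q. V q = l}"
    using L eigenspace_has_dim has_dim_ae_unique unfolding eigenvalue_listing_def by blast
qed

lemma ev_is_V:
  assumes "k \<ge> 1" shows "\<exists>q. V q = ev k"
proof -
  have "k \<in> {j \<in> {1..}. ev j = ev k}" using assms by simp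
  then have "card {j \<in> {1..}. ev j = ev k} > 0" using ev_listing(2) card_gt_0_iff by blast
  then have "{q. V q = ev k} \<noteq> {}" using ev_listing(3) by (metis card.empty less_irrefl)
  then show ?thesis by blast
qed

text \<open>The values taken on \<open>B\<close> occur in the listing only at indices below
  \<open>k\<close>, with multiplicities that add up to at least the size of
  \<open>B\<close>.\<close>

lemma index_lower:
  assumes k: "k \<ge> 1" and B: "finite B" "\<And>q. q \<in> B \<Longrightarrow> V q < ev k"
  shows "card B < k"
proof -
  have "card B \<le> card (\<Union>l\<in>V ` B. {q. V q = l})"
    using B finite_V_eq by (intro card_mono) auto
  also have "\<dots> \<le> (\<Sum>l\<in>V ` B. card {q. V q = l})" using B by (intro card_UN_le) auto
  also have "\<dots> = (\<Sum>l\<in>V ` B. card {j \<in> {1..}. ev j = l})"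
    by (rule sum.cong[OF refl]) (rule ev_listing(3)[symmetric])
  also have "\<dots> = card (\<Union>l\<in>V ` B. {j \<in> {1..}. ev j = l})"
    using B ev_listing(2) by (intro card_UN_disjoint[symmetric]) auto
  also have "\<dots> \<le> card {1..<k}"
  proof (intro card_mono)
    show "(\<Union>l\<in>V ` B. {j \<in> {1..}. ev j = l}) \<subseteq> {1..<k}"
    proof
      fix j assume "j \<in> (\<Union>l\<in>V ` B. {j \<in> {1..}. ev j = l})"
      then obtain q where j: "j \<in> {1..}" "ev j = V q" and "q \<in> B" by blast
      then have "ev j < ev k" using B by simp
      then have "\<not> k \<le> j" using mono_onD[OF ev_listing(1), of k j] k j by auto
      then show "j \<in> {1..<k}" using j by simp
    qed
  qed simp
  finally show ?thesis using k by simp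
qed

lemma index_upper:
  assumes k: "k \<ge> 1"
  shows "k \<le> card {q. V q \<le> ev k}"
proof -
  let ?B = "{q. V q \<le> ev k}"
  have fB: "finite (V ` ?B)" using finite_V by simp
  have "card {1..k} \<le> card (\<Union>l\<in>V ` ?B. {j \<in> {1..}. ev j = l})"
  proof (intro card_mono)
    show "finite (\<Union>l\<in>V ` ?B. {j \<in> {1..}. ev j = l})" by (rule finite_UN_I[OF fB ev_listing(2)])
    show "{1..k} \<subseteq> (\<Union>l\<in>V ` ?B. {j \<in> {1..}. ev j = l})"
    proof
      fix j assume j: "j \<in> {1..k}"
      then have "j \<ge> 1" by simp
      from ev_is_V[OF this] obtain q where q: "V q = ev j" by blast
      have "ev j \<le> ev k" using mono_onD[OF ev_listing(1), of j k] j by auto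
      then have "q \<in> ?B" "j \<in> {i \<in> {1..}. ev i = V q}" using q j by auto
      then show "j \<in> (\<Union>l\<in>V ` ?B. {j \<in> {1..}. ev j = l})" by blast
    qed
  qed
  also have "\<dots> \<le> (\<Sum>l\<in>V ` ?B. card {j \<in> {1..}. ev j = l})" using fB by (intro card_UN_le)
  also have "\<dots> = (\<Sum>l\<in>V ` ?B. card {q. V q = l})"
    by (rule sum.cong[OF refl]) (rule ev_listing(3))
  also have "\<dots> = card (\<Union>l\<in>V ` ?B. {q. V q = l})"
    using fB finite_V_eq by (intro card_UN_disjoint[symmetric]) auto
  also have "\<dots> \<le> card ?B" by (intro card_mono finite_V) auto
  finally show ?thesis by simp
qed

lemma eigv_1_le: "\<mu> 1 \<le> - 36"
proof -
  have "6 \<le> \<alpha> 1" using freq_1(1) H by simp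
  then have "6\<^sup>2 \<le> (\<alpha> 1)\<^sup>2" by (intro power_mono) auto
  then show ?thesis by (simp add: eigv_def)
qed

lemma eigv_le2: "a < 2 \<Longrightarrow> \<mu> a \<le> \<mu> 1"
  using eigv_0_1 by (auto simp: less_2_cases_iff)

lemma eigv_ge0: "\<mu> 0 \<le> \<mu> a"
  using strict_mono_less_eq[OF eigv_strict_mono] by simp

lemma eigv_inj: "\<mu> a = \<mu> b \<Longrightarrow> a = b"
  using strict_mono_eq[OF eigv_strict_mono] by blast

text \<open>The two negative eigenvalues differ by less than 1 and distinct positive ones by at
  least 1, so a change of the positive summand cannot be compensated.\<close>

lemma pair_sum_unique:
  assumes "a < 2" "i < 2" "b \<ge> 2" "n \<ge> 2" "\<mu> a + \<mu> b = \<mu> i + \<mu> n"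
  shows "a = i \<and> b = n"
proof (cases "b = n")
  case True
  then show ?thesis using assms eigv_inj by auto
next
  case False
  have "\<bar>\<mu> a - \<mu> i\<bar> < 1" using assms(1,2) eigv_gap eigv_0_1 by (auto simp: less_2_cases_iff)
  moreover have "\<bar>\<mu> b - \<mu> n\<bar> \<ge> 1" using False eigv_gap_ge2[of b n] eigv_gap_ge2[of n b] assms by linarith
  ultimately show ?thesis using assms(5) by linarith
qed

lemma spectral_structure:
  assumes k: "k \<ge> 6" and neg: "ev k < 0"
  obtains i n where "i < 2" "n \<ge> 2" "V (i, n) = ev k" "{q. V q = ev k} = {(i, n), (n, i)}"
    "4 * n - 3 + 2 * i \<le> k"
proof -
  \<comment> \<open>With \<open>\<mu> 1 \<le> -36\<close> and \<open>\<mu> 0 > \<mu> 1 - 1\<close>,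
    the sum of two negative eigenvalues lies far below either of them.\<close>
  have low: "\<mu> a + \<mu> b < \<mu> 0" if "a < 2" "b < 2" for a b
    using eigv_le2[OF that(1)] eigv_le2[OF that(2)] eigv_1_le eigv_gap by linarith
  obtain a b where ab: "V (a, b) = ev k" using ev_is_V[of k] k by (metis surj_pair le_trans one_le_numeral)
  have notlow: "\<not> (a < 2 \<and> b < 2)"
  proof
    assume "a < 2 \<and> b < 2"
    then have evk: "ev k < \<mu> 0" using ab low[of a b] by (simp add: V_def)
    \<comment> \<open>A value below \<open>\<mu> 0\<close> arises only from the four pairs of
      negative modes, which leaves no room for an index of at least 6.\<close>
    have "{q. V q \<le> ev k} \<subseteq> {0, 1} \<times> {0, 1}"
    proof
      fix q assume q: "q \<in> {q. V q \<le> ev k}"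
      then have lt: "\<mu> (fst q) + \<mu> (snd q) < \<mu> 0" using evk by (simp add: V_def)
      have "fst q < 2" using lt eigv_pos[of "fst q"] eigv_ge0[of "snd q"] by linarith
      moreover have "snd q < 2" using lt eigv_pos[of "snd q"] eigv_ge0[of "fst q"] by linarith
      ultimately show "q \<in> {0, 1} \<times> {0, 1}" by (cases q) (auto simp: less_2_cases_iff)
    qed
    then have "card {q. V q \<le> ev k} \<le> card ({0, 1::nat} \<times> {0, 1::nat})" by (intro card_mono) auto
    also have "\<dots> = 4" by (simp add: card_cartesian_product)
    finally show False using index_upper[of k] k by simp
  qed
  have nothigh: "\<not> (a \<ge> 2 \<and> b \<ge> 2)" using eigv_pos[of a] eigv_pos[of b] ab neg by (auto simp: V_def)
  define i where "i = min a b"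
  define n where "n = max a b"
  have i: "i < 2" and n: "n \<ge> 2" and V: "V (i, n) = ev k"
    using notlow nothigh ab by (auto simp: i_def n_def V_def min_def max_def)
  have Vin: "\<mu> i + \<mu> n = ev k" using V by (simp add: V_def)
  have set: "{q. V q = ev k} = {(i, n), (n, i)}"
  proof
    show "{(i, n), (n, i)} \<subseteq> {q. V q = ev k}" using V by (auto simp: V_def add.commute)
    show "{q. V q = ev k} \<subseteq> {(i, n), (n, i)}"
    proof
      fix q assume "q \<in> {q. V q = ev k}"
      then have q: "\<mu> (fst q) + \<mu> (snd q) = \<mu> i + \<mu> n" using Vin by (simp add: V_def)
      have "\<mu> n > 0" using eigv_pos[OF n] .
      then have 1: "\<not> (fst q < 2 \<and> snd q < 2)" using low[of "fst q" "snd q"] q eigv_ge0[of i] by linarith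
      have 2: "\<not> (fst q \<ge> 2 \<and> snd q \<ge> 2)"
        using q Vin neg eigv_pos[of "fst q"] eigv_pos[of "snd q"] by linarith
      consider "fst q < 2" "snd q \<ge> 2" | "fst q \<ge> 2" "snd q < 2" using 1 2 by linarith
      then show "q \<in> {(i, n), (n, i)}"
      proof cases
        case 1
        then have "fst q = i \<and> snd q = n" using pair_sum_unique[OF _ i _ n, of "fst q" "snd q"] q by blast
        then show ?thesis by (cases q) auto
      next
        case 2
        then have "snd q = i \<and> fst q = n" using pair_sum_unique[OF _ i _ n, of "snd q" "fst q"] q by simp
        then show ?thesis by (cases q) auto
      qed
    qed
  qed
  \<comment> \<open>The pairs that certainly lie below \<open>ev k\<close>: one index below 2 and
    the other below \<open>n\<close>, in either order, and for \<open>i = 1\<close> also the two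
    pairs formed by 0 and \<open>n\<close>. They number \<open>4 * n - 4 + 2 * i\<close>.\<close>
  define B1 where "B1 = {0, 1} \<times> {0, 1} \<union> ({0, 1} \<times> {2..<n} \<union> {2..<n} \<times> {0, 1::nat})"
  define B where "B = (if i = 0 then B1 else insert (0, n) (insert (n, 0) B1))"
  have f: "finite B1" by (simp add: B1_def)
  have "card B1 = 4 + 4 * (n - 2)"
    unfolding B1_def by (subst card_Un_disjoint; auto simp: card_cartesian_product)+
  then have cB: "card B = 4 * n - 4 + 2 * i"
  proof (cases "i = 0")
    case False
    have "(n, 0) \<notin> B1" "(0, n) \<notin> insert (n, 0) B1" using n by (auto simp: B1_def)
    then show ?thesis using False i n f \<open>card B1 = 4 + 4 * (n - 2)\<close> by (simp add: B_def)
  qed (use n in \<open>simp add: B_def\<close>)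
  have less: "\<mu> a + \<mu> b < \<mu> i + \<mu> n" if "a < 2" "b < n" for a b
  proof (cases "b < 2")
    case True
    then show ?thesis using low[OF that(1) True] eigv_ge0[of i] eigv_pos[OF n] by linarith
  next
    case False
    then show ?thesis
      using eigv_gap_ge2[of b n] that eigv_le2[OF that(1)] eigv_gap eigv_ge0[of i] by linarith
  qed
  have "V q < ev k" if "q \<in> B" for q
  proof -
    have B1: "V q < ev k" if "q \<in> B1"
    proof -
      from that consider "fst q < 2" "snd q < n" | "snd q < 2" "fst q < n" using n unfolding B1_def by auto
      then show ?thesis using less[of "fst q" "snd q"] less[of "snd q" "fst q"] Vin
        by cases (auto simp: V_def)
    qed
    have "\<mu> 0 + \<mu> n < ev k" if "i \<noteq> 0" using Vin that i eigv_0_1 by (cases "i = 1") auto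
    then show ?thesis using that B1 by (auto simp: B_def V_def split: if_splits)
  qed
  moreover have "finite B" using f by (simp add: B_def)
  ultimately have "card B < k" using index_lower[of k B] k by simp
  then have "4 * n - 3 + 2 * i \<le> k" using cB n by simp
  then show ?thesis using that[OF i n V set] by blast
qed

lemma eigenfunction_form:
  assumes u: "u \<in> robin_eigenspace (- H) l" "continuous_on square u"
    and set: "{q. V q = l} = {(i, n), (n, i)}" and ne: "i \<noteq> n"
  shows "\<exists>a b. \<forall>z\<in>square. u z = a * (p i (fst z) * p n (snd z)) + b * (p n (fst z) * p i (snd z))"
proof -
  obtain c where c: "AE z in area. u z = (\<Sum>q | V q = l. c q * P q z)"
    using eigenspace_expansion[OF u(1)] by blast
  define v where "v = (\<lambda>z. c (i, n) * P (i, n) z + c (n, i) * P (n, i) z)"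
  have "(\<Sum>q | V q = l. c q * P q z) = v z" for z
    unfolding set v_def using ne by simp
  then have "AE z in area. u z = v z" using c by simp
  then have ae: "AE z in lborel. z \<in> square \<longrightarrow> u z = v z"
    by (subst (asm) AE_restrict_space_iff) (simp_all add: square_sets)
  have "continuous_on square v" unfolding v_def
    by (intro continuous_intros continuous_on_subset[OF cont_P]) auto
  moreover have "open square" by (auto simp: square_def intro!: open_Times)
  ultimately have "u z = v z" if "z \<in> square" for z using continuous_AE_eq[OF _ u(2) _ ae that] by blast
  then show ?thesis by (intro exI[of _ "c (i, n)"] exI[of _ "c (n, i)"]) (simp add: v_def P_def tens_def)
qed

end

section \<open>Components of the nonzero set on the closed square\<close>

text \<open>Taken on the closed square, unlike \<open>nodal_domains\<close>, so that components
  contain the boundary points at which they are counted.\<close>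

definition nonzero :: "(real \<times> real \<Rightarrow> real) \<Rightarrow> (real \<times> real) set" where
  "nonzero u = {z \<in> csquare. u z \<noteq> 0}"

lemma csquare_iff: "z \<in> csquare \<longleftrightarrow> \<bar>fst z\<bar> \<le> pi/2 \<and> \<bar>snd z\<bar> \<le> pi/2"
  by (cases z) (auto simp: abs_le_iff)

lemma square_iff: "z \<in> square \<longleftrightarrow> \<bar>fst z\<bar> < pi/2 \<and> \<bar>snd z\<bar> < pi/2"
  unfolding square_def by (cases z) (auto simp: abs_less_iff)

lemma scale_csquare:
  assumes "z \<in> csquare" "0 \<le> t" "t \<le> 1" shows "t *\<^sub>R z \<in> csquare"
proof -
  have "\<bar>t * x\<bar> \<le> pi/2" if "\<bar>x\<bar> \<le> pi/2" for x
    using mult_mono[OF assms(3) that] assms(2) by (simp add: abs_mult)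
  then show ?thesis using assms(1) by (simp only: csquare_iff fst_scaleR snd_scaleR real_scaleR_def)
qed

lemma scale_square:
  assumes "z \<in> csquare" "0 \<le> t" "t < 1" shows "t *\<^sub>R z \<in> square"
proof -
  have "\<bar>t * x\<bar> < pi/2" if "\<bar>x\<bar> \<le> pi/2" for x
  proof -
    have "t * \<bar>x\<bar> \<le> t * (pi/2)" using that assms(2) by (intro mult_left_mono)
    also have "\<dots> < 1 * (pi/2)" using assms(3) by (intro mult_strict_right_mono) auto
    finally show ?thesis using assms(2) by (simp add: abs_mult)
  qed
  then show ?thesis using assms(1) by (simp only: csquare_iff square_iff fst_scaleR snd_scaleR real_scaleR_def)
qed

lemma scale_square':
  assumes "z \<in> square" "0 \<le> t" "t \<le> 1" shows "t *\<^sub>R z \<in> square"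
proof (cases "t = 1")
  case False
  moreover have "z \<in> csquare" using assms(1) by (auto simp: square_def)
  ultimately show ?thesis using scale_square[of z t] assms by auto
qed (use assms in simp)

text \<open>Contract the joining path slightly towards the origin.\<close>

lemma nonzero_component_open:
  assumes u: "continuous_on csquare u"
    and z: "z1 \<in> square" "z2 \<in> square" and c: "connected_component (nonzero u) z1 z2"
  shows "connected_component (square - u -` {0}) z1 z2"
proof -
  let ?U = "square - u -` {0}"
  have "openin (top_of_set csquare) (csquare \<inter> u -` (- {0}))"
    by (rule continuous_openin_preimage_gen[OF u]) auto
  then have "openin (top_of_set csquare) (nonzero u)" by (simp add: nonzero_def vimage_def Int_def)
  moreover have "locally path_connected csquare"
    by (intro convex_imp_locally_path_connected convex_Times) auto
  ultimately have "locally path_connected (nonzero u)" using locally_open_subset by blast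
  then have "path_component (nonzero u) z1 z2"
    using c path_component_eq_connected_component by metis
  then obtain g where g: "path g" "path_image g \<subseteq> nonzero u" "pathstart g = z1" "pathfinish g = z2"
    unfolding path_component_def by blast
  let ?K = "path_image g"
  have K: "compact ?K" "?K \<noteq> {}" "?K \<subseteq> csquare" using g by (auto simp: nonzero_def)
  have "continuous_on ?K (\<lambda>z. \<bar>u z\<bar>)" by (intro continuous_intros continuous_on_subset[OF u K(3)])
  then obtain z0 where z0: "z0 \<in> ?K" "\<And>z. z \<in> ?K \<Longrightarrow> \<bar>u z0\<bar> \<le> \<bar>u z\<bar>"
    using continuous_attains_inf[OF K(1,2)] by blast
  define d where "d = \<bar>u z0\<bar>"
  have d: "d > 0" using z0(1) g by (auto simp: d_def nonzero_def)
  have "uniformly_continuous_on csquare u"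
    by (intro compact_uniformly_continuous u compact_Times) auto
  then obtain e where e: "e > 0" "\<And>z z'. z \<in> csquare \<Longrightarrow> z' \<in> csquare \<Longrightarrow> dist z' z < e \<Longrightarrow> dist (u z') (u z) < d"
    using d unfolding uniformly_continuous_on_def by meson
  obtain B where B: "B > 0" "\<And>z. z \<in> ?K \<Longrightarrow> norm z \<le> B"
    using compact_imp_bounded[OF K(1)] bounded_pos by metis
  \<comment> \<open>Scaling by a factor between \<open>t\<close> and 1 moves a point of the path by
    less than \<open>e\<close>, hence changes \<open>u\<close> by less than \<open>d\<close>, its
    minimal modulus on the path.\<close>
  define t where "t = max 0 (1 - e / (2 * B))"
  have t: "0 \<le> t" "t < 1" using e(1) B(1) by (auto simp: t_def)
  have nz: "u (s *\<^sub>R z) \<noteq> 0" if "z \<in> ?K" "t \<le> s" "s \<le> 1" for s z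
  proof -
    have "dist (s *\<^sub>R z) z = norm ((s - 1) *\<^sub>R z)" by (simp add: dist_norm algebra_simps)
    also have "\<dots> = (1 - s) * norm z" using that by simp
    also have "\<dots> \<le> e / (2 * B) * B" using that B by (intro mult_mono) (auto simp: t_def)
    also have "\<dots> < e" using B(1) e(1) by simp
    finally have "dist (u (s *\<^sub>R z)) (u z) < d"
      using that K(3) t by (intro e(2) scale_csquare) auto
    moreover have "d \<le> \<bar>u z\<bar>" using z0(2)[OF that(1)] by (simp add: d_def)
    ultimately show ?thesis by (auto simp: dist_real_def)
  qed
  have seg: "connected_component ?U z (t *\<^sub>R z)" if "z \<in> square" "z \<in> ?K" for z
  proof (rule connected_componentI)
    show "connected ((\<lambda>s. s *\<^sub>R z) ` {t..1})"
      by (intro connected_continuous_image continuous_intros) auto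
    show "(\<lambda>s. s *\<^sub>R z) ` {t..1} \<subseteq> ?U"
      using nz[OF that(2)] scale_square'[OF that(1)] t by auto
    show "z \<in> (\<lambda>s. s *\<^sub>R z) ` {t..1}" using t by (intro image_eqI[of _ _ 1]) auto
    show "t *\<^sub>R z \<in> (\<lambda>s. s *\<^sub>R z) ` {t..1}" using t by (intro image_eqI[of _ _ t]) auto
  qed
  have ends: "z1 \<in> ?K" "z2 \<in> ?K" using g pathstart_in_path_image pathfinish_in_path_image by metis+
  have "connected_component ?U (t *\<^sub>R z1) (t *\<^sub>R z2)"
  proof (rule connected_componentI)
    show "connected ((\<lambda>z. t *\<^sub>R z) ` ?K)"
      by (intro connected_continuous_image continuous_intros connected_path_image g)
    show "(\<lambda>z. t *\<^sub>R z) ` ?K \<subseteq> ?U"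
      using nz t K(3) scale_square[OF _ t] by auto
  qed (use ends in auto)
  then show ?thesis
    using seg[OF z(1) ends(1)] seg[OF z(2) ends(2)]
    by (meson connected_component_sym connected_component_trans)
qed

text \<open>A nodal domain is sent to the component of \<open>nonzero u\<close> that contains it. By
  \<open>nonzero_component_open\<close> two nodal domains cannot be joined through boundary points,
  so this map is injective.\<close>

lemma nodal_card_le:
  assumes u: "continuous_on csquare u" and G: "finite G"
    and rep: "\<And>z. z \<in> square \<Longrightarrow> u z \<noteq> 0 \<Longrightarrow> \<exists>q\<in>G. connected_component (nonzero u) z q"
  shows "card (nodal_domains u) \<le> card (connected_component_set (nonzero u) ` G)"
proof -
  let ?U = "square - u -` {0}"
  let ?cc = "connected_component_set (nonzero u)"
  define r where "r = (\<lambda>C. ?cc (SOME z. z \<in> C))"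
  have some: "(SOME z. z \<in> C) \<in> C" "C = connected_component_set ?U (SOME z. z \<in> C)" if "C \<in> components ?U" for C
  proof -
    show *: "(SOME z. z \<in> C) \<in> C" using in_components_nonempty[OF that] some_in_eq by blast
    show "C = connected_component_set ?U (SOME z. z \<in> C)"
      using that * by (metis (no_types, lifting) connected_component_eq componentsE)
  qed
  have inj: "inj_on r (components ?U)"
  proof (rule inj_onI)
    fix C D assume C: "C \<in> components ?U" and D: "D \<in> components ?U" and eq: "r C = r D"
    let ?c = "SOME z. z \<in> C" and ?d = "SOME z. z \<in> D"
    have c: "?c \<in> ?U" "?d \<in> ?U" using some(1)[OF C] some(1)[OF D] in_components_subset[OF C] in_components_subset[OF D] by blast+
    have "?d \<in> nonzero u" using c by (auto simp: nonzero_def square_def)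
    then have "?d \<in> ?cc ?d" by simp
    then have "?d \<in> ?cc ?c" using eq unfolding r_def by (simp only:)
    then have "connected_component (nonzero u) ?c ?d" by simp
    then have "connected_component ?U ?c ?d" using nonzero_component_open[OF u] c by blast
    then show "C = D" using some(2)[OF C] some(2)[OF D] connected_component_eq by (metis mem_Collect_eq)
  qed
  have "r ` components ?U \<subseteq> ?cc ` G"
  proof
    fix K assume "K \<in> r ` components ?U"
    then obtain C where C: "C \<in> components ?U" "K = r C" by blast
    let ?c = "SOME z. z \<in> C"
    have "?c \<in> ?U" using some(1)[OF C(1)] in_components_subset[OF C(1)] by blast
    then obtain q where q: "q \<in> G" "connected_component (nonzero u) ?c q" using rep by blast
    then have "?cc ?c = ?cc q" by (simp add: connected_component_eq)
    then show "K \<in> ?cc ` G" using q C by (simp add: r_def)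
  qed
  then have "card (r ` components ?U) \<le> card (?cc ` G)" using G by (intro card_mono) auto
  then show ?thesis unfolding nodal_domains_def using card_image[OF inj] by simp
qed

section \<open>The maximum principle\<close>

lemma local_max_second_deriv:
  fixes f :: "real \<Rightarrow> real"
  assumes f: "\<And>x. (f has_real_derivative f' x) (at x)" and f': "(f' has_real_derivative l) (at x)"
    and max: "d > 0" "\<And>y. \<bar>x - y\<bar> < d \<Longrightarrow> f y \<le> f x"
  shows "l \<le> 0"
proof (rule ccontr)
  assume "\<not> l \<le> 0"
  have 0: "f' x = 0" using DERIV_local_max[OF f max(1)] max(2) by auto
  obtain e where e: "e > 0" "\<And>h. 0 < h \<Longrightarrow> h < e \<Longrightarrow> f' x < f' (x + h)"
    using DERIV_pos_inc_right[OF f'] \<open>\<not> l \<le> 0\<close> by auto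
  define h where "h = min d e / 2"
  have h: "0 < h" "h < d" "h < e" using max(1) e(1) by (auto simp: h_def)
  obtain z where z: "x < z" "z < x + h" "f (x + h) - f x = (x + h - x) * f' z"
    using MVT2[of x "x + h" f f'] f h by auto
  have "f' z > 0" using e(2)[of "z - x"] z h 0 by auto
  then have "f (x + h) > f x" using z(3) h by (metis add_diff_cancel_left' diff_gt_0_iff_gt mult_pos_pos)
  moreover have "f (x + h) \<le> f x" using max(2)[of "x + h"] h by auto
  ultimately show False by simp
qed

text \<open>Maximum principle: \<open>\<Delta>u = k u\<close> with \<open>k > 0\<close> excludes positive interior maxima and negative interior
  minima.\<close>

lemma reaches_boundary:
  assumes ux: "\<And>x y. ((\<lambda>x. u (x, y)) has_real_derivative ux (x, y)) (at x)"
    and uxx: "\<And>x y. ((\<lambda>x. ux (x, y)) has_real_derivative uxx (x, y)) (at x)"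
    and uy: "\<And>x y. ((\<lambda>y. u (x, y)) has_real_derivative uy (x, y)) (at y)"
    and uyy: "\<And>x y. ((\<lambda>y. uy (x, y)) has_real_derivative uyy (x, y)) (at y)"
    and lap: "\<And>z. uxx z + uyy z = k * u z" and k: "k > 0"
    and u: "continuous_on UNIV u" and z: "z \<in> nonzero u"
  shows "\<exists>q \<in> nonzero u - square. connected_component (nonzero u) z q"
proof -
  \<comment> \<open>The sign \<open>s\<close> treats positive and negative components together:
    \<open>s * u\<close> is positive on the whole component.\<close>
  define s where "s = sgn (u z)"
  have s: "s * u z > 0" "s \<noteq> 0" using z by (auto simp: s_def nonzero_def sgn_if)
  let ?C = "connected_component_set (nonzero u) z"
  have Csub: "?C \<subseteq> nonzero u" by (rule connected_component_subset)
  have uc: "continuous_on T u" for T using u continuous_on_subset by blast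
  have zC: "z \<in> ?C" using z by simp
  have pos: "s * u q > 0" if "q \<in> ?C" for q
  proof (rule ccontr)
    assume neg: "\<not> s * u q > 0"
    have "connected ((\<lambda>q. s * u q) ` ?C)"
      by (intro connected_continuous_image continuous_intros uc connected_connected_component)
    then have "is_interval ((\<lambda>q. s * u q) ` ?C)" by (simp add: is_interval_connected_1)
    moreover have "s * u q \<in> (\<lambda>q. s * u q) ` ?C" "s * u z \<in> (\<lambda>q. s * u q) ` ?C" using that zC by auto
    ultimately have "0 \<in> (\<lambda>q. s * u q) ` ?C" using neg s(1) unfolding is_interval_1 by (meson less_imp_le not_less)
    then show False using Csub s(2) by (auto simp: nonzero_def)
  qed
  have "closure ?C \<subseteq> csquare"
    using Csub by (intro closure_minimal closed_Times) (auto simp: nonzero_def)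
  moreover have "bounded csquare" by (intro bounded_Times) auto
  ultimately have "compact (closure ?C)" by (meson bounded_subset closed_closure compact_eq_bounded_closed)
  moreover have "closure ?C \<noteq> {}" using zC by (metis closure_eq_empty empty_iff)
  moreover have "continuous_on (closure ?C) (\<lambda>q. s * u q)" by (intro continuous_intros uc)
  ultimately have "\<exists>q\<in>closure ?C. \<forall>r\<in>closure ?C. s * u r \<le> s * u q"
    by (rule continuous_attains_sup)
  then obtain q where q: "q \<in> closure ?C" "\<And>r. r \<in> closure ?C \<Longrightarrow> s * u r \<le> s * u q" by blast
  have "z \<in> closure ?C" using zC closure_subset by blast
  then have "s * u q > 0" using q(2)[of z] s(1) by linarith
  then have qn: "q \<in> nonzero u" using q(1) \<open>closure ?C \<subseteq> csquare\<close> by (auto simp: nonzero_def)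
  \<comment> \<open>The maximum is attained on the closure; as \<open>u\<close> does not vanish at
    \<open>q\<close>, adding \<open>q\<close> to the component keeps it connected inside
    \<open>nonzero u\<close>.\<close>
  have qC: "q \<in> ?C"
  proof -
    have "connected (insert q ?C)"
    proof (rule connected_intermediate_closure[of ?C])
      show "connected ?C" by (rule connected_connected_component)
      show "?C \<subseteq> insert q ?C" by blast
      show "insert q ?C \<subseteq> closure ?C" using q(1) closure_subset by blast
    qed
    moreover have "insert q ?C \<subseteq> nonzero u" using qn Csub by blast
    ultimately have "insert q ?C \<subseteq> ?C" using zC by (intro connected_component_maximal) auto
    then show ?thesis by blast
  qed
  have "q \<notin> square"
  proof
    assume "q \<in> square"
    moreover have "open square" by (auto simp: square_def intro!: open_Times)
    moreover have "open (square \<inter> (\<lambda>q. s * u q) -` {0<..})"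
      using \<open>open square\<close> by (intro continuous_open_preimage continuous_intros uc) auto
    moreover have "q \<in> square \<inter> (\<lambda>q. s * u q) -` {0<..}" using \<open>q \<in> square\<close> \<open>s * u q > 0\<close> by simp
    ultimately obtain d where d: "d > 0" "ball q d \<subseteq> square \<inter> (\<lambda>q. s * u q) -` {0<..}"
      using openE by blast
    have "ball q d \<subseteq> nonzero u"
    proof
      fix r assume "r \<in> ball q d"
      then have "r \<in> square" "s * u r > 0" using d(2) by auto
      then show "r \<in> nonzero u" by (auto simp: nonzero_def square_def)
    qed
    then have "ball q d \<subseteq> connected_component_set (nonzero u) q" using d(1)
      by (intro connected_component_maximal) auto
    also have "\<dots> = ?C" using qC by (metis connected_component_eq)
    finally have loc: "s * u r \<le> s * u q" if "r \<in> ball q d" for r using q(2) that closure_subset by blast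
    obtain x y where xy: "q = (x, y)" by (metis surj_pair)
    have "s * uxx (x, y) \<le> 0"
    proof (rule local_max_second_deriv[of "\<lambda>x. s * u (x, y)" "\<lambda>x. s * ux (x, y)" _ x d])
      show "((\<lambda>x. s * u (x, y)) has_real_derivative s * ux (x, y)) (at x)" for x by (intro DERIV_cmult ux)
      show "((\<lambda>x. s * ux (x, y)) has_real_derivative s * uxx (x, y)) (at x)" by (intro DERIV_cmult uxx)
      show "s * u (x', y) \<le> s * u (x, y)" if "\<bar>x - x'\<bar> < d" for x'
        using loc[of "(x', y)"] that by (simp add: xy dist_Pair_Pair dist_real_def)
    qed (rule d(1))
    moreover have "s * uyy (x, y) \<le> 0"
    proof (rule local_max_second_deriv[of "\<lambda>y. s * u (x, y)" "\<lambda>y. s * uy (x, y)" _ y d])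
      show "((\<lambda>y. s * u (x, y)) has_real_derivative s * uy (x, y)) (at y)" for y by (intro DERIV_cmult uy)
      show "((\<lambda>y. s * uy (x, y)) has_real_derivative s * uyy (x, y)) (at y)" by (intro DERIV_cmult uyy)
      show "s * u (x, y') \<le> s * u (x, y)" if "\<bar>y - y'\<bar> < d" for y'
        using loc[of "(x, y')"] that by (simp add: xy dist_Pair_Pair dist_real_def)
    qed (rule d(1))
    ultimately have "s * (uxx (x, y) + uyy (x, y)) \<le> 0" by (simp add: distrib_left)
    then have "s * (k * u q) \<le> 0" using lap[of "(x, y)"] by (simp add: xy)
    moreover have "s * (k * u q) = k * (s * u q)" by simp
    ultimately show False using k \<open>s * u q > 0\<close> by (metis mult_pos_pos not_le)
  qed
  then show ?thesis using qC qn by blast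
qed

text \<open>Prepares the choice of a representative: a sign interval that reaches an end can be
  represented there, and one between two zeros by a point from Rolle's theorem.\<close>

lemma zero_gap:
  fixes w :: "real \<Rightarrow> real"
  assumes w: "continuous_on {l..r} w" and x: "x \<in> {l..r}" "w x \<noteq> 0"
  shows "(\<forall>t\<in>{x..r}. w t \<noteq> 0) \<or> (\<forall>t\<in>{l..x}. w t \<noteq> 0) \<or>
    (\<exists>z1 z2. l \<le> z1 \<and> z1 < x \<and> x < z2 \<and> z2 \<le> r \<and> w z1 = 0 \<and> w z2 = 0 \<and> (\<forall>t\<in>{z1<..<z2}. w t \<noteq> 0))"
proof (cases "(\<exists>t\<in>{x..r}. w t = 0) \<and> (\<exists>t\<in>{l..x}. w t = 0)")
  case True
  let ?R = "{t \<in> {x..r}. w t = 0}" and ?L = "{t \<in> {l..x}. w t = 0}"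
  have comp: "compact {t \<in> {c..d}. w t = 0}" if "{c..d} \<subseteq> {l..r}" for c d
  proof -
    have "closed ({c..d} \<inter> w -` {0})"
      by (intro continuous_closed_preimage continuous_on_subset[OF w that]) auto
    moreover have "{t \<in> {c..d}. w t = 0} = {c..d} \<inter> w -` {0}" by auto
    ultimately have "closed {t \<in> {c..d}. w t = 0}" by simp
    moreover have "bounded {t \<in> {c..d}. w t = 0}" by (rule bounded_subset[of "{c..d}"]) auto
    ultimately show ?thesis by (simp add: compact_eq_bounded_closed)
  qed
  have "\<exists>z2\<in>?R. \<forall>t\<in>?R. z2 \<le> t"
    by (rule compact_attains_inf[OF comp]) (use True x(1) in auto)
  then obtain z2 where z2: "z2 \<in> ?R" "\<And>t. t \<in> ?R \<Longrightarrow> z2 \<le> t" by blast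
  have "\<exists>z1\<in>?L. \<forall>t\<in>?L. t \<le> z1"
    by (rule compact_attains_sup[OF comp]) (use True x(1) in auto)
  then obtain z1 where z1: "z1 \<in> ?L" "\<And>t. t \<in> ?L \<Longrightarrow> t \<le> z1" by blast
  have "z1 \<noteq> x" "z2 \<noteq> x" using z1(1) z2(1) x(2) by auto
  then have "z1 < x" "x < z2" using z1(1) z2(1) by auto
  moreover have "w t \<noteq> 0" if "t \<in> {z1<..<z2}" for t
    using that z1(2)[of t] z2(2)[of t] z1(1) z2(1) by (cases "t \<le> x") force+
  moreover have "l \<le> z1" "z2 \<le> r" "w z1 = 0" "w z2 = 0" using z1(1) z2(1) by auto
  ultimately show ?thesis by blast
qed blast

text \<open>The gaps between consecutive zeros contain distinct elements of \<open>Z\<close>. The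
  bound is first proved for finite sets of zeros, and finiteness of the whole set follows from
  it.\<close>

lemma rolle_card:
  fixes W :: "real \<Rightarrow> real"
  assumes W: "\<And>x. (W has_real_derivative W' x) (at x)"
    and fin: "finite Z" and sub: "{x \<in> {l<..<r}. W' x = 0} \<subseteq> Z"
  shows "finite {x \<in> {l..r}. W x = 0} \<and> card {x \<in> {l..r}. W x = 0} \<le> Suc (card Z)"
proof -
  have bound: "card F \<le> Suc (card Z)" if F: "finite F" "F \<subseteq> {x \<in> {l..r}. W x = 0}" for F
  proof (cases "F = {}")
    case False
    define F' where "F' = F - {Max F}"
    define nx where "nx = (\<lambda>f. Min {g \<in> F. f < g})"
    have nx: "nx f \<in> F" "f < nx f" "\<And>g. g \<in> F \<Longrightarrow> f < g \<Longrightarrow> nx f \<le> g" if "f \<in> F'" for f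
    proof -
      have "f < Max F" using that F(1) by (metis DiffD1 DiffD2 F'_def Max_ge le_less singletonI)
      then have ne: "{g \<in> F. f < g} \<noteq> {}" using F(1) False Max_in by blast
      have fi: "finite {g \<in> F. f < g}" using F(1) by simp
      show "nx f \<in> F" "f < nx f" using Min_in[OF fi ne] by (auto simp: nx_def)
      show "nx f \<le> g" if "g \<in> F" "f < g" for g unfolding nx_def using fi that by (intro Min_le) auto
    qed
    have "\<exists>c. f < c \<and> c < nx f \<and> c \<in> Z" if f: "f \<in> F'" for f
    proof -
      have "W g = 0" if "g \<in> F" for g using F(2) that by auto
      then have "W f = W (nx f)" using f nx(1)[OF f] by (simp add: F'_def)
      moreover have "continuous_on {f..nx f} W"
        by (rule DERIV_continuous_on) (rule has_field_derivative_at_within[OF W])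
      moreover have "W differentiable (at x)" for x using W real_differentiable_def by blast
      ultimately obtain c where c: "f < c" "c < nx f" "(W has_real_derivative 0) (at c)"
        using Rolle[OF nx(2)[OF f]] by metis
      then have "W' c = 0" using DERIV_unique W by blast
      moreover have "l \<le> f" "nx f \<le> r" using F(2) f nx(1)[OF f] by (auto simp: F'_def)
      ultimately show ?thesis using c sub by force
    qed
    then obtain c where c: "\<And>f. f \<in> F' \<Longrightarrow> f < c f \<and> c f < nx f \<and> c f \<in> Z" by metis
    have "inj_on c F'"
    proof (rule inj_onI)
      have lt: "c f < c g" if "f \<in> F'" "g \<in> F'" "f < g" for f g
      proof -
        have "nx f \<le> g" using nx(3)[OF that(1)] that by (auto simp: F'_def)
        then show ?thesis using c[OF that(1)] c[OF that(2)] by linarith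
      qed
      fix f g assume "f \<in> F'" "g \<in> F'" "c f = c g"
      then show "f = g" using lt[of f g] lt[of g f] by (cases f g rule: linorder_cases) auto
    qed
    moreover have "c ` F' \<subseteq> Z" using c by blast
    ultimately have "card F' \<le> card Z" using card_inj_on_le fin by blast
    moreover have "card F' = card F - 1" using F(1) False by (simp add: F'_def)
    ultimately show ?thesis by simp
  qed simp
  have "finite {x \<in> {l..r}. W x = 0}"
  proof (rule ccontr)
    assume "infinite {x \<in> {l..r}. W x = 0}"
    then obtain F where "F \<subseteq> {x \<in> {l..r}. W x = 0}" "finite F" "card F = Suc (Suc (card Z))"
      using infinite_arbitrarily_large by blast
    then show False using bound[of F] by simp
  qed
  then show ?thesis using bound by blast
qed

section \<open>Nodal domains of a combination of two products\<close>

lemma affine_between: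
  fixes p q r \<alpha> \<beta> :: real
  assumes "p \<le> r \<and> r \<le> q \<or> q \<le> r \<and> r \<le> p" and "(\<alpha> + \<beta> * p) * (\<alpha> + \<beta> * q) > 0"
  shows "\<alpha> + \<beta> * r \<noteq> 0"
proof -
  have "\<beta> * p \<le> \<beta> * r \<and> \<beta> * r \<le> \<beta> * q \<or> \<beta> * q \<le> \<beta> * r \<and> \<beta> * r \<le> \<beta> * p"
    using assms(1) by (cases "\<beta> \<ge> 0") (auto intro: mult_left_mono mult_left_mono_neg)
  then show ?thesis using assms(2) by (auto simp: zero_less_mult_iff)
qed

text \<open>A triple contributes at most two values instead of three, so each index in
  \<open>I\<close> saves one.\<close>

lemma card_image_triples:
  assumes G: "finite G" and I: "finite I" and dis: "disjoint_family_on T I"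
    and T: "\<And>i. i \<in> I \<Longrightarrow> T i \<subseteq> G" "\<And>i. i \<in> I \<Longrightarrow> card (T i) = 3"
      "\<And>i. i \<in> I \<Longrightarrow> card (f ` (T i \<inter> S)) \<le> 2"
  shows "card (f ` (G \<inter> S)) + card I \<le> card G"
proof -
  let ?U = "\<Union>i\<in>I. T i"
  have fT: "finite (T i)" if "i \<in> I" for i using T(1)[OF that] G finite_subset by blast
  have "f ` (G \<inter> S) \<subseteq> f ` (G - ?U) \<union> (\<Union>i\<in>I. f ` (T i \<inter> S))" by blast
  then have "card (f ` (G \<inter> S)) \<le> card (f ` (G - ?U) \<union> (\<Union>i\<in>I. f ` (T i \<inter> S)))"
    using G I fT by (intro card_mono) auto
  also have "\<dots> \<le> card (f ` (G - ?U)) + card (\<Union>i\<in>I. f ` (T i \<inter> S))" by (rule card_Un_le)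
  also have "card (f ` (G - ?U)) \<le> card (G - ?U)" using G by (intro card_image_le) auto
  also have "card (\<Union>i\<in>I. f ` (T i \<inter> S)) \<le> (\<Sum>i\<in>I. card (f ` (T i \<inter> S)))" by (rule card_UN_le[OF I])
  also have "\<dots> \<le> (\<Sum>i\<in>I. 2)" using T(3) by (intro sum_mono)
  also have "\<dots> = 2 * card I" by simp
  finally have le: "card (f ` (G \<inter> S)) \<le> card (G - ?U) + 2 * card I" by simp
  have "card ?U = (\<Sum>i\<in>I. card (T i))" using I fT dis by (intro card_UN_disjoint) (auto simp: disjoint_family_on_def)
  also have "\<dots> = 3 * card I" using T(2) by simp
  finally have cU: "card ?U = 3 * card I" .
  have US: "?U \<subseteq> G" using T(1) by blast
  have "card (G - ?U) = card G - card ?U" by (rule card_Diff_subset[OF finite_subset[OF US G] US])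
  moreover have "card ?U \<le> card G" by (rule card_mono[OF G US])
  ultimately show ?thesis using le cU by linarith
qed

abbreviation is_sign :: "real \<Rightarrow> bool" where
  "is_sign \<sigma> \<equiv> \<sigma> = 1 \<or> \<sigma> = -1"

definition side :: "bool \<Rightarrow> real \<Rightarrow> real \<Rightarrow> real \<times> real" where
  "side s \<tau> t = (if s then (t, \<tau> * (pi/2)) else (\<tau> * (pi/2), t))"

definition grid :: "real set \<Rightarrow> (real \<times> real) set" where
  "grid X = X \<times> {-pi/2, pi/2} \<union> {-pi/2, pi/2} \<times> X"

text \<open>Each side carries a copy of \<open>X\<close>, and each of the four corners is shared by
  two sides.\<close>

lemma grid_card:
  assumes "finite X" "{-pi/2, pi/2} \<subseteq> X"
  shows "finite (grid X)" "card (grid X) \<le> 4 * card X - 4"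
proof -
  let ?E = "{-pi/2, pi/2 :: real}"
  have E: "card ?E = 2" using pi_gt_zero by (simp add: card_insert_if)
  show "finite (grid X)" using assms by (simp add: grid_def)
  have "grid X = X \<times> ?E \<union> ?E \<times> (X - ?E)" using assms(2) unfolding grid_def by blast
  then have "card (grid X) \<le> card (X \<times> ?E) + card (?E \<times> (X - ?E))" by (metis card_Un_le)
  also have "\<dots> = 2 * card X + 2 * (card X - 2)"
    using assms(2) E by (simp add: card_cartesian_product card_Diff_subset)
  finally have "card (grid X) \<le> 2 * card X + 2 * (card X - 2)" .
  moreover have "2 \<le> card X" using card_mono[OF assms] E by simp
  ultimately show "card (grid X) \<le> 4 * card X - 4" by linarith
qed

text \<open>Expresses that the sign interval of \<open>w\<close> around \<open>x\<close> meets
  \<open>X\<close>, so that finitely many points can represent all sign intervals.\<close>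

definition rep_on :: "real set \<Rightarrow> (real \<Rightarrow> real) \<Rightarrow> real \<Rightarrow> bool" where
  "rep_on X w x \<longleftrightarrow> (w x \<noteq> 0 \<longrightarrow> (\<exists>x'\<in>X. \<forall>t\<in>closed_segment x x'. w t \<noteq> 0))"

lemma rep_on_reflect:
  assumes "rep_on X (\<lambda>x. w (- x)) (- x)" "uminus ` X \<subseteq> X"
  shows "rep_on X w x"
  unfolding rep_on_def
proof
  assume "w x \<noteq> 0"
  then obtain x' where x': "x' \<in> X" "\<And>t. t \<in> closed_segment (- x) x' \<Longrightarrow> w (- t) \<noteq> 0"
    using assms(1) unfolding rep_on_def by auto
  have "w t \<noteq> 0" if "t \<in> closed_segment x (- x')" for t
  proof -
    have "- t \<in> closed_segment (- x) x'" using that unfolding closed_segment_eq_real_ivl by (auto split: if_splits)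
    then show ?thesis using x'(2) by fastforce
  qed
  then show "\<exists>x'\<in>X. \<forall>t\<in>closed_segment x x'. w t \<noteq> 0" using assms(2) x'(1) by blast
qed

text \<open>All that the nodal count uses of the modes: \<open>A\<close> is the mode of index
  \<open>i < 2\<close> and \<open>Q\<close> that of index \<open>n\<close>, with
  \<open>\<kappa> = - \<mu> i\<close> and \<open>\<nu> = \<mu> n\<close>. \<open>Wend\<close> is the
  common Robin condition with \<open>H\<close> eliminated, and \<open>\<nu> < \<kappa>\<close> says
  that the sum of the two eigenvalues is negative.\<close>

locale nodal_pair =
  fixes A A' Q Q' :: "real \<Rightarrow> real" and \<kappa> \<nu> sA sQ :: real
  assumes dA: "\<And>x. (A has_real_derivative A' x) (at x)"
    and dA': "\<And>x. (A' has_real_derivative \<kappa> * A x) (at x)"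
    and dQ: "\<And>x. (Q has_real_derivative Q' x) (at x)"
    and dQ': "\<And>x. (Q' has_real_derivative - \<nu> * Q x) (at x)"
    and \<nu>\<kappa>: "0 < \<nu>" "\<nu> < \<kappa>"
    and Apos: "\<And>x. 0 < x \<Longrightarrow> x \<le> pi/2 \<Longrightarrow> A x > 0"
    and Qend: "Q (pi/2) \<noteq> 0"
    and Wend: "Q' (pi/2) * A (pi/2) = Q (pi/2) * A' (pi/2)"
    and sA: "sA = 1 \<or> sA = -1" "\<And>x. A (- x) = sA * A x"
    and sQ: "sQ = 1 \<or> sQ = -1" "\<And>x. Q (- x) = sQ * Q x"
begin

text \<open>The Wronskian: its zeros are the critical points of \<open>Q / A\<close>.\<close>

definition W :: "real \<Rightarrow> real" where "W x = Q' x * A x - Q x * A' x"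

text \<open>The products of first derivatives cancel. Hence Rolle's theorem bounds the number of
  zeros of \<open>W\<close> by that of \<open>Q\<close> plus one wherever \<open>A\<close> has no
  zero.\<close>

lemma dW: "(W has_real_derivative - (\<kappa> + \<nu>) * (Q x * A x)) (at x)"
  unfolding W_def[abs_def]
  by (rule derivative_eq_intros dA dA' dQ dQ' refl)+ (simp add: algebra_simps)

lemma W_end: "W (pi/2) = 0" using Wend by (simp add: W_def)

lemma dW0: "- (\<kappa> + \<nu>) * (Q x * A x) = 0 \<longleftrightarrow> Q x = 0 \<or> A x = 0"
  using \<nu>\<kappa> by simp

lemma contA: "continuous_on S A" by (rule DERIV_continuous_on) (rule has_field_derivative_at_within[OF dA])
lemma contQ: "continuous_on S Q" by (rule DERIV_continuous_on) (rule has_field_derivative_at_within[OF dQ])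

lemma dquot:
  assumes "A x \<noteq> 0"
  shows "((\<lambda>x. Q x / A x) has_real_derivative W x / (A x)\<^sup>2) (at x)"
  using DERIV_divide[OF dQ dA assms] by (simp add: W_def power2_eq_square)

lemma comb_cont: "continuous_on S (\<lambda>x. c1 * A x + c2 * Q x)"
  by (intro continuous_intros contA contQ)

text \<open>At both zeros \<open>Q / A\<close> takes the value \<open>- c1 / c2\<close>, so it has a
  critical point in between, a zero of \<open>W\<close>.\<close>

lemma comb_rolle:
  assumes z: "z1 < z2" "\<And>x. x \<in> {z1..z2} \<Longrightarrow> A x \<noteq> 0"
    and w: "c1 * A z1 + c2 * Q z1 = 0" "c1 * A z2 + c2 * Q z2 = 0" and c: "c1 \<noteq> 0 \<or> c2 \<noteq> 0"
  shows "\<exists>t. z1 < t \<and> t < z2 \<and> W t = 0"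
proof -
  have c2: "c2 \<noteq> 0" using w(1) c z by auto
  have "c1 + c2 * (Q z1 / A z1) = 0" "c1 + c2 * (Q z2 / A z2) = 0"
    using w z by (auto simp: field_simps)
  then have "c2 * (Q z1 / A z1) = c2 * (Q z2 / A z2)" by linarith
  then have eq: "Q z1 / A z1 = Q z2 / A z2" using c2 mult_left_cancel by blast
  have "continuous_on {z1..z2} (\<lambda>x. Q x / A x)"
    by (intro continuous_intros contA contQ) (use z in auto)
  moreover have "(\<lambda>x. Q x / A x) differentiable (at x)" if "z1 < x" "x < z2" for x
    using dquot[OF z(2)] that real_differentiable_def by (metis atLeastAtMost_iff less_imp_le)
  ultimately obtain t where t: "z1 < t" "t < z2" "((\<lambda>x. Q x / A x) has_real_derivative 0) (at t)"
    using Rolle[of z1 z2 "\<lambda>x. Q x / A x", OF z(1)] eq by blast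
  have "A t \<noteq> 0" using t z by auto
  then have "W t / (A t)\<^sup>2 = 0" using DERIV_unique[OF dquot t(3)] by blast
  then show ?thesis using t \<open>A t \<noteq> 0\<close> by auto
qed

text \<open>Equal values of \<open>g\<close> would produce a zero of \<open>W\<close> by
  \<open>comb_rolle\<close>, so \<open>g\<close> is strictly monotone, and its zero at
  \<open>\<zeta>\<close> separates the values at the two ends.\<close>

lemma segment_between:
  assumes \<xi>: "0 \<le> \<xi>" "\<xi> < pi/2" "A \<xi> > 0" and W: "\<forall>x\<in>{\<xi><..<pi/2}. W x \<noteq> 0"
    and \<zeta>: "\<xi> < \<zeta>" "\<zeta> < pi/2" "Q \<zeta> = 0"
  defines "g \<equiv> \<lambda>x. Q x / A x"
  shows "g \<xi> * g (pi/2) < 0"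
    and "x \<in> {\<xi>..pi/2} \<Longrightarrow> g \<xi> \<le> g x \<and> g x \<le> g (pi/2) \<or> g (pi/2) \<le> g x \<and> g x \<le> g \<xi>"
proof -
  have A0: "A x \<noteq> 0" if "x \<in> {\<xi>..pi/2}" for x
    using that \<xi> Apos[of x] by (cases "x = \<xi>") auto
  have gc: "continuous_on {\<xi>..pi/2} g" unfolding g_def by (intro continuous_intros contA contQ) (use A0 in auto)
  have inj: "inj_on g {\<xi>..pi/2}"
  proof (rule linorder_inj_onI')
    fix s t assume st: "s \<in> {\<xi>..pi/2}" "t \<in> {\<xi>..pi/2}" "s < t"
    show "g s \<noteq> g t"
    proof
      assume "g s = g t"
      moreover have "g s * A s = Q s" "g t * A t = Q t" using A0[of s] A0[of t] st by (simp_all add: g_def)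
      ultimately have "\<exists>r. s < r \<and> r < t \<and> W r = 0"
        using st A0 by (intro comb_rolle[of s t "g s" "-1"]) auto
      then show False using W st by force
    qed
  qed
  have "g \<zeta> = 0" using \<zeta> by (simp add: g_def)
  moreover have "g \<xi> < g \<zeta> \<and> g \<zeta> < g (pi/2) \<or> g (pi/2) < g \<zeta> \<and> g \<zeta> < g \<xi>"
    using continuous_inj_imp_mono[of \<xi> \<zeta> "pi/2" g] \<zeta> gc inj by auto
  ultimately show "g \<xi> * g (pi/2) < 0" by (auto simp: mult_less_0_iff)
  show "g \<xi> \<le> g x \<and> g x \<le> g (pi/2) \<or> g (pi/2) \<le> g x \<and> g x \<le> g \<xi>" if "x \<in> {\<xi>..pi/2}"
  proof (cases "x = \<xi> \<or> x = pi/2")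
    case True
    then have "g x = g \<xi> \<or> g x = g (pi/2)" by metis
    then show ?thesis by linarith
  next
    case False
    then show ?thesis using continuous_inj_imp_mono[of \<xi> x "pi/2" g] that gc inj by auto
  qed
qed

end

locale nodal_form = nodal_pair +
  fixes a b :: real
  assumes ab: "a \<noteq> 0 \<or> b \<noteq> 0"
begin

definition u :: "real \<times> real \<Rightarrow> real" where
  "u z = a * (A (fst z) * Q (snd z)) + b * (Q (fst z) * A (snd z))"

abbreviation "conn \<equiv> connected_component (nonzero u)"
abbreviation "cc \<equiv> connected_component_set (nonzero u)"

lemma cont_u: "continuous_on S u"
  unfolding u_def
  by (intro continuous_intros continuous_on_compose2[OF contA[of UNIV]] continuous_on_compose2[OF contQ[of UNIV]]) auto

text \<open>The parities of \<open>A\<close> and \<open>Q\<close> turn a reflection into a change of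
  coefficients, so arguments can be restricted to the quadrant of nonnegative coordinates.\<close>

lemma u_reflect:
  assumes "is_sign \<sigma>" "is_sign \<tau>"
  shows "\<exists>a' b'. (a' \<noteq> 0 \<or> b' \<noteq> 0) \<and> (\<forall>x y. u (\<sigma> * x, \<tau> * y) = a' * (A x * Q y) + b' * (Q x * A y))"
proof -
  have "\<exists>r. r \<noteq> 0 \<and> (\<forall>x. A (\<sigma> * x) = r * A x)" if "is_sign \<sigma>" for \<sigma>
    using that sA by (metis mult_1 mult_minus1 one_neq_neg_one one_neq_zero zero_neq_neg_one)
  then obtain r1 r2 where r: "r1 \<noteq> 0" "\<And>x. A (\<sigma> * x) = r1 * A x" "r2 \<noteq> 0" "\<And>x. A (\<tau> * x) = r2 * A x"
    using assms by metis
  have "\<exists>r. r \<noteq> 0 \<and> (\<forall>x. Q (\<sigma> * x) = r * Q x)" if "is_sign \<sigma>" for \<sigma>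
    using that sQ by (metis mult_1 mult_minus1 one_neq_neg_one one_neq_zero zero_neq_neg_one)
  then obtain q1 q2 where q: "q1 \<noteq> 0" "\<And>x. Q (\<sigma> * x) = q1 * Q x" "q2 \<noteq> 0" "\<And>x. Q (\<tau> * x) = q2 * Q x"
    using assms by metis
  show ?thesis
    by (intro exI[of _ "a * r1 * q2"] exI[of _ "b * q1 * r2"]) (use r q ab in \<open>auto simp: u_def algebra_simps\<close>)
qed

text \<open>On a side one factor of each product is constant, and it is nonzero because neither
  \<open>A\<close> nor \<open>Q\<close> vanishes at pi/2; hence the restriction is a nontrivial
  combination.\<close>

lemma u_side:
  assumes "is_sign \<sigma>" "is_sign \<tau>"
  obtains c1 c2 where "c1 \<noteq> 0 \<or> c2 \<noteq> 0" "\<And>t. u (side s \<tau> (\<sigma> * t)) = c1 * A t + c2 * Q t"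
proof (cases s)
  case True
  obtain a' b' where c: "a' \<noteq> 0 \<or> b' \<noteq> 0" and r: "\<And>x y. u (\<sigma> * x, \<tau> * y) = a' * (A x * Q y) + b' * (Q x * A y)"
    using u_reflect[OF assms] by blast
  show ?thesis
  proof (rule that)
    show "a' * Q (pi/2) \<noteq> 0 \<or> b' * A (pi/2) \<noteq> 0" using c Qend Apos[of "pi/2"] by auto
    show "u (side s \<tau> (\<sigma> * t)) = a' * Q (pi/2) * A t + b' * A (pi/2) * Q t" for t
      using True unfolding side_def by (simp only: if_True r, (simp add: mult_ac)?)
  qed
next
  case False
  obtain a' b' where c: "a' \<noteq> 0 \<or> b' \<noteq> 0" and r: "\<And>x y. u (\<tau> * x, \<sigma> * y) = a' * (A x * Q y) + b' * (Q x * A y)"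
    using u_reflect[OF assms(2,1)] by blast
  show ?thesis
  proof (rule that)
    show "b' * Q (pi/2) \<noteq> 0 \<or> a' * A (pi/2) \<noteq> 0" using c Qend Apos[of "pi/2"] by auto
    show "u (side s \<tau> (\<sigma> * t)) = b' * Q (pi/2) * A t + a' * A (pi/2) * Q t" for t
      using False unfolding side_def by (simp only: if_False r, (simp add: mult_ac)?)
  qed
qed

lemma conn_image:
  assumes "connected K" "continuous_on K f" "\<And>t. t \<in> K \<Longrightarrow> f t \<in> csquare \<and> u (f t) \<noteq> 0" "s \<in> K" "t \<in> K"
  shows "conn (f s) (f t)"
proof (rule connected_componentI)
  show "connected (f ` K)" by (rule connected_continuous_image[OF assms(2,1)])
  show "f ` K \<subseteq> nonzero u" unfolding nonzero_def using assms(3) by blast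
qed (use assms(4,5) in simp_all)

lemma cc_eq: "conn z z' \<Longrightarrow> cc z = cc z'"
  using connected_component_eq[of z' "nonzero u" z] by simp

text \<open>The maximum principle leads from a nodal domain to a side, and \<open>rep\<close> leads
  along that side to a grid point without crossing a zero.\<close>

lemma card_nodal_grid:
  assumes X: "finite X" "{-pi/2, pi/2} \<subseteq> X" "X \<subseteq> {-pi/2..pi/2}"
    and rep: "\<And>s \<tau> t. is_sign \<tau> \<Longrightarrow> \<bar>t\<bar> \<le> pi/2 \<Longrightarrow> rep_on X (\<lambda>t. u (side s \<tau> t)) t"
  shows "card (nodal_domains u) \<le> card (cc ` (grid X \<inter> nonzero u))"
proof (rule nodal_card_le)
  show "continuous_on csquare u" by (rule cont_u)
  show "finite (grid X \<inter> nonzero u)" using grid_card(1)[OF X(1,2)] by simp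
  fix z assume z: "z \<in> square" "u z \<noteq> 0"
  have "z \<in> nonzero u" using z by (auto simp: nonzero_def square_def)
  have "\<exists>q \<in> nonzero u - square. conn z q"
  \<comment> \<open>The second derivatives of \<open>A\<close> and \<open>Q\<close> are
    \<open>\<kappa> * A\<close> and \<open>- \<nu> * Q\<close>, so the Laplacian of \<open>u\<close>
    is \<open>(\<kappa> - \<nu>) * u\<close>.\<close>
  proof (rule reaches_boundary[where k = "\<kappa> - \<nu>" 
      and ux = "\<lambda>z. a * (A' (fst z) * Q (snd z)) + b * (Q' (fst z) * A (snd z))"
      and uxx = "\<lambda>z. a * (\<kappa> * A (fst z) * Q (snd z)) + b * (- \<nu> * Q (fst z) * A (snd z))"
      and uy = "\<lambda>z. a * (A (fst z) * Q' (snd z)) + b * (Q (fst z) * A' (snd z))"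
      and uyy = "\<lambda>z. a * (A (fst z) * (- \<nu> * Q (snd z))) + b * (Q (fst z) * (\<kappa> * A (snd z)))"])
    show "continuous_on UNIV u" by (rule cont_u)
  qed (use \<open>z \<in> nonzero u\<close> \<nu>\<kappa> in \<open>auto simp: u_def algebra_simps intro!: derivative_eq_intros dA dA' dQ dQ'\<close>)
  then obtain q where q: "q \<in> nonzero u" "q \<notin> square" "conn z q" by blast
  have "q \<in> csquare" using q(1) by (simp add: nonzero_def)
  then have "\<bar>fst q\<bar> \<le> pi/2" "\<bar>snd q\<bar> \<le> pi/2" unfolding csquare_iff by auto
  moreover have "\<bar>fst q\<bar> = pi/2 \<or> \<bar>snd q\<bar> = pi/2" using q(2) calculation by (auto simp: square_iff)
  moreover have "\<exists>\<tau>. is_sign \<tau> \<and> c = \<tau> * (pi/2)" if "\<bar>c\<bar> = pi/2" for c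
  proof -
    have "c = 1 * (pi/2) \<or> c = -1 * (pi/2)" using that by (auto simp: abs_if split: if_splits)
    then show ?thesis by blast
  qed
  ultimately obtain s \<tau> t where qs: "is_sign \<tau>" "\<bar>t\<bar> \<le> pi/2" "q = side s \<tau> t"
    unfolding side_def by (metis prod.collapse)
  have "\<exists>q'\<in>grid X. conn q q'"
  proof -
    obtain t' where t': "t' \<in> X" "\<And>r. r \<in> closed_segment t t' \<Longrightarrow> u (side s \<tau> r) \<noteq> 0"
    proof -
      have "u (side s \<tau> t) \<noteq> 0" using q(1) unfolding qs(3) nonzero_def by blast
      then show ?thesis using rep[OF qs(1,2), of s] that unfolding rep_on_def by blast
    qed
    have seg: "closed_segment t t' \<subseteq> {-pi/2..pi/2}"
      using qs(2) X(3) t'(1) by (intro closed_segment_subset) (auto simp: abs_le_iff)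
    have "conn (side s \<tau> t) (side s \<tau> t')"
    proof (rule conn_image[of "closed_segment t t'" "side s \<tau>"])
      show "continuous_on (closed_segment t t') (side s \<tau>)"
        unfolding side_def[abs_def] by (cases s) (auto intro!: continuous_intros)
      fix r assume r: "r \<in> closed_segment t t'"
      then have "r \<in> {-pi/2..pi/2}" using seg by blast
      then have "\<bar>r\<bar> \<le> pi/2" by (auto simp: abs_le_iff)
      then have "side s \<tau> r \<in> csquare" using qs(1) unfolding csquare_iff side_def by (auto simp: abs_mult)
      then show "side s \<tau> r \<in> csquare \<and> u (side s \<tau> r) \<noteq> 0" using t'(2)[OF r] by blast
    qed auto
    moreover have "side s \<tau> t' \<in> grid X" using t'(1) qs(1) by (auto simp: grid_def side_def)
    ultimately show ?thesis using qs(3) by blast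
  qed
  then obtain q' where q': "q' \<in> grid X" "conn q q'" by blast
  then have "q' \<in> nonzero u" using connected_component_in by blast
  then show "\<exists>q\<in>grid X \<inter> nonzero u. conn z q" using q' q(3) connected_component_trans by blast
qed

text \<open>Up to reflection \<open>u (x, y) = A x * A y * (a * g y + b * g x)\<close> with \<open>g = Q / A\<close> monotone on
  \<open>[\<xi>, \<pi>/2]\<close> and of opposite signs at the ends, so \<open>u\<close> has opposite signs at the corner
  and at the diagonal point \<open>(\<xi>, \<xi>)\<close>.\<close>

lemma corner:
  assumes \<xi>: "0 \<le> \<xi>" "\<xi> < pi/2" "A \<xi> > 0" and W: "\<forall>x\<in>{\<xi><..<pi/2}. W x \<noteq> 0"
    and \<zeta>: "\<xi> < \<zeta>" "\<zeta> < pi/2" "Q \<zeta> = 0"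
    and st: "is_sign \<sigma>" "is_sign \<tau>"
    and C: "u (\<sigma> * (pi/2), \<tau> * (pi/2)) \<noteq> 0"
  shows "u (\<sigma> * \<xi>, \<tau> * (pi/2)) \<noteq> 0 \<Longrightarrow>
      conn (\<sigma> * \<xi>, \<tau> * (pi/2)) (\<sigma> * (pi/2), \<tau> * (pi/2)) \<or> conn (\<sigma> * \<xi>, \<tau> * (pi/2)) (\<sigma> * \<xi>, \<tau> * \<xi>)"
    and "u (\<sigma> * (pi/2), \<tau> * \<xi>) \<noteq> 0 \<Longrightarrow>
      conn (\<sigma> * (pi/2), \<tau> * \<xi>) (\<sigma> * (pi/2), \<tau> * (pi/2)) \<or> conn (\<sigma> * (pi/2), \<tau> * \<xi>) (\<sigma> * \<xi>, \<tau> * \<xi>)"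
proof -
  define g where "g = (\<lambda>x. Q x / A x)"
  define e where "e = pi/2"
  have e: "\<xi> < e" "e > 0" using \<xi> by (auto simp: e_def)
  have gs: "g \<xi> * g e < 0"
    "\<And>x. x \<in> {\<xi>..e} \<Longrightarrow> g \<xi> \<le> g x \<and> g x \<le> g e \<or> g e \<le> g x \<and> g x \<le> g \<xi>"
    using segment_between[OF \<xi> W \<zeta>] unfolding g_def e_def by blast+
  have A0: "A x > 0" if "x \<in> {\<xi>..e}" for x
    using that \<xi> Apos[of x] by (cases "x = \<xi>") (auto simp: e_def)
  obtain a' b' where r: "\<And>x y. u (\<sigma> * x, \<tau> * y) = a' * (A x * Q y) + b' * (Q x * A y)"
    using u_reflect[OF st] by blast
  have u: "u (\<sigma> * x, \<tau> * y) = A x * A y * (a' * g y + b' * g x)" if "x \<in> {\<xi>..e}" "y \<in> {\<xi>..e}" for x y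
  proof -
    have "Q x = A x * g x" "Q y = A y * g y" using A0[OF that(1)] A0[OF that(2)] by (simp_all add: g_def)
    then show ?thesis by (simp add: r algebra_simps)
  qed
  have u0: "u (\<sigma> * x, \<tau> * y) \<noteq> 0 \<longleftrightarrow> a' * g y + b' * g x \<noteq> 0" if "x \<in> {\<xi>..e}" "y \<in> {\<xi>..e}" for x y
    using u[OF that] A0[OF that(1)] A0[OF that(2)] by simp
  have ends: "\<xi> \<in> {\<xi>..e}" "e \<in> {\<xi>..e}" using e by auto
  have sq: "(\<sigma> * x, \<tau> * y) \<in> csquare" if "x \<in> {\<xi>..e}" "y \<in> {\<xi>..e}" for x y
    using that st \<xi>(1) by (auto simp: csquare_iff e_def abs_mult)
  have C': "(a' + b') * g e \<noteq> 0" using C[folded e_def] u0[OF ends(2) ends(2)] by (simp add: distrib_right)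
  have H: "conn (\<sigma> * x1, \<tau> * y) (\<sigma> * x2, \<tau> * y)"
    if y: "y \<in> {\<xi>..e}" and xs: "{x1, x2} = {\<xi>, e}" and pos: "(a' * g y + b' * g x1) * (a' * g y + b' * g x2) > 0" for x1 x2 y
  proof (rule conn_image[of "{\<xi>..e}" "\<lambda>t. (\<sigma> * t, \<tau> * y)"])
    show "x1 \<in> {\<xi>..e}" "x2 \<in> {\<xi>..e}" using xs ends by (metis insertI1 insertI2 insertE singletonD)+
    fix t assume t: "t \<in> {\<xi>..e}"
    have "g x1 \<le> g t \<and> g t \<le> g x2 \<or> g x2 \<le> g t \<and> g t \<le> g x1" using gs(2)[OF t] xs e by (auto simp: doubleton_eq_iff)
    then have "a' * g y + b' * g t \<noteq> 0" using affine_between pos by blast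
    then show "(\<sigma> * t, \<tau> * y) \<in> csquare \<and> u (\<sigma> * t, \<tau> * y) \<noteq> 0" using u0[OF t y] sq[OF t y] by blast
  qed (auto intro!: continuous_intros)
  have V: "conn (\<sigma> * x, \<tau> * y1) (\<sigma> * x, \<tau> * y2)"
    if x: "x \<in> {\<xi>..e}" and ys: "{y1, y2} = {\<xi>, e}" and pos: "(b' * g x + a' * g y1) * (b' * g x + a' * g y2) > 0" for y1 y2 x
  proof (rule conn_image[of "{\<xi>..e}" "\<lambda>t. (\<sigma> * x, \<tau> * t)"])
    show "y1 \<in> {\<xi>..e}" "y2 \<in> {\<xi>..e}" using ys ends by (metis insertI1 insertI2 insertE singletonD)+
    fix t assume t: "t \<in> {\<xi>..e}"
    have "g y1 \<le> g t \<and> g t \<le> g y2 \<or> g y2 \<le> g t \<and> g t \<le> g y1" using gs(2)[OF t] ys e by (auto simp: doubleton_eq_iff)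
    then have "b' * g x + a' * g t \<noteq> 0" using affine_between pos by blast
    then show "(\<sigma> * x, \<tau> * t) \<in> csquare \<and> u (\<sigma> * x, \<tau> * t) \<noteq> 0"
      using u0[OF x t] sq[OF x t] by (simp add: add.commute)
  qed (auto intro!: continuous_intros)
  \<comment> \<open>Up to positive factors the two right-hand values are those of \<open>u\<close>
    at the corner and at the diagonal point. As they have opposite signs, the nonzero value
    \<open>v\<close> at a neighbouring vertex agrees in sign with one of them, and
    \<open>affine_between\<close> joins the two along the edge.\<close>
  have opp: "v * ((a' + b') * g e) > 0 \<or> v * ((a' + b') * g \<xi>) > 0" if "v \<noteq> 0" for v
  proof -
    have "(a' + b') \<noteq> 0" using C' by simp
    then have "((a' + b') * g \<xi>) * ((a' + b') * g e) < 0"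
      using gs(1) by (metis (no_types, opaque_lifting) mult.assoc mult.left_commute mult_less_0_iff mult_pos_neg not_square_less_zero zero_less_mult_iff linorder_neqE_linordered_idom)
    then show ?thesis using that by (auto simp: mult_less_0_iff zero_less_mult_iff)
  qed
  show "conn (\<sigma> * \<xi>, \<tau> * (pi/2)) (\<sigma> * (pi/2), \<tau> * (pi/2)) \<or> conn (\<sigma> * \<xi>, \<tau> * (pi/2)) (\<sigma> * \<xi>, \<tau> * \<xi>)"
    if "u (\<sigma> * \<xi>, \<tau> * (pi/2)) \<noteq> 0"
    unfolding e_def[symmetric]
    using opp[of "a' * g e + b' * g \<xi>"] u0[OF ends] that[folded e_def] H[OF ends(2), of \<xi> e] V[OF ends(1), of e \<xi>]
    by (auto simp: algebra_simps)
  show "conn (\<sigma> * (pi/2), \<tau> * \<xi>) (\<sigma> * (pi/2), \<tau> * (pi/2)) \<or> conn (\<sigma> * (pi/2), \<tau> * \<xi>) (\<sigma> * \<xi>, \<tau> * \<xi>)"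
    if "u (\<sigma> * (pi/2), \<tau> * \<xi>) \<noteq> 0"
    unfolding e_def[symmetric]
    using opp[of "a' * g \<xi> + b' * g e"] u0[OF ends(2,1)] that[folded e_def] V[OF ends(2), of \<xi> e] H[OF ends(1), of e \<xi>]
    by (auto simp: algebra_simps)
qed

text \<open>At each corner the corner point and its two neighbours in the grid form a triple. If no
  neighbour is joined to the corner, \<open>corner\<close> joins both to the diagonal point and so
  to each other; in any case the triple meets at most two components. The four triples are disjoint
  as \<open>\<xi> > 0\<close>.\<close>

lemma card_nodal_corners:
  assumes \<xi>: "0 < \<xi>" "\<xi> < pi/2" "A \<xi> > 0" and W: "\<forall>x\<in>{\<xi><..<pi/2}. W x \<noteq> 0"
    and \<zeta>: "\<xi> < \<zeta>" "\<zeta> < pi/2" "Q \<zeta> = 0"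
    and X: "finite X" "{-pi/2, pi/2} \<subseteq> X" "{-\<xi>, \<xi>} \<subseteq> X"
  shows "card (cc ` (grid X \<inter> nonzero u)) + 4 \<le> card (grid X)"
proof -
  define I where "I = {1, -1 :: real} \<times> {1, -1 :: real}"
  define T where "T = (\<lambda>(\<sigma>, \<tau>). {(\<sigma> * \<xi>, \<tau> * (pi/2)), (\<sigma> * (pi/2), \<tau> * (pi/2)), (\<sigma> * (pi/2), \<tau> * \<xi>)})"
  have "card (cc ` (grid X \<inter> nonzero u)) + card I \<le> card (grid X)"
  proof (rule card_image_triples[where T = T])
    show "finite (grid X)" using grid_card(1)[OF X(1,2)] .
    show "finite I" by (simp add: I_def)
    show "disjoint_family_on T I" unfolding disjoint_family_on_def I_def T_def using \<xi> by auto
    fix i assume "i \<in> I"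
    then obtain \<sigma> \<tau> where i: "i = (\<sigma>, \<tau>)" and st: "is_sign \<sigma>" "is_sign \<tau>" by (auto simp: I_def)
    show "T i \<subseteq> grid X" using X st by (auto simp: i T_def grid_def)
    show "card (T i) = 3" using st \<xi> by (auto simp: i T_def card_insert_if)
    let ?T = "(\<sigma> * \<xi>, \<tau> * (pi/2))" and ?C = "(\<sigma> * (pi/2), \<tau> * (pi/2))" and ?R = "(\<sigma> * (pi/2), \<tau> * \<xi>)"
    have two: "card (cc ` (T i \<inter> nonzero u)) \<le> 2" if "cc ` (T i \<inter> nonzero u) \<subseteq> {x, y}" for x y
    proof -
      have "card (cc ` (T i \<inter> nonzero u)) \<le> card {x, y}" by (rule card_mono[OF _ that]) simp
      also have "\<dots> \<le> 2" by (simp add: card_insert_if)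
      finally show ?thesis .
    qed
    show "card (cc ` (T i \<inter> nonzero u)) \<le> 2"
    proof (cases "u ?T \<noteq> 0 \<and> u ?C \<noteq> 0 \<and> u ?R \<noteq> 0")
      case False
      then consider "?T \<notin> nonzero u" | "?C \<notin> nonzero u" | "?R \<notin> nonzero u" by (auto simp: nonzero_def)
      then show ?thesis
      proof cases
        case 1
        then show ?thesis by (intro two[of "cc ?C" "cc ?R"]) (auto simp: i T_def)
      next
        case 2
        then show ?thesis by (intro two[of "cc ?T" "cc ?R"]) (auto simp: i T_def)
      next
        case 3
        then show ?thesis by (intro two[of "cc ?C" "cc ?T"]) (auto simp: i T_def)
      qed
    next
      case True
      note c = corner[OF less_imp_le[OF \<xi>(1)] \<xi>(2,3) W \<zeta> st]
      have "conn ?T ?C \<or> conn ?R ?C \<or> conn ?T ?R"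
        using c True by (meson connected_component_sym connected_component_trans)
      then consider "cc ?T = cc ?C" | "cc ?R = cc ?C" | "cc ?T = cc ?R"
        using cc_eq by blast
      then show ?thesis
      proof cases
        case 1
        then show ?thesis by (intro two[of "cc ?C" "cc ?R"]) (auto simp: i T_def)
      next
        case 2
        then show ?thesis by (intro two[of "cc ?C" "cc ?T"]) (auto simp: i T_def)
      next
        case 3
        then show ?thesis by (intro two[of "cc ?C" "cc ?R"]) (auto simp: i T_def)
      qed
    qed
  qed
  then show ?thesis by (simp add: I_def card_cartesian_product)
qed

end

section \<open>Representatives of the sign intervals on a side\<close>

lemma rep_on_mono: "rep_on X w x \<Longrightarrow> X \<subseteq> Y \<Longrightarrow> rep_on Y w x"
  unfolding rep_on_def by blast

lemma card_le2:
  assumes "S \<subseteq> {x, y}" shows "card S \<le> 2"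
proof -
  have "card S \<le> card {x, y}" by (rule card_mono[OF _ assms]) simp
  also have "\<dots> \<le> 2" by (simp add: card_insert_if)
  finally show ?thesis .
qed

context nodal_pair
begin

lemma dA_minus: "A' (- x) = - sA * A' x"
proof -
  have "((\<lambda>x. A (- x)) has_real_derivative - A' (- x)) (at x)"
  proof -
    have "((\<lambda>x. - x) has_real_derivative -1) (at x)" by (auto intro!: derivative_eq_intros)
    from DERIV_chain2[OF dA this] show ?thesis by simp
  qed
  moreover have "((\<lambda>x. A (- x)) has_real_derivative sA * A' x) (at x)"
    unfolding sA(2) by (intro DERIV_cmult dA)
  ultimately have "- A' (- x) = sA * A' x" by (rule DERIV_unique)
  then show ?thesis by simp
qed

lemma dQ_minus: "Q' (- x) = - sQ * Q' x"
proof -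
  have "((\<lambda>x. Q (- x)) has_real_derivative - Q' (- x)) (at x)"
  proof -
    have "((\<lambda>x. - x) has_real_derivative -1) (at x)" by (auto intro!: derivative_eq_intros)
    from DERIV_chain2[OF dQ this] show ?thesis by simp
  qed
  moreover have "((\<lambda>x. Q (- x)) has_real_derivative sQ * Q' x) (at x)"
    unfolding sQ(2) by (intro DERIV_cmult dQ)
  ultimately have "- Q' (- x) = sQ * Q' x" by (rule DERIV_unique)
  then show ?thesis by simp
qed

lemma W_minus: "W (- x) = 0 \<longleftrightarrow> W x = 0"
proof -
  have "W (- x) = - (sA * sQ) * W x"
    by (simp add: W_def dA_minus dQ_minus sA(2) sQ(2) algebra_simps)
  then show ?thesis using sA(1) sQ(1) by auto
qed

lemma W_card:
  assumes "finite Z" "\<And>x. l < x \<Longrightarrow> x < r \<Longrightarrow> Q x = 0 \<or> A x = 0 \<Longrightarrow> x \<in> Z"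
  shows "finite {x \<in> {l..r}. W x = 0}" "card {x \<in> {l..r}. W x = 0} \<le> Suc (card Z)"
  using rolle_card[OF dW assms(1), of l r] assms(2) unfolding dW0 by auto

lemma W_rolle:
  assumes "s < t" "W s = 0" "W t = 0" "\<And>x. s < x \<Longrightarrow> x < t \<Longrightarrow> A x \<noteq> 0"
  obtains \<zeta> where "s < \<zeta>" "\<zeta> < t" "Q \<zeta> = 0"
proof -
  have "continuous_on {s..t} W" by (rule DERIV_continuous_on) (rule has_field_derivative_at_within[OF dW])
  moreover have "W differentiable (at x)" for x using dW real_differentiable_def by blast
  ultimately obtain z where z: "s < z" "z < t" "(W has_real_derivative 0) (at z)"
    using Rolle[OF assms(1), of W] assms(2,3) by auto
  then have "- (\<kappa> + \<nu>) * (Q z * A z) = 0" using DERIV_unique[OF dW] by blast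
  then have "Q z = 0" using assms(4) z unfolding dW0 by blast
  then show ?thesis using that z by blast
qed

text \<open>A sign interval that reaches an end is represented by that end, where \<open>W\<close>
  vanishes by the Robin condition; one between two zeros is represented by the zero of
  \<open>W\<close> from \<open>comb_rolle\<close>.\<close>

lemma rep_positive:
  assumes pos: "\<And>x. \<bar>x\<bar> \<le> pi/2 \<Longrightarrow> A x \<noteq> 0" and c: "c1 \<noteq> 0 \<or> c2 \<noteq> 0" and x: "\<bar>x\<bar> \<le> pi/2"
  shows "rep_on {x \<in> {-pi/2..pi/2}. W x = 0} (\<lambda>x. c1 * A x + c2 * Q x) x"
  unfolding rep_on_def
proof
  let ?w = "\<lambda>x. c1 * A x + c2 * Q x"
  assume nz: "?w x \<noteq> 0"
  have x': "x \<in> {-pi/2..pi/2}" using x by (auto simp: abs_le_iff)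
  have We: "W (-pi/2) = 0" using W_minus[of "pi/2"] W_end by simp
  show "\<exists>x'\<in>{x \<in> {-pi/2..pi/2}. W x = 0}. \<forall>t\<in>closed_segment x x'. ?w t \<noteq> 0"
  proof -
    consider (right) "\<forall>t\<in>{x..pi/2}. ?w t \<noteq> 0" | (left) "\<forall>t\<in>{-pi/2..x}. ?w t \<noteq> 0"
      | (gap) z1 z2 where "-pi/2 \<le> z1" "z1 < x" "x < z2" "z2 \<le> pi/2" "?w z1 = 0" "?w z2 = 0"
          "\<forall>t\<in>{z1<..<z2}. ?w t \<noteq> 0"
      using zero_gap[OF comb_cont x' nz] by blast
    then show ?thesis
  proof cases
    case right
    then show ?thesis using x' W_end by (intro bexI[of _ "pi/2"]) (auto simp: closed_segment_eq_real_ivl)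
  next
    case left
    then show ?thesis using x' We by (intro bexI[of _ "-pi/2"]) (auto simp: closed_segment_eq_real_ivl)
  next
    case (gap z1 z2)
    have "A s \<noteq> 0" if "s \<in> {z1..z2}" for s
    proof -
      have "- (pi/2) \<le> s" "s \<le> pi/2" using that gap by auto
      then show ?thesis by (intro pos) (simp add: abs_le_iff)
    qed
    then obtain t where t: "z1 < t" "t < z2" "W t = 0"
      using comb_rolle[OF less_trans[OF gap(2,3)] _ gap(5,6) c] by blast
    have "s \<in> {z1<..<z2}" if "s \<in> closed_segment x t" for s
      using that gap t by (auto simp: closed_segment_eq_real_ivl split: if_splits)
    moreover have "t \<in> {-pi/2..pi/2}" using t gap by simp
    ultimately show ?thesis using gap t(3) by (intro bexI[of _ t]) auto
  qed
qed
qed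

text \<open>An odd \<open>A\<close> vanishes at 0, so Rolle's theorem for \<open>Q / A\<close> is
  available only away from 0. The alternatives \<open>left\<close> and \<open>zero\<close> describe
  the sign interval next to 0, which the later cases treat by hand.\<close>

lemma rep_half:
  assumes c: "c1 \<noteq> 0 \<or> c2 \<noteq> 0" and x: "0 \<le> x" "x \<le> pi/2" and nz: "c1 * A x + c2 * Q x \<noteq> 0"
  obtains (node) "rep_on {x \<in> {0<..pi/2}. W x = 0} (\<lambda>x. c1 * A x + c2 * Q x) x"
    | (left) "\<And>t. 0 \<le> t \<Longrightarrow> t \<le> x \<Longrightarrow> c1 * A t + c2 * Q t \<noteq> 0"
    | (zero) "c1 * A 0 + c2 * Q 0 = 0" "0 < x" "\<And>t. 0 < t \<Longrightarrow> t \<le> x \<Longrightarrow> c1 * A t + c2 * Q t \<noteq> 0"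
        "\<exists>t. x < t \<and> t \<le> pi/2 \<and> c1 * A t + c2 * Q t = 0"
proof -
  let ?w = "\<lambda>x. c1 * A x + c2 * Q x"
  have x': "x \<in> {0..pi/2}" using x by auto
  show ?thesis
  proof -
    consider (right) "\<forall>t\<in>{x..pi/2}. ?w t \<noteq> 0" | (left) "\<forall>t\<in>{0..x}. ?w t \<noteq> 0"
      | (gap) z1 z2 where "0 \<le> z1" "z1 < x" "x < z2" "z2 \<le> pi/2" "?w z1 = 0" "?w z2 = 0"
          "\<forall>t\<in>{z1<..<z2}. ?w t \<noteq> 0"
      using zero_gap[OF comb_cont x' nz] by blast
    then show ?thesis
  proof cases
    case right
    have "pi/2 \<in> {x \<in> {0<..pi/2}. W x = 0}" using W_end by auto
    then have "rep_on {x \<in> {0<..pi/2}. W x = 0} ?w x" unfolding rep_on_def using x' right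
      by (intro impI bexI[of _ "pi/2"]) (auto simp: closed_segment_eq_real_ivl)
    then show ?thesis by (rule node)
  next
    case left
    then show ?thesis by (intro that(2)) auto
  next
    case (gap z1 z2)
    show ?thesis
    proof (cases "z1 = 0")
      case True
      show ?thesis
      proof (rule zero)
        show "?w 0 = 0" using gap True by simp
        show "0 < x" using gap True by simp
        show "?w t \<noteq> 0" if "0 < t" "t \<le> x" for t using gap(7) that gap True by simp
        show "\<exists>t. x < t \<and> t \<le> pi/2 \<and> ?w t = 0" using gap by blast
      qed
    next
      case False
      then have "0 < z1" using gap by simp
      then have "A s \<noteq> 0" if "s \<in> {z1..z2}" for s using Apos[of s] that gap by force
      then obtain t where t: "z1 < t" "t < z2" "W t = 0"
        using comb_rolle[OF less_trans[OF gap(2,3)] _ gap(5,6) c] by blast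
      have "s \<in> {z1<..<z2}" if "s \<in> closed_segment x t" for s
        using that gap t by (auto simp: closed_segment_eq_real_ivl split: if_splits)
      moreover have "t \<in> {x \<in> {0<..pi/2}. W x = 0}" using t gap \<open>0 < z1\<close> by auto
      ultimately have "rep_on {x \<in> {0<..pi/2}. W x = 0} ?w x"
        unfolding rep_on_def using gap by blast
      then show ?thesis by (rule node)
    qed
  qed
qed
qed

text \<open>Two zeros before the first positive zero \<open>r\<close> of \<open>W\<close> would
  enclose another zero of \<open>W\<close>, so there is at most one, and none close to 0.\<close>

lemma comb_eventually:
  assumes c: "c1 \<noteq> 0 \<or> c2 \<noteq> 0" and fin: "finite {x \<in> {0<..pi/2}. W x = 0}"
  shows "\<forall>\<^sub>F t in at_right 0. c1 * A t + c2 * Q t \<noteq> 0"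
proof -
  let ?w = "\<lambda>x. c1 * A x + c2 * Q x"
  define r where "r = Min {x \<in> {0<..pi/2}. W x = 0}"
  have ne: "{x \<in> {0<..pi/2}. W x = 0} \<noteq> {}"
  proof -
    have "pi/2 \<in> {x \<in> {0<..pi/2}. W x = 0}" using W_end by simp
    then show ?thesis by blast
  qed
  have "r \<in> {x \<in> {0<..pi/2}. W x = 0}" unfolding r_def by (rule Min_in[OF fin ne])
  then have r: "0 < r" "r \<le> pi/2" by auto
  have nW: "W t \<noteq> 0" if "0 < t" "t < r" for t
  proof
    assume "W t = 0"
    then have "r \<le> t" unfolding r_def using that r by (intro Min_le fin) auto
    then show False using that by simp
  qed
  have uniq: "s = t" if "0 < s" "s < r" "?w s = 0" "0 < t" "t < r" "?w t = 0" for s t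
  proof -
    have "\<not> x < y" if h: "0 < x" "?w x = 0" "y < r" "?w y = 0" for x y
    proof
      assume "x < y"
      moreover have "A z \<noteq> 0" if "z \<in> {x..y}" for z using Apos[of z] that \<open>0 < x\<close> \<open>y < r\<close> r by force
      ultimately obtain z where "x < z" "z < y" "W z = 0" using comb_rolle[OF \<open>x < y\<close> _ h(2,4) c] by blast
      then show False using nW[of z] that by simp
    qed
    then show ?thesis using that by (meson linorder_neqE_linordered_idom)
  qed
  have "\<exists>b>0. \<forall>t>0. t < b \<longrightarrow> ?w t \<noteq> 0"
  proof (cases "\<exists>s. 0 < s \<and> s < r \<and> ?w s = 0")
    case True
    then obtain s where "0 < s" "s < r" "?w s = 0" by blast
    then show ?thesis using uniq[of s] by (intro exI[of _ s]) force
  next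
    case False
    then show ?thesis using r by (intro exI[of _ r]) auto
  qed
  then show ?thesis by (simp add: eventually_at_right_field)
qed

end

context nodal_form
begin

text \<open>Here \<open>u\<close> has constant sign on each of the four half-axes, and near the origin it
  behaves like a linear form that joins them in pairs.\<close>

lemma card_axis:
  assumes odd: "sA = -1" and even: "sQ = 1" and Q0: "Q 0 > 0"
  shows "card (cc ` ({(0, pi/2), (0, -pi/2), (pi/2, 0), (-pi/2, 0)} \<inter> nonzero u)) \<le> 2"
proof -
  have A0: "A 0 = 0" using sA(2)[of 0] odd by simp
  have Q0ne: "Q 0 \<noteq> 0" using Q0 by simp
  have Am: "A (- x) = - A x" "Q (- x) = Q x" for x using sA(2) sQ(2) odd even by auto
  obtain d where d: "0 < d" "d < pi/2" "\<And>x. 0 \<le> x \<Longrightarrow> x \<le> d \<Longrightarrow> Q x > 0"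
  proof -
    have "isCont Q 0" using dQ DERIV_isCont by blast
    then have "\<forall>\<^sub>F x in nhds 0. Q x > 0"
      using order_tendstoD(1)[OF _ Q0] by (metis isCont_def tendsto_at_iff_tendsto_nhds)
    then obtain e where e: "e > 0" "\<And>x. dist x 0 < e \<Longrightarrow> Q x > 0" unfolding eventually_nhds_metric by blast
    have "0 < min (e/2) (pi/4)" "min (e/2) (pi/4) < pi/2"
      using e pi_gt_zero by (simp, intro min.strict_coboundedI2, simp)
    moreover have "Q x > 0" if "0 \<le> x" "x \<le> min (e/2) (pi/4)" for x using that e by (auto simp: dist_real_def)
    ultimately show ?thesis using that by blast
  qed
  have u0: "u (x, 0) = a * (A x * Q 0)" "u (0, x) = b * (Q 0 * A x)" for x by (simp_all add: u_def A0)
  consider "a = 0" | "b = 0" | "a \<noteq> 0" "b \<noteq> 0" by blast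
  then show ?thesis
  proof cases
    case 1
    have "u (x, 0) = 0" for x using u0(1)[of x] 1 by simp
    then have "(pi/2, 0) \<notin> nonzero u" "(-pi/2, 0) \<notin> nonzero u" by (simp_all add: nonzero_def)
    then have "cc ` ({(0, pi/2), (0, -pi/2), (pi/2, 0), (-pi/2, 0)} \<inter> nonzero u) \<subseteq> {cc (0, pi/2), cc (0, -pi/2)}" by blast
    then show ?thesis by (rule card_le2)
  next
    case 2
    have "u (0, x) = 0" for x using u0(2)[of x] 2 by simp
    then have "(0, pi/2) \<notin> nonzero u" "(0, -pi/2) \<notin> nonzero u" by (simp_all add: nonzero_def)
    then have "cc ` ({(0, pi/2), (0, -pi/2), (pi/2, 0), (-pi/2, 0)} \<inter> nonzero u) \<subseteq> {cc (pi/2, 0), cc (-pi/2, 0)}" by blast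
    then show ?thesis by (rule card_le2)
  next
    case 3
    have C: "conn (\<sigma> * (pi/2), 0) (0, \<tau> * (pi/2))"
      if st: "is_sign \<sigma>" "is_sign \<tau>" and pos: "(a * \<sigma>) * (b * \<tau>) > 0" for \<sigma> \<tau>
    proof -
      have uf: "u (\<sigma> * x, \<tau> * y) = a * \<sigma> * (A x * Q y) + b * \<tau> * (Q x * A y)" for x y
      proof -
        have "A (\<rho> * x) = \<rho> * A x \<and> Q (\<rho> * x) = Q x" if "is_sign \<rho>" for \<rho> x
          using that Am[of x] by (elim disjE) simp_all
        then show ?thesis using st by (simp add: u_def)
      qed
      have ad: "A d > 0" using Apos[of d] d by simp
      have hor: "conn (\<sigma> * (pi/2), \<tau> * 0) (\<sigma> * d, \<tau> * 0)"
      proof (rule conn_image[of "{d..pi/2}" "\<lambda>t. (\<sigma> * t, \<tau> * 0)"])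
        fix t assume t: "t \<in> {d..pi/2}"
        then have "A t > 0" using Apos[of t] d by simp
        then show "(\<sigma> * t, \<tau> * 0) \<in> csquare \<and> u (\<sigma> * t, \<tau> * 0) \<noteq> 0"
          unfolding uf csquare_iff using t st d Q0ne A0 3 by (auto simp: abs_mult)
      qed (use d in \<open>auto intro!: continuous_intros\<close>)
      have ver: "conn (\<sigma> * 0, \<tau> * d) (\<sigma> * 0, \<tau> * (pi/2))"
      proof (rule conn_image[of "{d..pi/2}" "\<lambda>t. (\<sigma> * 0, \<tau> * t)"])
        fix t assume t: "t \<in> {d..pi/2}"
        then have "A t > 0" using Apos[of t] d by simp
        then show "(\<sigma> * 0, \<tau> * t) \<in> csquare \<and> u (\<sigma> * 0, \<tau> * t) \<noteq> 0"
          unfolding uf csquare_iff using t st d Q0ne A0 3 by (auto simp: abs_mult)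
      qed (use d in \<open>auto intro!: continuous_intros\<close>)
      \<comment> \<open>The segment cuts across the quadrant near the origin, where
        \<open>Q > 0\<close>. Both terms of \<open>u\<close> carry the common sign of
        \<open>a * \<sigma>\<close> and \<open>b * \<tau>\<close> there and do not vanish
        together.\<close>
      have "conn (\<sigma> * (d - 0), \<tau> * 0) (\<sigma> * (d - d), \<tau> * d)"
      proof (rule conn_image[of "{0..d}" "\<lambda>t. (\<sigma> * (d - t), \<tau> * t)"])
        fix t assume t: "t \<in> {0..d}"
        have q: "Q t > 0" "Q (d - t) > 0" using d(3) t by auto
        have "A t \<ge> 0 \<and> A (d - t) \<ge> 0 \<and> (A t > 0 \<or> A (d - t) > 0)"
          using Apos[of t] Apos[of "d - t"] A0 t d ad by (cases "t = 0"; cases "t = d") auto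
        then have "A (d - t) * Q t \<ge> 0 \<and> Q (d - t) * A t \<ge> 0 \<and> (A (d - t) * Q t > 0 \<or> Q (d - t) * A t > 0)"
          using q by auto
        moreover have "r * X + s * Y \<noteq> 0" if "r * s > 0" "X \<ge> 0 \<and> Y \<ge> 0 \<and> (X > 0 \<or> Y > 0)" for r s X Y :: real
        proof -
          have "r * (r * X + s * Y) = r\<^sup>2 * X + (r * s) * Y" by (simp add: algebra_simps power2_eq_square)
          moreover have "r\<^sup>2 > 0" using that(1) by auto
          ultimately have "r * (r * X + s * Y) > 0" using that
            by (metis add_nonneg_pos add_pos_nonneg less_imp_le mult_nonneg_nonneg mult_pos_pos)
          then show ?thesis by auto
        qed
        ultimately have "u (\<sigma> * (d - t), \<tau> * t) \<noteq> 0" unfolding uf using pos by blast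
        moreover have "\<bar>\<sigma> * (d - t)\<bar> \<le> pi/2" "\<bar>\<tau> * t\<bar> \<le> pi/2" using st t d by auto
        ultimately show "(\<sigma> * (d - t), \<tau> * t) \<in> csquare \<and> u (\<sigma> * (d - t), \<tau> * t) \<noteq> 0"
          unfolding csquare_iff by simp
      qed (use d in \<open>auto intro!: continuous_intros\<close>)
      then show ?thesis using hor ver unfolding mult_zero_right diff_zero diff_self
        by (meson connected_component_trans)
    qed
    \<comment> \<open>The positive horizontal half-axis is joined to the vertical one of sign
      \<open>\<tau>\<close>, and the negative one to the opposite vertical half-axis.\<close>
    have "\<exists>\<tau>. (\<tau> = 1 \<or> \<tau> = -1) \<and> a * (b * \<tau>) > 0"
      using 3 by (cases "a * b > 0") (auto simp: not_less le_less intro: exI[of _ 1] exI[of _ "-1"])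
    then obtain \<tau> :: real where t: "is_sign \<tau>" "a * (b * \<tau>) > 0" by blast
    have "conn (1 * (pi/2), 0) (0, \<tau> * (pi/2))" using t by (intro C) auto
    from cc_eq[OF this] have "cc (pi/2, 0) = cc (0, \<tau> * (pi/2))" by simp
    moreover have "conn (-1 * (pi/2), 0) (0, - \<tau> * (pi/2))" using t by (intro C) auto
    from cc_eq[OF this] have "cc (-pi/2, 0) = cc (0, - \<tau> * (pi/2))" by simp
    ultimately have "cc ` ({(0, pi/2), (0, -pi/2), (pi/2, 0), (-pi/2, 0)} \<inter> nonzero u) \<subseteq> {cc (0, pi/2), cc (0, -pi/2)}"
      using t(1) by auto
    then show ?thesis by (rule card_le2)
  qed
qed

text \<open>The grid consists of the corners and the midpoints of the sides. With
  \<open>\<xi> = 0\<close> the diagonal point of every corner is the origin, so each midpoint where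
  \<open>u\<close> is nonzero joins a corner or the origin: four components and one more. If
  \<open>u\<close> vanishes at one corner it does so at all of them by symmetry, and only the
  midpoints remain.\<close>

lemma card_two:
  assumes even: "sA = 1" "sQ = 1" and A0: "A 0 > 0"
    and W: "\<forall>x\<in>{0<..<pi/2}. W x \<noteq> 0" and \<zeta>: "0 < \<zeta>" "\<zeta> < pi/2" "Q \<zeta> = 0"
  shows "card (cc ` (grid {-pi/2, 0, pi/2} \<inter> nonzero u)) \<le> 5"
proof -
  let ?e = "pi/2"
  let ?C = "{cc (?e, ?e), cc (?e, - ?e), cc (- ?e, ?e), cc (- ?e, - ?e)}"
  let ?K = "cc ` (grid {-pi/2, 0, pi/2} \<inter> nonzero u)"
  have sym: "u (\<sigma> * x, \<tau> * y) = u (x, y)" if "is_sign \<sigma>" "is_sign \<tau>" for \<sigma> \<tau> x y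
    using that sA(2) sQ(2) even by (auto simp: u_def)
  have sgn: "u (- ?e, ?e) = u (?e, ?e)" "u (?e, - ?e) = u (?e, ?e)" "u (- ?e, - ?e) = u (?e, ?e)"
      "u (0, - ?e) = u (0, ?e)" "u (- ?e, 0) = u (?e, 0)"
    using sym[of "-1" 1 ?e ?e] sym[of 1 "-1" ?e ?e] sym[of "-1" "-1" ?e ?e] sym[of 1 "-1" 0 ?e] sym[of "-1" 1 ?e 0] by simp_all
  have grid: "grid {-pi/2, 0, pi/2} = {(?e, ?e), (?e, - ?e), (- ?e, ?e), (- ?e, - ?e), (0, ?e), (0, - ?e), (?e, 0), (- ?e, 0)}"
    unfolding grid_def by auto
  have le: "card ?K \<le> card F" if "?K \<subseteq> F" "finite F" for F using card_mono that by blast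
  have c4: "card {w, x, y, z} \<le> 4" for w x y z :: "(real \<times> real) set" by (simp add: card_insert_if)
  have c5: "card {v, w, x, y, z} \<le> 5" for v w x y z :: "(real \<times> real) set" by (simp add: card_insert_if)
  show ?thesis
  proof (cases "u (?e, ?e) = 0")
    case True
    then have "?K \<subseteq> {cc (0, ?e), cc (0, - ?e), cc (?e, 0), cc (- ?e, 0)}"
      unfolding grid by (auto simp: nonzero_def sgn)
    from le[OF this] show ?thesis using c4[of "cc (0, ?e)" "cc (0, - ?e)" "cc (?e, 0)" "cc (- ?e, 0)"] by simp
  next
    case False
    have cor: "u (0, ?e) = 0 \<or> conn (\<sigma> * 0, \<tau> * ?e) (\<sigma> * ?e, \<tau> * ?e) \<or> conn (\<sigma> * 0, \<tau> * ?e) (\<sigma> * 0, \<tau> * 0)"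
       "u (?e, 0) = 0 \<or> conn (\<sigma> * ?e, \<tau> * 0) (\<sigma> * ?e, \<tau> * ?e) \<or> conn (\<sigma> * ?e, \<tau> * 0) (\<sigma> * 0, \<tau> * 0)"
      if "is_sign \<sigma>" "is_sign \<tau>" for \<sigma> \<tau>
    proof -
      have "u (\<sigma> * ?e, \<tau> * ?e) \<noteq> 0" using False sym[OF that, of ?e ?e] by argo
      note k = corner[OF order_refl pi_half_gt_zero A0 W \<zeta> that this]
      show "u (0, ?e) = 0 \<or> conn (\<sigma> * 0, \<tau> * ?e) (\<sigma> * ?e, \<tau> * ?e) \<or> conn (\<sigma> * 0, \<tau> * ?e) (\<sigma> * 0, \<tau> * 0)"
        using k(1) sym[OF that, of 0 ?e] by argo
      show "u (?e, 0) = 0 \<or> conn (\<sigma> * ?e, \<tau> * 0) (\<sigma> * ?e, \<tau> * ?e) \<or> conn (\<sigma> * ?e, \<tau> * 0) (\<sigma> * 0, \<tau> * 0)"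
        using k(2) sym[OF that, of ?e 0] by argo
    qed
    have top: "cc (0, \<tau> * ?e) = cc (0, 0) \<or> cc (0, \<tau> * ?e) = cc (\<sigma> * ?e, \<tau> * ?e)"
      if st: "is_sign \<sigma>" "is_sign \<tau>" and nz: "u (0, \<tau> * ?e) \<noteq> 0" for \<sigma> \<tau>
    proof -
      have "u (0, ?e) \<noteq> 0" using nz sym[OF st, of 0 ?e] by simp
      then have "cc (\<sigma> * 0, \<tau> * ?e) = cc (\<sigma> * ?e, \<tau> * ?e) \<or> cc (\<sigma> * 0, \<tau> * ?e) = cc (\<sigma> * 0, \<tau> * 0)"
        using cor(1)[OF st] cc_eq by blast
      then show ?thesis unfolding mult_zero_right by blast
    qed
    have right: "cc (\<sigma> * ?e, 0) = cc (0, 0) \<or> cc (\<sigma> * ?e, 0) = cc (\<sigma> * ?e, \<tau> * ?e)"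
      if st: "is_sign \<sigma>" "is_sign \<tau>" and nz: "u (\<sigma> * ?e, 0) \<noteq> 0" for \<sigma> \<tau>
    proof -
      have "u (?e, 0) \<noteq> 0" using nz sym[OF st, of ?e 0] by simp
      then have "cc (\<sigma> * ?e, \<tau> * 0) = cc (\<sigma> * ?e, \<tau> * ?e) \<or> cc (\<sigma> * ?e, \<tau> * 0) = cc (\<sigma> * 0, \<tau> * 0)"
        using cor(2)[OF st] cc_eq by blast
      then show ?thesis unfolding mult_zero_right by blast
    qed
    have "?K \<subseteq> insert (cc (0, 0)) ?C"
    proof
      fix k assume "k \<in> ?K"
      then obtain q where q: "q \<in> grid {-pi/2, 0, pi/2}" "u q \<noteq> 0" "k = cc q" by (auto simp: nonzero_def)
      from q(1) consider "q \<in> {(?e, ?e), (?e, - ?e), (- ?e, ?e), (- ?e, - ?e)}"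
        | "q = (0, 1 * ?e)" | "q = (0, -1 * ?e)" | "q = (1 * ?e, 0)" | "q = (-1 * ?e, 0)"
        unfolding grid by auto
      then show "k \<in> insert (cc (0, 0)) ?C"
      proof cases
        case 1
        then show ?thesis using q(3) by auto
      next
        case 2
        have "u (0, 1 * ?e) \<noteq> 0" using q(2) unfolding 2 .
        from top[OF _ _ this, of 1] show ?thesis unfolding q(3) 2 by auto
      next
        case 3
        have "u (0, -1 * ?e) \<noteq> 0" using q(2) unfolding 3 .
        from top[OF _ _ this, of 1] show ?thesis unfolding q(3) 3 by auto
      next
        case 4
        have "u (1 * ?e, 0) \<noteq> 0" using q(2) unfolding 4 .
        from right[OF _ _ this, of 1] show ?thesis unfolding q(3) 4 by auto
      next
        case 5
        have "u (-1 * ?e, 0) \<noteq> 0" using q(2) unfolding 5 .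
        from right[OF _ _ this, of 1] show ?thesis unfolding q(3) 5 by auto
      qed
    qed
    from le[OF this] show ?thesis using c5[of "cc (0, 0)" "cc (?e, ?e)" "cc (?e, - ?e)" "cc (- ?e, ?e)" "cc (- ?e, - ?e)"] by simp
  qed
qed

lemma rep_sides_full:
  assumes pos: "\<And>x. \<bar>x\<bar> \<le> pi/2 \<Longrightarrow> A x \<noteq> 0" and \<tau>: "is_sign \<tau>" and t: "\<bar>t\<bar> \<le> pi/2"
  shows "rep_on {x \<in> {-pi/2..pi/2}. W x = 0} (\<lambda>t. u (side s \<tau> t)) t"
proof -
  obtain c1 c2 where c: "c1 \<noteq> 0 \<or> c2 \<noteq> 0" "\<And>t. u (side s \<tau> (1 * t)) = c1 * A t + c2 * Q t"
    using u_side[of 1 \<tau>] \<tau> by blast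
  show ?thesis using rep_positive[OF pos c(1) t] unfolding c(2)[symmetric] mult_1 .
qed

text \<open>\<open>F\<close> restricts the combinations to those that occur on a side: when both
  modes are odd, the small point in \<open>X\<close> is chosen for finitely many functions
  only.\<close>

lemma rep_sides_half:
  assumes half: "\<And>c1 c2 x. c1 \<noteq> 0 \<or> c2 \<noteq> 0 \<Longrightarrow> (\<lambda>x. c1 * A x + c2 * Q x) \<in> F \<Longrightarrow> 0 \<le> x \<Longrightarrow> x \<le> pi/2
      \<Longrightarrow> rep_on X (\<lambda>x. c1 * A x + c2 * Q x) x"
    and F: "\<And>s \<sigma> \<tau>. is_sign \<sigma> \<Longrightarrow> is_sign \<tau> \<Longrightarrow> (\<lambda>t. u (side s \<tau> (\<sigma> * t))) \<in> F"
    and X: "uminus ` X \<subseteq> X"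
    and \<tau>: "is_sign \<tau>" and t: "\<bar>t\<bar> \<le> pi/2"
  shows "rep_on X (\<lambda>t. u (side s \<tau> t)) t"
proof -
  have pos: "rep_on X (\<lambda>t. u (side s \<tau> (\<sigma> * t))) y" if h: "is_sign \<sigma>" "0 \<le> y" "y \<le> pi/2" for \<sigma> y
  proof -
    obtain c1 c2 where c: "c1 \<noteq> 0 \<or> c2 \<noteq> 0" "\<And>t. u (side s \<tau> (\<sigma> * t)) = c1 * A t + c2 * Q t"
      using u_side[OF h(1) \<tau>] by blast
    then have "(\<lambda>x. c1 * A x + c2 * Q x) \<in> F" using F[OF h(1) \<tau>, of s] by simp
    from half[OF c(1) this h(2,3)] show ?thesis unfolding c(2) .
  qed
  show ?thesis
  proof (cases "t \<ge> 0")
    case True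
    then have "rep_on X (\<lambda>t. u (side s \<tau> (1 * t))) t" using t by (intro pos) auto
    then show ?thesis unfolding mult_1 .
  next
    case False
    then have "rep_on X (\<lambda>t. u (side s \<tau> (-1 * t))) (- t)" using t by (intro pos) auto
    then show ?thesis unfolding mult_minus1 by (rule rep_on_reflect[OF _ X])
  qed
qed

text \<open>For \<open>i = 0\<close>, \<open>n \<ge> 3\<close>: \<open>X\<close> has at most
  \<open>card Z + 1\<close> points, the grid at most \<open>4 * card Z\<close>, and the corners save
  4. The zeros \<open>z1\<close> and \<open>z2\<close> enclose a zero of \<open>W\<close>, so the
  last zero of \<open>W\<close> before pi/2 is positive, as \<open>card_nodal_corners\<close>
  requires.\<close>

lemma card_nodal_positive:
  assumes pos: "\<And>x. A x > 0"
    and Z: "finite Z" "\<And>x. -pi/2 < x \<Longrightarrow> x < pi/2 \<Longrightarrow> Q x = 0 \<Longrightarrow> x \<in> Z"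
    and z: "0 \<le> z1" "z1 < z2" "z2 < pi/2" "Q z1 = 0" "Q z2 = 0"
  shows "card (nodal_domains u) \<le> 4 * card Z - 4"
proof -
  define X where "X = {x \<in> {-pi/2..pi/2}. W x = 0}"
  have A0: "A x \<noteq> 0" for x using pos[of x] by simp
  have X: "finite X" "card X \<le> Suc (card Z)"
    using W_card[OF Z(1), of "-pi/2" "pi/2"] Z(2) A0 unfolding X_def by auto
  have We: "W (-pi/2) = 0" using W_minus[of "pi/2"] W_end by simp
  have E: "{-pi/2, pi/2} \<subseteq> X" using W_end We pi_ge_zero unfolding X_def by auto
  obtain t where t: "z1 < t" "t < z2" "W t = 0" using comb_rolle[of z1 z2 0 1] z A0 by auto
  define \<xi> where "\<xi> = Max (X - {pi/2})"
  have tX: "t \<in> X - {pi/2}" using t z unfolding X_def by auto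
  have "\<xi> \<in> X - {pi/2}" unfolding \<xi>_def using X(1) tX by (intro Max_in) auto
  then have \<xi>X: "\<xi> \<in> X" and "\<xi> \<noteq> pi/2" by auto
  have "t \<le> \<xi>" unfolding \<xi>_def using X(1) tX by (intro Max_ge) auto
  then have \<xi>: "0 < \<xi>" "\<xi> < pi/2" "W \<xi> = 0" using t z \<xi>X \<open>\<xi> \<noteq> pi/2\<close> unfolding X_def by auto
  have W0: "W x \<noteq> 0" if "x \<in> {\<xi><..<pi/2}" for x
  proof
    assume "W x = 0"
    then have "x \<in> X - {pi/2}" using that \<xi> unfolding X_def by auto
    then have "x \<le> \<xi>" unfolding \<xi>_def using X(1) by (intro Max_ge) auto
    then show False using that by simp
  qed
  obtain \<zeta> where \<zeta>: "\<xi> < \<zeta>" "\<zeta> < pi/2" "Q \<zeta> = 0" using W_rolle[OF \<xi>(2,3) W_end] A0 by blast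
  have m\<xi>: "{-\<xi>, \<xi>} \<subseteq> X" using \<xi> \<xi>X W_minus[of \<xi>] unfolding X_def by auto
  have "card (nodal_domains u) \<le> card (cc ` (grid X \<inter> nonzero u))"
  proof (rule card_nodal_grid[OF X(1) E])
    show "X \<subseteq> {-pi/2..pi/2}" unfolding X_def by blast
    show "rep_on X (\<lambda>t. u (side s \<tau> t)) t" if "is_sign \<tau>" "\<bar>t\<bar> \<le> pi/2" for s \<tau> t
      unfolding X_def by (rule rep_sides_full[OF A0 that])
  qed
  moreover have "card (cc ` (grid X \<inter> nonzero u)) + 4 \<le> card (grid X)"
    by (rule card_nodal_corners[OF \<xi>(1,2) pos _ \<zeta> X(1) E m\<xi>]) (use W0 in blast)
  moreover have "card (grid X) \<le> 4 * card X - 4" using grid_card(2)[OF X(1) E] .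
  ultimately show ?thesis using X(2) by linarith
qed

text \<open>For \<open>i = 0\<close>, \<open>n = 2\<close>: Rolle's theorem allows three zeros of
  \<open>W\<close>, and the end points and 0 already are zeros. Hence the last zero before pi/2 is
  0, the corner triples overlap, and \<open>card_two\<close> replaces
  \<open>card_nodal_corners\<close>.\<close>

lemma card_nodal_two:
  assumes even: "sA = 1" "sQ = 1" and pos: "\<And>x. A x > 0"
    and Z: "finite Z" "\<And>x. -pi/2 < x \<Longrightarrow> x < pi/2 \<Longrightarrow> Q x = 0 \<Longrightarrow> x \<in> Z" "card Z \<le> 2"
    and \<zeta>: "0 < \<zeta>" "\<zeta> < pi/2" "Q \<zeta> = 0"
  shows "card (nodal_domains u) \<le> 5"
proof -
  define X where "X = {x \<in> {-pi/2..pi/2}. W x = 0}"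
  have A0: "A x \<noteq> 0" for x using pos[of x] by simp
  have X: "finite X" "card X \<le> Suc (card Z)"
    using W_card[OF Z(1), of "-pi/2" "pi/2"] Z(2) A0 unfolding X_def by auto
  have We: "W (-pi/2) = 0" using W_minus[of "pi/2"] W_end by simp
  have "A' 0 = 0" "Q' 0 = 0" using dA_minus[of 0] dQ_minus[of 0] even by simp_all
  then have "W 0 = 0" by (simp add: W_def)
  then have E: "{-pi/2, 0, pi/2} \<subseteq> X" using W_end We pi_ge_zero unfolding X_def by auto
  have "card {-pi/2, 0, pi/2 :: real} = 3" using pi_gt_zero by (simp add: card_insert_if)
  then have Xeq: "X = {-pi/2, 0, pi/2}" using card_seteq[OF X(1) E] X(2) Z(3) by simp
  have W0: "\<forall>x\<in>{0<..<pi/2}. W x \<noteq> 0"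
  proof
    fix x assume x: "x \<in> {0<..<pi/2}"
    then have "x \<notin> X" unfolding Xeq by auto
    then show "W x \<noteq> 0" using x unfolding X_def by auto
  qed
  have "card (nodal_domains u) \<le> card (cc ` (grid X \<inter> nonzero u))"
  proof (rule card_nodal_grid[OF X(1)])
    show "{-pi/2, pi/2} \<subseteq> X" using E by blast
    show "X \<subseteq> {-pi/2..pi/2}" unfolding X_def by blast
    show "rep_on X (\<lambda>t. u (side s \<tau> t)) t" if "is_sign \<tau>" "\<bar>t\<bar> \<le> pi/2" for s \<tau> t
      unfolding X_def by (rule rep_sides_full[OF A0 that])
  qed
  also have "\<dots> \<le> 5" unfolding Xeq by (rule card_two[OF even pos W0 \<zeta>])
  finally show ?thesis .
qed

text \<open>For \<open>i = 1\<close> and even \<open>n\<close>: no zero of \<open>W\<close> precedes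
  \<open>z1\<close>, so at most \<open>card Z + 1\<close> of them are positive. With their negatives
  and 0 the grid has at most \<open>8 * card Z + 8\<close> points, of which \<open>card_axis\<close>
  saves 2.\<close>

lemma card_nodal_odd_even:
  assumes odd: "sA = -1" and even: "sQ = 1" and Q0: "Q 0 > 0"
    and z1: "0 < z1" "z1 < pi/2" "\<And>x. 0 < x \<Longrightarrow> x < z1 \<Longrightarrow> W x \<noteq> 0"
    and Z: "finite Z" "\<And>x. z1 < x \<Longrightarrow> x < pi/2 \<Longrightarrow> Q x = 0 \<Longrightarrow> x \<in> Z"
  shows "card (nodal_domains u) \<le> 8 * card Z + 6"
proof -
  define N where "N = {x \<in> {0<..pi/2}. W x = 0}"
  define X where "X = insert 0 (N \<union> uminus ` N)"
  have A0: "A 0 = 0" using sA(2)[of 0] odd by simp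
  have N: "finite {x \<in> {z1..pi/2}. W x = 0}" "card {x \<in> {z1..pi/2}. W x = 0} \<le> Suc (card Z)"
    using W_card[OF Z(1), of z1 "pi/2"] Z(2) Apos z1(1) by (metis less_imp_le less_irrefl less_trans)+
  have "N = {x \<in> {z1..pi/2}. W x = 0}" unfolding N_def using z1 by (auto simp: not_less[symmetric])
  then have Nf: "finite N" "card N \<le> Suc (card Z)" using N by auto
  have eN: "pi/2 \<in> N" using W_end by (simp add: N_def)
  have X: "finite X" using Nf by (simp add: X_def)
  have cX: "card X \<le> 2 * card Z + 3"
  proof -
    have "card X \<le> Suc (card (N \<union> uminus ` N))" unfolding X_def using Nf by (simp add: card_insert_if)
    moreover have "card (N \<union> uminus ` N) \<le> card N + card (uminus ` N)" by (rule card_Un_le)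
    moreover have "card (uminus ` N) = card N" by (intro card_image) (simp add: inj_on_def)
    ultimately show ?thesis using Nf(2) by linarith
  qed
  have E: "{-pi/2, pi/2} \<subseteq> X" using eN by (auto simp: X_def)
  have sub: "X \<subseteq> {-pi/2..pi/2}" unfolding X_def N_def by auto
  have sym: "uminus ` X \<subseteq> X" unfolding X_def by auto
  have half: "rep_on X (\<lambda>x. c1 * A x + c2 * Q x) x" if c: "c1 \<noteq> 0 \<or> c2 \<noteq> 0" and x: "0 \<le> x" "x \<le> pi/2" for c1 c2 x
  proof (cases "c1 * A x + c2 * Q x = 0")
    case True
    then show ?thesis by (simp add: rep_on_def)
  next
    case False
    then consider (node) "rep_on N (\<lambda>x. c1 * A x + c2 * Q x) x"
      | (left) "\<And>t. 0 \<le> t \<Longrightarrow> t \<le> x \<Longrightarrow> c1 * A t + c2 * Q t \<noteq> 0"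
      | (zero) "c1 * A 0 + c2 * Q 0 = 0" "\<exists>t. x < t \<and> t \<le> pi/2 \<and> c1 * A t + c2 * Q t = 0"
      using rep_half[OF c x False] unfolding N_def by blast
    then show ?thesis
    proof cases
      case node
      then show ?thesis by (rule rep_on_mono) (auto simp: X_def)
    next
      case left
      then show ?thesis unfolding rep_on_def using x
        by (intro impI bexI[of _ 0]) (auto simp: closed_segment_eq_real_ivl X_def)
    next
      case zero
      then obtain t where t: "x < t" "t \<le> pi/2" "c1 * A t + c2 * Q t = 0" by blast
      \<comment> \<open>A combination that vanishes at 0 is a multiple of \<open>A\<close>, which
        has no zero on the right of 0.\<close>
      have "c2 = 0" using zero(1) A0 Q0 by auto
      then have False using c t Apos[of t] x(1) by auto
      then show ?thesis ..
    qed
  qed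
  have "card (nodal_domains u) \<le> card (cc ` (grid X \<inter> nonzero u))"
  proof (rule card_nodal_grid[OF X E sub])
    show "rep_on X (\<lambda>t. u (side s \<tau> t)) t" if "is_sign \<tau>" "\<bar>t\<bar> \<le> pi/2" for s \<tau> t
      by (rule rep_sides_half[of UNIV, OF half _ sym that]) auto
  qed
  also have "\<dots> \<le> card (grid X) - 2"
  proof -
    let ?F = "{(0, pi/2), (0, -pi/2), (pi/2, 0), (-pi/2, 0)} :: (real \<times> real) set"
    have F: "?F \<subseteq> grid X" by (auto simp: grid_def X_def)
    have cF: "card ?F = 4" using pi_gt_zero by (simp add: card_insert_if)
    note gf = grid_card(1)[OF X E]
    have "cc ` (grid X \<inter> nonzero u) \<subseteq> cc ` (grid X - ?F) \<union> cc ` (?F \<inter> nonzero u)" by blast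
    then have "card (cc ` (grid X \<inter> nonzero u)) \<le> card (cc ` (grid X - ?F) \<union> cc ` (?F \<inter> nonzero u))"
      using gf by (intro card_mono) auto
    also have "\<dots> \<le> card (cc ` (grid X - ?F)) + card (cc ` (?F \<inter> nonzero u))" by (rule card_Un_le)
    also have "card (cc ` (grid X - ?F)) \<le> card (grid X - ?F)" using gf by (intro card_image_le) auto
    also have "card (grid X - ?F) = card (grid X) - 4"
      using card_Diff_subset[OF _ F] cF by simp
    also have "card (cc ` (?F \<inter> nonzero u)) \<le> 2" by (rule card_axis[OF odd even Q0])
    finally have "card (cc ` (grid X \<inter> nonzero u)) \<le> card (grid X) - 4 + 2" by simp
    moreover have "4 \<le> card (grid X)" using card_mono[OF gf F] cF by simp
    ultimately show ?thesis by linarith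
  qed
  also have "\<dots> \<le> 8 * card Z + 6" using grid_card(2)[OF X E] cX by linarith
  finally show ?thesis .
qed

text \<open>As \<open>u\<close> vanishes on the axes, the sign interval of a side next to an axis may contain no zero of
  \<open>W\<close>; a small \<open>\<epsilon>\<close> represents it.\<close>

lemma card_nodal_odd_odd:
  assumes odd: "sA = -1" "sQ = -1"
    and Z: "finite Z" "\<And>x. 0 < x \<Longrightarrow> x < pi/2 \<Longrightarrow> Q x = 0 \<Longrightarrow> x \<in> Z"
  shows "card (nodal_domains u) \<le> 8 * card Z"
proof -
  define N where "N = {x \<in> {0<..pi/2}. W x = 0}"
  have A0: "A 0 = 0" "Q 0 = 0" using sA(2)[of 0] sQ(2)[of 0] odd by simp_all
  have W0: "W 0 = 0" by (simp add: W_def A0)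
  have N: "finite {x \<in> {0..pi/2}. W x = 0}" "card {x \<in> {0..pi/2}. W x = 0} \<le> Suc (card Z)"
    using W_card[OF Z(1), of 0 "pi/2"] Z(2) Apos by (metis less_imp_le less_irrefl)+
  \<comment> \<open>The zero of \<open>W\<close> at 0 is one of the \<open>card Z + 1\<close> that
    Rolle's theorem allows, so only \<open>card Z\<close> can be positive.\<close>
  have "{x \<in> {0..pi/2}. W x = 0} = insert 0 N" unfolding N_def using W0 pi_ge_zero by auto
  moreover have "0 \<notin> N" by (simp add: N_def)
  ultimately have Nf: "finite N" "card N \<le> card Z" using N by auto
  have eN: "pi/2 \<in> N" using W_end by (simp add: N_def)
  define S where "S = {1, -1 :: real}"
  \<comment> \<open>\<open>Q\<close> is included so that \<open>\<epsilon>\<close> also precedes the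
    first positive zero of \<open>Q\<close>, which supplies \<open>\<zeta>\<close> when
    \<open>\<xi> = \<epsilon>\<close>.\<close>
  define F where "F = insert Q (\<Union>\<sigma>\<in>S. \<Union>\<tau>\<in>S. range (\<lambda>s t. u (side s \<tau> (\<sigma> * t))))"
  have comb: "\<exists>c1 c2. (c1 \<noteq> 0 \<or> c2 \<noteq> 0) \<and> w = (\<lambda>x. c1 * A x + c2 * Q x)" if "w \<in> F" for w
  proof -
    from that consider "w = Q"
      | s \<sigma> \<tau> where "is_sign \<sigma>" "is_sign \<tau>" "w = (\<lambda>t. u (side s \<tau> (\<sigma> * t)))"
      unfolding F_def S_def by blast
    then show ?thesis
    proof cases
      case 1
      then show ?thesis by (intro exI[of _ 0] exI[of _ 1]) simp
    next
      case 2
      then show ?thesis using u_side[OF 2(1,2), of s] by metis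
    qed
  qed
  have "\<forall>\<^sub>F t in at_right 0. w t \<noteq> 0" if "w \<in> F" for w
    using comb[OF that] comb_eventually[OF _ Nf(1)[unfolded N_def]] by auto
  moreover have "finite F" by (simp add: F_def S_def)
  ultimately have "\<forall>\<^sub>F t in at_right 0. \<forall>w\<in>F. w t \<noteq> 0" by (simp add: eventually_ball_finite)
  then obtain r where r: "r > 0" "\<And>t w. 0 < t \<Longrightarrow> t < r \<Longrightarrow> w \<in> F \<Longrightarrow> w t \<noteq> 0"
    unfolding eventually_at_right_field by blast
  define \<epsilon> where "\<epsilon> = min r (pi/2) / 2"
  have \<epsilon>: "0 < \<epsilon>" "\<epsilon> < r" "\<epsilon> < pi/2" using r(1) pi_gt_zero by (auto simp: \<epsilon>_def min_def)
  define Y where "Y = insert \<epsilon> N"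
  define X where "X = Y \<union> uminus ` Y"
  have Yf: "finite Y" "card Y \<le> Suc (card Z)" using Nf by (auto simp: Y_def card_insert_if)
  have X: "finite X" using Yf by (simp add: X_def)
  have cX: "card X \<le> 2 * card Z + 2"
  proof -
    have "card X \<le> card Y + card (uminus ` Y)" unfolding X_def by (rule card_Un_le)
    also have "card (uminus ` Y) = card Y" by (intro card_image) (simp add: inj_on_def)
    finally show ?thesis using Yf(2) by linarith
  qed
  have E: "{-pi/2, pi/2} \<subseteq> X" using eN by (auto simp: X_def Y_def)
  have sub: "X \<subseteq> {-pi/2..pi/2}" unfolding X_def Y_def N_def using \<epsilon> by auto
  have sym: "uminus ` X \<subseteq> X" unfolding X_def by auto
  have half: "rep_on X (\<lambda>x. c1 * A x + c2 * Q x) x"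
    if c: "c1 \<noteq> 0 \<or> c2 \<noteq> 0" and w: "(\<lambda>x. c1 * A x + c2 * Q x) \<in> F" and x: "0 \<le> x" "x \<le> pi/2" for c1 c2 x
  proof (cases "c1 * A x + c2 * Q x = 0")
    case True
    then show ?thesis by (simp add: rep_on_def)
  next
    case False
    then consider (node) "rep_on N (\<lambda>x. c1 * A x + c2 * Q x) x"
      | (left) "c1 * A 0 + c2 * Q 0 \<noteq> 0"
      | (zero) "0 < x" "\<And>t. 0 < t \<Longrightarrow> t \<le> x \<Longrightarrow> c1 * A t + c2 * Q t \<noteq> 0"
      using rep_half[OF c x False] x(1) unfolding N_def by blast
    then show ?thesis
    proof cases
      case node
      then show ?thesis by (rule rep_on_mono) (auto simp: X_def Y_def)
    next
      case left
      then show ?thesis using A0 by simp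
    next
      case zero
      have "c1 * A t + c2 * Q t \<noteq> 0" if "t \<in> closed_segment x \<epsilon>" for t
      proof (cases "t \<le> x")
        case True
        have "0 < t" using that zero(1) \<epsilon>(1) by (auto simp: closed_segment_eq_real_ivl split: if_splits)
        then show ?thesis using zero(2) True by blast
      next
        case False
        then have "0 < t" "t < r" using that zero(1) \<epsilon> by (auto simp: closed_segment_eq_real_ivl split: if_splits)
        then show ?thesis using r(2)[OF _ _ w] by simp
      qed
      moreover have "\<epsilon> \<in> X" by (simp add: X_def Y_def)
      ultimately show ?thesis unfolding rep_on_def by blast
    qed
  qed
  have "card (nodal_domains u) \<le> card (cc ` (grid X \<inter> nonzero u))"
  proof (rule card_nodal_grid[OF X E sub])
    have F': "(\<lambda>t. u (side s \<tau> (\<sigma> * t))) \<in> F" if "is_sign \<sigma>" "is_sign \<tau>" for s \<sigma> \<tau>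
    proof -
      have "\<sigma> \<in> S" "\<tau> \<in> S" using that by (auto simp: S_def)
      then show ?thesis unfolding F_def by blast
    qed
    show "rep_on X (\<lambda>t. u (side s \<tau> t)) t" if "is_sign \<tau>" "\<bar>t\<bar> \<le> pi/2" for s \<tau> t
      by (rule rep_sides_half[OF half F' sym that])
  qed
  \<comment> \<open>The grid has at most \<open>8 * card Z + 4\<close> points, and the corners save
    4.\<close>
  moreover have "card (cc ` (grid X \<inter> nonzero u)) + 4 \<le> card (grid X)"
  proof -
    define \<xi> where "\<xi> = Max (Y - {pi/2})"
    have \<epsilon>Y: "\<epsilon> \<in> Y - {pi/2}" using \<epsilon> by (simp add: Y_def)
    have "\<xi> \<in> Y - {pi/2}" unfolding \<xi>_def using Yf(1) \<epsilon>Y by (intro Max_in) auto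
    then have \<xi>Y: "\<xi> \<in> Y" and "\<xi> \<noteq> pi/2" by simp_all
    have "\<epsilon> \<le> \<xi>" unfolding \<xi>_def using Yf(1) \<epsilon>Y by (intro Max_ge) auto
    moreover have "Y \<subseteq> {..pi/2}" unfolding Y_def N_def using \<epsilon>(3) by auto
    then have "\<xi> \<le> pi/2" using \<xi>Y by blast
    ultimately have \<xi>: "0 < \<xi>" "\<xi> < pi/2" using \<epsilon>(1,3) \<open>\<xi> \<noteq> pi/2\<close> by linarith+
    have W1: "\<forall>x\<in>{\<xi><..<pi/2}. W x \<noteq> 0"
    proof (intro ballI notI)
      fix x assume x: "x \<in> {\<xi><..<pi/2}" and "W x = 0"
      then have "x \<in> Y - {pi/2}" using \<xi> unfolding Y_def N_def by auto
      then have "x \<le> \<xi>" unfolding \<xi>_def using Yf(1) by (intro Max_ge) auto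
      then show False using x by simp
    qed
    obtain \<zeta> where \<zeta>: "\<xi> < \<zeta>" "\<zeta> < pi/2" "Q \<zeta> = 0"
    proof (cases "W \<xi> = 0")
      case True
      have "A x \<noteq> 0" if "\<xi> < x" "x < pi/2" for x using Apos[of x] that \<xi> by auto
      then show ?thesis using W_rolle[OF \<xi>(2) True W_end] that by blast
    next
      case False
      then have "\<xi> = \<epsilon>" using \<xi>Y unfolding Y_def N_def by auto
      have "A x \<noteq> 0" if "0 < x" "x < pi/2" for x using Apos[of x] that by auto
      then obtain \<zeta> where \<zeta>: "0 < \<zeta>" "\<zeta> < pi/2" "Q \<zeta> = 0"
        using W_rolle[OF pi_half_gt_zero W0 W_end] by blast
      have "\<not> \<zeta> < r" using r(2)[of \<zeta> Q] \<zeta> by (auto simp: F_def)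
      then show ?thesis using that[of \<zeta>] \<zeta> \<epsilon> \<open>\<xi> = \<epsilon>\<close> by simp
    qed
    show ?thesis
      by (rule card_nodal_corners[OF \<xi> _ W1 \<zeta> X E]) (use \<xi> \<xi>Y Apos in \<open>auto simp: X_def\<close>)
  qed
  moreover have "card (grid X) \<le> 4 * card X - 4" using grid_card(2)[OF X E] .
  ultimately show ?thesis using cX by linarith
qed

end

section \<open>Nodal domains of the eigenfunctions\<close>

context robin
begin

lemma nodal_pair_modes:
  assumes i: "i < 2" and n: "n \<ge> 2" and neg: "\<mu> i + \<mu> n < 0"
  shows "nodal_pair (p i) (p' i) (p n) (p' n) (- \<mu> i) (\<mu> n) ((-1) ^ i) ((-1) ^ n)"
proof
  show "p i x > 0" if "0 < x" "x \<le> pi/2" for x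
    using that i freq_pos[of i] by (auto simp: mode_def)
  show "p' n (pi/2) * p i (pi/2) = p n (pi/2) * p' i (pi/2)" by (simp add: robin_right)
  show "(-1 :: real) ^ i = 1 \<or> (-1 :: real) ^ i = -1" "(-1 :: real) ^ n = 1 \<or> (-1 :: real) ^ n = -1"
    by (cases "even i"; simp) (cases "even n"; simp)
  show "(p' i has_real_derivative - \<mu> i * p i x) (at x)" "(p' n has_real_derivative - \<mu> n * p n x) (at x)" for x
    by (rule dmode_deriv)+
qed (use eigv_pos[OF n] neg in \<open>auto simp: mode_deriv mode_end_nonzero mode_minus\<close>)

text \<open>Since \<open>\<alpha> n < n\<close>, the angle stays below m * pi in modulus, which
  leaves 2 * m possible values of \<open>k\<close>.\<close>

lemma zeros_even:
  assumes n: "n \<ge> 2" "n = 2 * m" and x: "\<bar>x\<bar> < pi/2" "p n x = 0"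
  shows "\<exists>k::int. k \<in> {- int m..<int m} \<and> x = (real_of_int k * pi + pi/2) / \<alpha> n"
proof -
  have "cos (\<alpha> n * x) = 0" using x(2) n by (simp add: mode_def)
  then obtain k :: int where k: "\<alpha> n * x = real_of_int k * pi + pi/2" using cos_zero_iff_int2 by blast
  have "\<alpha> n * \<bar>x\<bar> < real n * (pi/2)"
    using freq_ge2[OF n(1)] freq_pos[of n] x(1) by (intro mult_strict_mono) auto
  then have "\<bar>\<alpha> n * x\<bar> < real m * pi" using freq_pos[of n] n(2) by (simp add: abs_mult)
  then have "\<bar>(real_of_int k + 1/2) * pi\<bar> < real m * pi" unfolding k by (simp add: distrib_right)
  then have "\<bar>real_of_int k + 1/2\<bar> < real m" by (simp add: abs_mult)
  then have "- int m \<le> k" "k < int m" by linarith+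
  moreover have "x = (real_of_int k * pi + pi/2) / \<alpha> n" using k freq_pos[of n] by (simp add: field_simps)
  ultimately show ?thesis by auto
qed

lemma zeros_odd:
  assumes n: "n \<ge> 2" "n = 2 * m + 1" and x: "\<bar>x\<bar> < pi/2" "p n x = 0"
  shows "\<exists>k::int. k \<in> {- int m..int m} \<and> x = real_of_int k * pi / \<alpha> n"
proof -
  have "sin (\<alpha> n * x) = 0" using x(2) n by (simp add: mode_def split: if_splits)
  then obtain k :: int where k: "\<alpha> n * x = real_of_int k * pi" using sin_zero_iff_int2 by blast
  have "\<alpha> n * \<bar>x\<bar> < real n * (pi/2)"
    using freq_ge2[OF n(1)] freq_pos[of n] x(1) by (intro mult_strict_mono) auto
  then have "\<bar>\<alpha> n * x\<bar> < (real m + 1/2) * pi" using freq_pos[of n] n(2) by (simp add: abs_mult algebra_simps)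
  then have "\<bar>real_of_int k\<bar> < real m + 1/2" unfolding k by (simp add: abs_mult)
  then have "- int m \<le> k" "k \<le> int m" by linarith+
  moreover have "x = real_of_int k * pi / \<alpha> n" using k freq_pos[of n] by (simp add: field_simps)
  ultimately show ?thesis by auto
qed

lemma zeros_card:
  assumes n: "n \<ge> 2"
  obtains Z where "finite Z" "card Z \<le> n" "\<And>x. -pi/2 < x \<Longrightarrow> x < pi/2 \<Longrightarrow> p n x = 0 \<Longrightarrow> x \<in> Z"
proof (cases "even n")
  case True
  then obtain m where m: "n = 2 * m" by auto
  let ?Z = "(\<lambda>k::int. (real_of_int k * pi + pi/2) / \<alpha> n) ` {- int m..<int m}"
  show ?thesis
  proof (rule that[of ?Z])
    show "card ?Z \<le> n" by (rule order.trans[OF card_image_le]) (use m in auto)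
    show "x \<in> ?Z" if "-pi/2 < x" "x < pi/2" "p n x = 0" for x
    proof -
      have "\<bar>x\<bar> < pi/2" using that(1,2) by linarith
      from zeros_even[OF n m this that(3)] show ?thesis by blast
    qed
  qed simp
next
  case False
  then obtain m where m: "n = 2 * m + 1" by (metis oddE)
  let ?Z = "(\<lambda>k::int. real_of_int k * pi / \<alpha> n) ` {- int m..int m}"
  show ?thesis
  proof (rule that[of ?Z])
    show "card ?Z \<le> n" by (rule order.trans[OF card_image_le]) (use m in auto)
    show "x \<in> ?Z" if "-pi/2 < x" "x < pi/2" "p n x = 0" for x
    proof -
      have "\<bar>x\<bar> < pi/2" using that(1,2) by linarith
      from zeros_odd[OF n m this that(3)] show ?thesis by blast
    qed
  qed simp
qed

lemma first_zero:
  assumes n: "n \<ge> 2" "even n"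
  shows "0 < pi / (2 * \<alpha> n)" "pi / (2 * \<alpha> n) < pi/2" "p n (pi / (2 * \<alpha> n)) = 0"
proof -
  have "\<alpha> n > 1" using freq_ge2[OF n(1)] n(1) by simp
  then show "0 < pi / (2 * \<alpha> n)" "pi / (2 * \<alpha> n) < pi/2" by (simp_all add: field_simps)
  have "\<alpha> n * (pi / (2 * \<alpha> n)) = pi/2" using freq_pos[of n] by simp
  then show "p n (pi / (2 * \<alpha> n)) = 0" using n by (simp only: mode_def) simp
qed

lemma two_zeros:
  assumes n: "n \<ge> 3"
  obtains z1 z2 where "0 \<le> z1" "z1 < z2" "z2 < pi/2" "p n z1 = 0" "p n z2 = 0"
proof (cases "even n")
  case True
  then have "n \<ge> 4" using n by presburger
  then have a: "\<alpha> n > 3" using freq_ge2[of n] n by simp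
  show ?thesis
  proof (rule that[of "pi / (2 * \<alpha> n)" "3 * pi / (2 * \<alpha> n)"])
    show "0 \<le> pi / (2 * \<alpha> n)" "p n (pi / (2 * \<alpha> n)) = 0" using first_zero[of n] n True by auto
    show "pi / (2 * \<alpha> n) < 3 * pi / (2 * \<alpha> n)" using a by (simp add: divide_strict_right_mono)
    show "3 * pi / (2 * \<alpha> n) < pi/2" using a by (simp add: field_simps)
    have "\<alpha> n * (3 * pi / (2 * \<alpha> n)) = 3/2 * pi" using a by simp
    then have "cos (\<alpha> n * (3 * pi / (2 * \<alpha> n))) = 0" by (simp only: cos_3over2_pi)
    moreover have "p n z = cos (\<alpha> n * z)" for z using n True by (auto simp: mode_def)
    ultimately show "p n (3 * pi / (2 * \<alpha> n)) = 0" by (simp only:)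
  qed
next
  case False
  have a: "\<alpha> n > 2" using freq_ge2[of n] n by simp
  show ?thesis
  proof (rule that[of 0 "pi / \<alpha> n"])
    show "0 < pi / \<alpha> n" "pi / \<alpha> n < pi/2" using a by (simp_all add: field_simps)
    have "\<alpha> n * (pi / \<alpha> n) = pi" using a by simp
    then show "p n (pi / \<alpha> n) = 0" using n False by (simp only: mode_def) simp
    show "p n 0 = 0" using n False by (simp add: mode_def)
  qed simp
qed

text \<open>The second bound is one below the index bound of \<open>spectral_structure\<close>. The
  value 5 is for \<open>i = 0\<close>, \<open>n = 2\<close>, where the hypothesis
  \<open>k \<ge> 6\<close> decides.\<close>

lemma nodal_bound:
  assumes i: "i < 2" and n: "n \<ge> 2" and neg: "\<mu> i + \<mu> n < 0" and ab: "a \<noteq> 0 \<or> b \<noteq> 0"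
  defines "v \<equiv> \<lambda>z. a * (p i (fst z) * p n (snd z)) + b * (p n (fst z) * p i (snd z))"
  shows "card (nodal_domains v) \<le> max 5 (4 * n - 4 + 2 * i)"
proof -
  interpret nodal_form "p i" "p' i" "p n" "p' n" "- \<mu> i" "\<mu> n" "(-1) ^ i" "(-1) ^ n" a b
    using nodal_pair_modes[OF i n neg] ab by (simp add: nodal_form_def nodal_form_axioms_def)
  have v: "v = u" by (rule ext) (simp add: v_def u_def)
  consider "i = 0" "n = 2" | "i = 0" "n \<ge> 3" | "i = 1" "even n" | "i = 1" "odd n" using i n by linarith
  then show ?thesis
  proof cases
    case 1
    have pos: "p i x > 0" for x using 1 by (simp add: mode_def)
    obtain Z where Z: "finite Z" "card Z \<le> n" "\<And>x. -pi/2 < x \<Longrightarrow> x < pi/2 \<Longrightarrow> p n x = 0 \<Longrightarrow> x \<in> Z"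
      using zeros_card[OF n] by blast
    have "card (nodal_domains u) \<le> 5"
      by (rule card_nodal_two[OF _ _ pos Z(1,3) _ first_zero[OF n]]) (use 1 Z(2) in auto)
    then show ?thesis by (simp add: v)
  next
    case 2
    have pos: "p i x > 0" for x using 2 by (simp add: mode_def)
    obtain Z where Z: "finite Z" "card Z \<le> n" "\<And>x. -pi/2 < x \<Longrightarrow> x < pi/2 \<Longrightarrow> p n x = 0 \<Longrightarrow> x \<in> Z"
      using zeros_card[OF n] by blast
    obtain z1 z2 where z: "0 \<le> z1" "z1 < z2" "z2 < pi/2" "p n z1 = 0" "p n z2 = 0"
      using two_zeros[OF 2(2)] by blast
    have "card (nodal_domains u) \<le> 4 * card Z - 4" by (rule card_nodal_positive[OF pos Z(1,3) z])
    then have "card (nodal_domains u) \<le> 4 * n - 4" using Z(2) by linarith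
    then show ?thesis by (simp add: v)
  next
    case 3
    then obtain m where m: "n = 2 * m" by auto
    let ?z = "pi / (2 * \<alpha> n)"
    \<comment> \<open>The index 0 is left out: it belongs to the first zero \<open>?z\<close> of the
      cosine, before which \<open>W\<close> is negative.\<close>
    let ?Z = "(\<lambda>k::int. (real_of_int k * pi + pi/2) / \<alpha> n) ` {1..<int m}"
    have "card ?Z \<le> m - 1" by (rule order.trans[OF card_image_le]) auto
    moreover have "card (nodal_domains u) \<le> 8 * card ?Z + 6"
    proof (rule card_nodal_odd_even)
      show "0 < ?z" "?z < pi/2" using first_zero[OF n] 3 by auto
      show "W x \<noteq> 0" if x: "0 < x" "x < ?z" for x
      proof -
        have ax: "0 < \<alpha> n * x" "\<alpha> n * x < pi/2" using x freq_pos[of n] by (simp_all add: field_simps)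
        have "cos (\<alpha> n * x) > 0" "sin (\<alpha> n * x) > 0"
          using ax by (auto intro!: cos_gt_zero sin_gt_zero)
        then have "p n x > 0" "p' n x < 0" using n 3 freq_pos[of n] by (auto simp: mode_def dmode_def)
        moreover have "p i x > 0" "p' i x > 0" using x(1) freq_pos[of 1] 3 by (auto simp: mode_def dmode_def)
        ultimately have "p' n x * p i x < 0" "p n x * p' i x > 0" by (auto intro: mult_neg_pos)
        then show ?thesis by (simp add: W_def)
      qed
      show "x \<in> ?Z" if x: "?z < x" "x < pi/2" "p n x = 0" for x
      proof -
        have "0 < ?z" using first_zero[OF n] 3 by auto
        then have "\<bar>x\<bar> < pi/2" using x by simp
        from zeros_even[OF n m this x(3)] obtain k :: int where
          k: "k \<in> {- int m..<int m}" "x = (real_of_int k * pi + pi/2) / \<alpha> n" by blast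
        have "?z * \<alpha> n < x * \<alpha> n" using x(1) freq_pos[of n] by (intro mult_strict_right_mono)
        then have "pi/2 < real_of_int k * pi + pi/2" using k(2) freq_pos[of n] by simp
        then have "0 < k" by (simp add: zero_less_mult_iff)
        then show ?thesis using k by auto
      qed
      show "p n 0 > 0" using n 3 by (simp add: mode_def)
    qed (use 3 in auto)
    ultimately show ?thesis using m n 3(1) by (simp add: v)
  next
    case 4
    then obtain m where m: "n = 2 * m + 1" by (metis oddE)
    let ?Z = "(\<lambda>k::int. real_of_int k * pi / \<alpha> n) ` {1..int m}"
    have "card ?Z \<le> m" by (rule order.trans[OF card_image_le]) auto
    moreover have "card (nodal_domains u) \<le> 8 * card ?Z"
    proof (rule card_nodal_odd_odd)
      show "x \<in> ?Z" if x: "0 < x" "x < pi/2" "p n x = 0" for x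
      proof -
        have "\<bar>x\<bar> < pi/2" using x by simp
        from zeros_odd[OF n m this x(3)] obtain k :: int where
          k: "k \<in> {- int m..int m}" "x = real_of_int k * pi / \<alpha> n" by blast
        have "0 < k" using x(1) freq_pos[of n] unfolding k(2) by (simp add: zero_less_mult_iff zero_less_divide_iff)
        then show ?thesis using k by auto
      qed
    qed (use 4 in auto)
    ultimately show ?thesis using m n 4(1) by (simp add: v)
  qed
qed

lemma not_courant_sharp:
  assumes k: "k \<ge> 6" and neg: "ev k < 0"
  shows "\<not> courant_sharp (- H) k"
proof
  assume "courant_sharp (- H) k"
  then obtain u where u: "u \<in> robin_eigenspace (- H) (ev k)" "\<not> (AE x in area. u x = 0)"
    "continuous_on square u" "card (nodal_domains u) = k"
    unfolding courant_sharp_def by blast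
  obtain i n where i: "i < 2" and n: "n \<ge> 2" and V: "V (i, n) = ev k"
    and set: "{q. V q = ev k} = {(i, n), (n, i)}" and low: "4 * n - 3 + 2 * i \<le> k"
    using spectral_structure[OF k neg] by blast
  obtain a b where ab: "\<And>z. z \<in> square \<Longrightarrow> u z = a * (p i (fst z) * p n (snd z)) + b * (p n (fst z) * p i (snd z))"
    using eigenfunction_form[OF u(1,3) set] i n by fastforce
  let ?v = "\<lambda>z. a * (p i (fst z) * p n (snd z)) + b * (p n (fst z) * p i (snd z))"
  have "a \<noteq> 0 \<or> b \<noteq> 0"
  proof (rule ccontr)
    assume "\<not> (a \<noteq> 0 \<or> b \<noteq> 0)"
    then have "AE x in area. u x = 0" using ab by (intro AE_I2) (simp add: space_restrict_space)
    then show False using u(2) by simp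
  qed
  moreover have "\<mu> i + \<mu> n < 0" using V neg by (simp add: V_def)
  ultimately have "card (nodal_domains ?v) \<le> max 5 (4 * n - 4 + 2 * i)" by (intro nodal_bound[OF i n])
  moreover have "square - u -` {0} = square - ?v -` {0}" using ab by auto
  then have "nodal_domains u = nodal_domains ?v" by (simp add: nodal_domains_def)
  ultimately show False using u(4) k low n by auto
qed

end

theorem theorem1p6:
  "\<exists>hstar::real. hstar < 0 \<and>
     (\<forall>h<hstar. \<forall>k\<ge>6. robin_eigenvalue h k < 0 \<longrightarrow> \<not> courant_sharp h k)"
proof (intro exI[of _ "-12"] conjI allI impI)
  fix h :: real and k :: nat
  assume h: "h < -12" and k: "k \<ge> 6" and neg: "robin_eigenvalue h k < 0"
  interpret robin "- h" using h by unfold_locales simp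
  show "\<not> courant_sharp h k" using not_courant_sharp[OF k] neg by simp
qed simp

end
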